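(* Let $\beta=\frac12+\frac{\log(5/3)}{\log 4}$ and $m\ge 0$. The trace map $T_m$ (restriction to $\mathrm{SG}_m$) is continuous from $\mathrm{dom}\,\mathcal{E}$ to $H^\beta(\mathrm{SG}_m)$, with $$\|T_mF\|_{H^\beta(\mathrm{SG}_m)}^2\le c\,\mathcal{E}(F)$$ for all $F\in\mathrm{dom}\,\mathcal{E}$. Moreover, there exists a continuous linear extension map $E_m:H^\beta(\mathrm{SG}_m)\to\mathrm{dom}\,\mathcal{E}$ with $T_mE_mf=f$ and $$\mathcal{E}(E_mf)\le c\,\|f\|_{H^\beta(\mathrm{SG}_m)}^2$$ for all $f\in H^\beta(\mathrm{SG}_m)$. Here $c$ is a constant independent of $F$ and $f$.
   Context: Let $q_0,q_1,q_2$ be the vertices of an equilateral triangle of side length $1$ in the plane, and $\Phi_i(x)=\frac12x+\frac12q_i$. The Sierpinski gasket $\mathrm{SG}$ is the unique nonempty compact set with $\mathrm{SG}=\bigcup_{i=0}^2\Phi_i(\mathrm{SG})$. For a word $w=(w_1,\dots,w_m)\in\{0,1,2\}^m$ write $|w|=m$ and $\Phi_w=\Phi_{w_1}\circ\cdots\circ\Phi_{w_m}$. For a function $f$ on $\mathrm{SG}$ let $E_m(f)=\sum_{i\ne j}\sum_{|w|=m}|f(\Phi_wq_i)-f(\Phi_wq_j)|^2$ and $\mathcal{E}(f)=\lim_{m\to\infty}(5/3)^mE_m(f)$ (the sequence is nondecreasing); $\mathrm{dom}\,\mathcal{E}$ is the space of functions (continuous on $\mathrm{SG}$) for which this limit is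 finite. $\mathrm{SG}_m$ is the metric graph whose vertices are the points $\Phi_wq_i$ ($|w|=m$, $i=0,1,2$) and whose edges are the segments $\Phi_w(e_{ij})$, $|w|=m$, where $e_{ij}$ is the side of the original triangle joining $q_i$ and $q_j$; each edge has length $2^{-m}$ (equivalently $\mathrm{SG}_m=\mathrm{SG}\cap$ the triangular grid of side $2^{-m}$). For a metric graph $G$ with edges $e$ of length $L_e$ parametrized by arclength $x\mapsto e(x)$, $H^\beta(G)$ is the space of continuous functions $F$ on $G$ (modulo constants) with $$\|F\|_{H^\beta(G)}^2=\sum_{e}\int_0^{L_e}\int_0^{L_e}\frac{|F(e(x))-F(e(y))|^2}{|x-y|^{1+2\beta}}\,dx\,dy<\infty.$$ *)

theory Defs
  imports "HOL-Analysis.Analysis"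
begin

definition q :: "nat \<Rightarrow> complex" where
  "q i = (if i = 0 then 0 else if i = 1 then 1 else cis (pi / 3))"

definition Phi :: "nat \<Rightarrow> complex \<Rightarrow> complex" where
  "Phi i x = x / 2 + q i / 2"

definition Phiw :: "nat list \<Rightarrow> complex \<Rightarrow> complex" where
  "Phiw w = foldr (\<lambda>i f. Phi i \<circ> f) w id"

definition words :: "nat \<Rightarrow> nat list set" where
  "words m = {w. length w = m \<and> set w \<subseteq> {0..<3}}"

definition SG :: "complex set" where
  "SG = (THE K. compact K \<and> K \<noteq> {} \<and> K = (\<Union>i\<in>{0..<3}. Phi i ` K))"

definition Em :: "nat \<Rightarrow> (complex \<Rightarrow> real) \<Rightarrow> real" where
  "Em m f = (\<Sum>i\<in>{0..<3}. \<Sum>j\<in>{0..<3} - {i}. \<Sum>w\<in>words m.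
              \<bar>f (Phiw w (q i)) - f (Phiw w (q j))\<bar>^2)"

definition dom_energy :: "(complex \<Rightarrow> real) set" where
  "dom_energy = {f. continuous_on SG f \<and> convergent (\<lambda>m. (5/3::real)^m * Em m f)}"

definition energy :: "(complex \<Rightarrow> real) \<Rightarrow> real" where
  "energy f = lim (\<lambda>m. (5/3::real)^m * Em m f)"

text \<open>Edge Phi_w(e_ij) of SG_m (i<j), parametrised by arclength on [0, 2^-m].\<close>
definition edge :: "nat \<Rightarrow> nat list \<Rightarrow> nat \<Rightarrow> nat \<Rightarrow> real \<Rightarrow> complex" where
  "edge m w i j x = Phiw w (q i) + complex_of_real (x * 2^m) * (Phiw w (q j) - Phiw w (q i))"

definition edges :: "nat \<Rightarrow> (nat list \<times> nat \<times> nat) set" where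
  "edges m = {(w, i, j). w \<in> words m \<and> i < j \<and> j < 3}"

definition SGm :: "nat \<Rightarrow> complex set" where
  "SGm m = (\<Union>(w, i, j)\<in>edges m. edge m w i j ` {0..(1/2)^m})"

definition Hnorm2 :: "real \<Rightarrow> nat \<Rightarrow> (complex \<Rightarrow> real) \<Rightarrow> ennreal" where
  "Hnorm2 \<beta> m F = (\<Sum>(w, i, j)\<in>edges m.
      \<integral>\<^sup>+ x\<in>{0..(1/2::real)^m}. \<integral>\<^sup>+ y\<in>{0..(1/2::real)^m}.
        ennreal (\<bar>F (edge m w i j x) - F (edge m w i j y)\<bar>^2 / \<bar>x - y\<bar> powr (1 + 2*\<beta>))
      \<partial>lborel \<partial>lborel)"

definition Hspace :: "real \<Rightarrow> nat \<Rightarrow> (complex \<Rightarrow> real) set" where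
  "Hspace \<beta> m = {F. continuous_on (SGm m) F \<and> Hnorm2 \<beta> m F < \<infinity>}"

end

(* On one side of a triangle both spaces are governed by the dyadic increments of the function:
   since 2^(1+2 beta) = 20/3, the seminorm of u on [0,1] is comparable with
   sum_n (5/3)^n sum_k |u((k+1)/2^n) - u(k/2^n)|^2.
   Trace: the energy of the cells of level n that touch a fixed side decays geometrically, up to
   the increments of the total energy, because a harmonic function leaves a fixed proportion of
   its energy in the cell opposite to the side; hence the sum above is bounded by the energy.
   Extension: values at new vertices off the skeleton are copied from a boundary value at
   comparable distance, so that a cell without a side on the skeleton arises with an energy
   bounded by dyadic increments of its scale; inside such a cell the extension is harmonic.
   This defines a function of finite energy on the vertices, which is Hoelder continuous there. *)
theory Submission
  imports Defs
begin

section \<open>Barycentric geometry of the gasket\<close>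

text \<open>The number 20/3 is 4 times 5/3: 5/3 renormalises the energy and 4 is the area factor of
  halving a square. A double integral does not see single points, so an increment of the function is
  recovered from it only as the limit of a chain of points shrinking to an end point. Each link of
  the chain may cost a factor below 5/3. The usual 2 of a squared sum is too expensive there; an
  unequal splitting costs 3/2 and leaves the convergent ratio 9/10. In the converse estimate the
  factor 2 is harmless, because the dyadic intervals shrink at the same rate. Harmonic extension of
  vertex values alone would ignore the boundary function between the vertices. The construction
  therefore carries, with every cell, the set of its sides that lie on the skeleton, and the energy
  of a cell is bounded separately for zero, one, two and three such sides. Copied values are charged
  to increments of the next generation, so that each scale is paid a bounded number of times. As a
  vertex has several addresses, the value built along one address must be shown to be that along any
  other.\<close>

definition bary :: "nat \<Rightarrow> complex \<Rightarrow> real" where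
  "bary l z = (if l = 0 then 1 - Re z - Im z / sqrt 3
              else if l = 1 then Re z - Im z / sqrt 3 else 2 * Im z / sqrt 3)"

lemma less3E:
  assumes "i < (3::nat)" obtains "i = 0" | "i = 1" | "i = 2"
  using assms by linarith

lemma q_simps [simp]: "q 0 = 0" "q (Suc 0) = 1" "q 2 = Complex (1/2) (sqrt 3 / 2)"
  by (auto simp: q_def complex_eq_iff cos_60 sin_60)

lemma bary_q: "l < 3 \<Longrightarrow> i < 3 \<Longrightarrow> bary l (q i) = (if l = i then 1 else 0)"
  by (elim less3E) (simp_all add: bary_def)

lemma Re_Phi: "Re (Phi i z) = Re z / 2 + Re (q i) / 2"
  and Im_Phi: "Im (Phi i z) = Im z / 2 + Im (q i) / 2"
  by (simp_all add: Phi_def)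

lemma bary_Phi: "l < 3 \<Longrightarrow> i < 3 \<Longrightarrow> bary l (Phi i z) = bary l z / 2 + (if l = i then 1/2 else 0)"
  by (elim less3E) (simp_all add: bary_def Re_Phi Im_Phi diff_divide_distrib add_divide_distrib)

lemma bary_sum: "bary 0 z + bary 1 z + bary 2 z = 1"
  by (simp add: bary_def field_simps)

lemma bary_sum_perm:
  "{i, j, l} = {0, 1, 2} \<Longrightarrow> bary i z + bary j z + bary l z = 1"
proof -
  assume e: "{i, j, l} = {0, 1, 2}"
  have "card {i, j, l} = 3" unfolding e by simp
  then have d: "i \<noteq> j" "j \<noteq> l" "i \<noteq> l" by (simp_all add: card_insert_if split: if_splits)
  have "bary i z + bary j z + bary l z = (\<Sum>k\<in>{i, j, l}. bary k z)" using d by simp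
  also have "\<dots> = (\<Sum>k\<in>{0, 1, 2}. bary k z)" by (simp only: e)
  also have "\<dots> = 1" using bary_sum[of z] by simp
  finally show ?thesis .
qed

lemma bary_affine: "bary l (z + of_real s * (z' - z)) = (1 - s) * bary l z + s * bary l z'"
  by (simp add: bary_def field_simps)

text \<open>An l1 distance, equivalent to the norm. Every \<open>Phi i\<close> acts on barycentric
  coordinates by halving and a shift, so separation of cells becomes a matter of linear
  inequalities.\<close>

definition bary_dist :: "complex \<Rightarrow> complex \<Rightarrow> real" where
  "bary_dist x y = (\<Sum>l<3. \<bar>bary l x - bary l y\<bar>)"

lemma bary_dist_expand: "bary_dist x y = \<bar>bary 0 x - bary 0 y\<bar> + \<bar>bary 1 x - bary 1 y\<bar> + \<bar>bary 2 x - bary 2 y\<bar>"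
  by (simp add: bary_dist_def eval_nat_numeral)

lemma bary_le_bary_dist: "l < 3 \<Longrightarrow> \<bar>bary l x - bary l y\<bar> \<le> bary_dist x y"
  unfolding bary_dist_def by (rule member_le_sum) auto

lemma bary_dist_commute: "bary_dist x y = bary_dist y x"
  by (simp add: bary_dist_expand abs_minus_commute)

lemma bary_dist_Phi: "i < 3 \<Longrightarrow> bary_dist (Phi i x) (Phi i y) = bary_dist x y / 2"
proof -
  assume i: "i < 3"
  have "\<bar>bary l (Phi i x) - bary l (Phi i y)\<bar> = \<bar>bary l x - bary l y\<bar> / 2" if "l < 3" for l
    using that i by (simp add: bary_Phi abs_if field_simps)
  then have "(\<Sum>l<3. \<bar>bary l (Phi i x) - bary l (Phi i y)\<bar>) = (\<Sum>l<3. \<bar>bary l x - bary l y\<bar> / 2)"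
    by (intro sum.cong) auto
  then show ?thesis by (simp only: bary_dist_def sum_divide_distrib)
qed

lemma bary_dist_le_norm: "bary_dist x y \<le> 6 * norm (x - y)"
proof -
  have r: "\<bar>Re x - Re y\<bar> \<le> norm (x - y)" and i: "\<bar>Im x - Im y\<bar> \<le> norm (x - y)"
    using abs_Re_le_cmod[of "x - y"] abs_Im_le_cmod[of "x - y"] by auto
  have s: "1 \<le> sqrt 3" by simp
  have "\<bar>(Im x - Im y) / sqrt 3\<bar> \<le> \<bar>Im x - Im y\<bar>"
    using s by (simp add: abs_divide divide_le_eq mult_left_le mult_le_cancel_left1)
  then have i': "\<bar>Im x / sqrt 3 - Im y / sqrt 3\<bar> \<le> norm (x - y)" using i by (simp add: diff_divide_distrib)
  have "bary 2 x - bary 2 y = 2 * (Im x / sqrt 3 - Im y / sqrt 3)" by (simp add: bary_def)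
  then show ?thesis using r i' unfolding bary_dist_expand by (simp add: bary_def)
qed

lemma bary_decomp: "z = (\<Sum>l<3. of_real (bary l z) * q l)"
  by (simp add: eval_nat_numeral complex_eq_iff) (simp add: bary_def field_simps flip: numeral_2_eq_2)

lemma norm_q_le: "norm (q l) \<le> 1"
  by (simp add: q_def)

lemma norm_le_bary_dist: "norm (x - y) \<le> bary_dist x y"
proof -
  have "x - y = (\<Sum>l<3. of_real (bary l x - bary l y) * q l)"
    using bary_decomp[of x] bary_decomp[of y] by (simp add: left_diff_distrib sum_subtractf)
  then have "norm (x - y) \<le> (\<Sum>l<3. norm (of_real (bary l x - bary l y) * q l))"
    by (metis norm_sum)
  also have "\<dots> \<le> (\<Sum>l<3. \<bar>bary l x - bary l y\<bar>)"
    by (intro sum_mono) (simp add: norm_mult mult_left_le norm_q_le del: of_real_diff)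
  finally show ?thesis by (simp add: bary_dist_def)
qed

lemma bary_eqI: "(\<And>l. l < 3 \<Longrightarrow> bary l x = bary l y) \<Longrightarrow> x = y"
  using norm_le_bary_dist[of x y] by (simp add: bary_dist_def)

lemma Phi_q_commute: "Phi i (q j) = Phi j (q i)"
  by (simp add: Phi_def)

lemma Phi_q_same [simp]: "Phi i (q i) = q i"
  by (simp add: Phi_def)

lemma Phi_inj: "Phi i x = Phi i y \<longleftrightarrow> x = y"
  by (simp add: Phi_def)

lemma Phiw_Nil [simp]: "Phiw [] x = x" and Phiw_Cons [simp]: "Phiw (i # w) x = Phi i (Phiw w x)"
  by (simp_all add: Phiw_def)

lemma Phiw_append: "Phiw (v @ w) x = Phiw v (Phiw w x)"
  by (induction v) auto

lemma Phiw_affine: "Phiw w (x + of_real s * (y - x)) = Phiw w x + of_real s * (Phiw w y - Phiw w x)"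
proof (induction w)
  case (Cons a w)
  have "Phi a (u + of_real s * (v - u)) = Phi a u + of_real s * (Phi a v - Phi a u)" for u v
    by (simp add: Phi_def field_simps)
  then show ?case using Cons by simp
qed simp

section \<open>Vertices of all levels, junctions of cells, and the gasket as a closure\<close>

definition vertices :: "complex set" where
  "vertices = {Phiw w (q i) | w i. set w \<subseteq> {..<3} \<and> i < 3}"

lemma VertI: "set w \<subseteq> {..<3} \<Longrightarrow> i < 3 \<Longrightarrow> Phiw w (q i) \<in> vertices"
  by (auto simp: vertices_def)

lemma q_vertices: "i < 3 \<Longrightarrow> q i \<in> vertices"
  using VertI[of "[]" i] by simp

lemma Phi_vertices: "i < 3 \<Longrightarrow> x \<in> vertices \<Longrightarrow> Phi i x \<in> vertices"
proof -
  assume i: "i < 3" and "x \<in> vertices"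
  then obtain w k where "set w \<subseteq> {..<3}" "k < 3" "x = Phiw w (q k)" by (auto simp: vertices_def)
  then show ?thesis using VertI[of "i # w" k] i by simp
qed

lemma Phiw_vertices: "set w \<subseteq> {..<3} \<Longrightarrow> x \<in> vertices \<Longrightarrow> Phiw w x \<in> vertices"
  by (induction w) (auto simp: Phi_vertices)

lemma vertices_cases:
  assumes "x \<in> vertices" obtains i y where "i < 3" "y \<in> vertices" "x = Phi i y"
proof -
  obtain w k where w: "set w \<subseteq> {..<3}" "k < 3" "x = Phiw w (q k)" using assms by (auto simp: vertices_def)
  show ?thesis
  proof (cases w)
    case Nil then show ?thesis using that[of k "q k"] w q_vertices by simp
  next
    case (Cons a v) then show ?thesis using that[of a "Phiw v (q k)"] w VertI[of v k] by simp
  qed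
qed

lemma vertices_eq: "vertices = (\<Union>i<3. Phi i ` vertices)"
proof
  show "vertices \<subseteq> (\<Union>i<3. Phi i ` vertices)" by (blast elim: vertices_cases)
qed (auto intro: Phi_vertices)

lemma bary_Phiw_q_nonneg: "set w \<subseteq> {..<3} \<Longrightarrow> i < 3 \<Longrightarrow> l < 3 \<Longrightarrow> 0 \<le> bary l (Phiw w (q i))"
  by (induction w) (auto simp: bary_q bary_Phi)

lemma bary_vertices_nonneg: "x \<in> vertices \<Longrightarrow> l < 3 \<Longrightarrow> 0 \<le> bary l x"
  by (auto simp: vertices_def bary_Phiw_q_nonneg)

lemma third_index:
  assumes "i < (3::nat)" "j < 3" "i \<noteq> j"
  obtains l where "l < 3" "l \<noteq> i" "l \<noteq> j" "{i, j, l} = {0, 1, 2}"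
proof -
  have "{i, j, 3 - i - j} = {0, 1, 2} \<and> 3 - i - j < 3 \<and> 3 - i - j \<noteq> i \<and> 3 - i - j \<noteq> j"
    using assms by (elim less3E) auto
  then show ?thesis using that by blast
qed

text \<open>Coordinate \<open>j\<close> is at least 1/2 throughout cell \<open>j\<close>, while for
  a point of cell \<open>i\<close> its deficit from 1/2 is half the distance to the junction.
  Getting from cell \<open>i\<close> to cell \<open>j\<close> thus costs a fixed share of the
  distance to the junction.\<close>

lemma junction_bary_dist:
  assumes "i < 3" "j < 3" "i \<noteq> j" "x \<in> vertices" "y \<in> vertices"
  shows "bary_dist (Phi i x) (Phi i (q j)) \<le> 4 * bary_dist (Phi i x) (Phi j y)"
proof -
  obtain l where l: "l < 3" "l \<noteq> i" "l \<noteq> j" "{i, j, l} = {0, 1, 2}" by (rule third_index[OF assms(1-3)])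
  note nn = bary_vertices_nonneg[OF assms(4)] bary_vertices_nonneg[OF assms(5)]
  let ?d = "bary_dist (Phi i x) (Phi j y)"
  have s: "bary i z + bary j z + bary l z = 1" for z by (rule bary_sum_perm[OF l(4)])
  have a: "\<bar>bary i (Phi i x) - bary i (Phi j y)\<bar> \<le> ?d" "\<bar>bary j (Phi i x) - bary j (Phi j y)\<bar> \<le> ?d"
    using assms(1,2) by (simp_all add: bary_le_bary_dist)
  have p: "bary i (Phi i x) = bary i x / 2 + 1/2" "bary i (Phi j y) = bary i y / 2"
     "bary j (Phi i x) = bary j x / 2" "bary j (Phi j y) = bary j y / 2 + 1/2" "bary l (Phi i x) = bary l x / 2"
     "bary i (Phi i (q j)) = 1/2" "bary j (Phi i (q j)) = 1/2" "bary l (Phi i (q j)) = 0"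
    using assms(1-3) l(1-3) by (simp_all add: bary_Phi bary_q)
  have n: "0 \<le> bary i x" "0 \<le> bary j x" "0 \<le> bary l x" "0 \<le> bary i y" "0 \<le> bary j y" "0 \<le> bary l y"
    using nn l(1) assms(1,2) by auto
  have "bary_dist (Phi i x) (Phi i (q j)) = (\<Sum>k\<in>{i,j,l}. \<bar>bary k (Phi i x) - bary k (Phi i (q j))\<bar>)"
    unfolding bary_dist_def l(4) by (rule sum.cong) auto
  also have "\<dots> = \<bar>bary i x / 2\<bar> + \<bar>bary j x / 2 - 1/2\<bar> + \<bar>bary l x / 2\<bar>"
    using l(2,3) assms(3) by (simp add: p)
  also have "\<dots> = bary i x / 2 + (1/2 - bary j x / 2) + bary l x / 2"
    using n s[of x] by simp
  finally have e: "bary_dist (Phi i x) (Phi i (q j)) = bary i x / 2 + (1/2 - bary j x / 2) + bary l x / 2" .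
  have "bary i (Phi i x) - bary i (Phi j y) \<le> ?d" "bary j (Phi j y) - bary j (Phi i x) \<le> ?d" using a by auto
  then have "bary i x / 2 + 1/2 - bary i y / 2 \<le> ?d" "bary j y / 2 + 1/2 - bary j x / 2 \<le> ?d" using p by auto
  then show ?thesis using e n s[of x] s[of y] by linarith
qed

lemma junction_unique:
  assumes "i < 3" "j < 3" "i \<noteq> j" "x \<in> vertices" "y \<in> vertices" "Phi i x = Phi j y"
  shows "x = q j"
proof -
  have "bary_dist (Phi i x) (Phi i (q j)) \<le> 0"
    using junction_bary_dist[OF assms(1-5)] assms(6) by (simp add: bary_dist_def)
  then have "norm (Phi i x - Phi i (q j)) \<le> 0" using norm_le_bary_dist order_trans by blast
  then have "Phi i x = Phi i (q j)" by simp
  then show ?thesis by (simp add: Phi_inj)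
qed

lemma bary_one_imp_q:
  assumes "i < 3" "x \<in> vertices" "bary i x = 1" shows "x = q i"
proof (rule bary_eqI)
  fix l assume l: "l < (3::nat)"
  have "0 \<le> bary 0 x" "0 \<le> bary 1 x" "0 \<le> bary 2 x" using bary_vertices_nonneg assms by auto
  then have "bary l x = (if l = i then 1 else 0)"
    using bary_sum[of x] assms(3) l assms(1) by (elim less3E) simp_all
  then show "bary l x = bary l (q i)" using l assms by (simp add: bary_q)
qed

text \<open>Coordinate \<open>i\<close> is at most 1 on vertices and equals 1 only at
  \<open>q i\<close>; after \<open>Phi a\<close> with another \<open>a\<close> it is at most 1/2.
  Hence every letter in an address of a corner is that corner's index.\<close>

lemma corner_unique:
  assumes "i < 3" "a < 3" "x \<in> vertices" "Phi a x = q i"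
  shows "a = i \<and> x = q i"
proof -
  have nn: "0 \<le> bary 0 x" "0 \<le> bary 1 x" "0 \<le> bary 2 x" using bary_vertices_nonneg[OF assms(3)] by auto
  from assms(1) have le: "bary i x \<le> 1"
    by (rule less3E; hypsubst) (use nn bary_sum[of x] in linarith)+
  have "bary i (Phi a x) = 1" using assms(1) by (simp add: assms(4) bary_q)
  then have "bary i x / 2 + (if i = a then 1/2 else 0) = 1" using assms(1,2) by (simp only: bary_Phi)
  then have "a = i" "bary i x = 1" using le by (simp_all split: if_splits)
  then show ?thesis using bary_one_imp_q assms by auto
qed

lemma closure_Phi: "Phi i ` closure S = closure (Phi i ` S)"
proof -
  have e: "Phi i ` X = (\<lambda>x. q i / 2 + x) ` ((\<lambda>x. (1/2) *\<^sub>R x) ` X)" for X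
    by (auto simp: Phi_def image_image scaleR_conv_of_real)
  show ?thesis unfolding e by (simp add: closure_translation closure_scaleR)
qed

lemma continuous_Phi [continuous_intros]: "continuous_on S f \<Longrightarrow> continuous_on S (\<lambda>x. Phi i (f x))"
  unfolding Phi_def by (intro continuous_intros) auto

lemma dist_Phi: "dist (Phi i x) (Phi i y) = dist x y / 2"
proof -
  have "Phi i x - Phi i y = (x - y) / 2" by (simp add: Phi_def field_simps)
  then show ?thesis by (simp only: dist_norm norm_divide) simp
qed

lemma dist_Phiw: "dist (Phiw w x) (Phiw w y) = dist x y / 2 ^ length w"
  by (induction w) (auto simp: dist_Phi)

lemma bounded_vertices: "bounded vertices"
proof (rule boundedI)
  fix x assume x: "x \<in> vertices"
  have "norm (x - q 0) \<le> bary_dist x (q 0)" by (rule norm_le_bary_dist)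
  also have "\<dots> \<le> 2" using bary_vertices_nonneg[OF x, of 0] bary_vertices_nonneg[OF x, of 1] bary_vertices_nonneg[OF x, of 2] bary_sum[of x]
    by (simp add: bary_dist_expand bary_q del: q_simps)
  finally show "norm x \<le> 2" by simp
qed

text \<open>An invariant set contains the fixed points \<open>q i\<close> as limits of iterates,
  hence all vertices. Conversely each of its points is \<open>Phiw w y\<close> with a long word
  \<open>w\<close>, and \<open>Phiw w (q 0)\<close> is a vertex within
  \<open>diameter K / 2^n\<close> of it.\<close>

lemma invariant_set_unique:
  assumes "compact K" "K \<noteq> {}" "K = (\<Union>i\<in>{0..<3}. Phi i ` K)"
  shows "K = closure vertices"
proof
  have cl: "closed K" using assms compact_imp_closed by auto
  have im: "Phi i x \<in> K" if "i < 3" "x \<in> K" for i x by (subst assms(3)) (use that in auto)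
  obtain x0 where x0: "x0 \<in> K" using assms by auto
  have qK: "q i \<in> K" if i: "i < 3" for i
  proof -
    have mem: "(Phi i ^^ n) x0 \<in> K" for n by (induction n) (auto simp: x0 im i)
    have d: "dist ((Phi i ^^ n) x0) (q i) = dist x0 (q i) * (1/2) ^ n" for n
    proof (induction n)
      case (Suc n)
      have "dist (Phi i ((Phi i ^^ n) x0)) (Phi i (q i)) = dist ((Phi i ^^ n) x0) (q i) / 2" by (rule dist_Phi)
      then show ?case using Suc by simp
    qed simp
    have "(\<lambda>n. dist x0 (q i) * (1/2) ^ n) \<longlonglongrightarrow> dist x0 (q i) * 0"
      by (intro tendsto_intros LIMSEQ_realpow_zero) auto
    then have "(\<lambda>n. (Phi i ^^ n) x0) \<longlonglongrightarrow> q i"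
      by (subst tendsto_dist_iff) (simp add: d)
    then show ?thesis using closed_sequentially[OF cl, of "\<lambda>n. (Phi i ^^ n) x0"] mem by blast
  qed
  have "Phiw w (q i) \<in> K" if "set w \<subseteq> {..<3}" "i < 3" for w i
    using that by (induction w) (auto simp: qK im)
  then show "closure vertices \<subseteq> K" using cl by (intro closure_minimal) (auto simp: vertices_def)
  have split: "\<exists>w y. set w \<subseteq> {..<3} \<and> length w = n \<and> y \<in> K \<and> x = Phiw w y" if "x \<in> K" for n x
    using that
  proof (induction n arbitrary: x)
    case 0 then show ?case by (intro exI[of _ "[]"]) auto
  next
    case (Suc n)
    then have "x \<in> (\<Union>i\<in>{0..<3}. Phi i ` K)" using assms(3) by blast
    then obtain i x' where i: "i < 3" "x' \<in> K" "x = Phi i x'" by auto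
    obtain w y where "set w \<subseteq> {..<3}" "length w = n" "y \<in> K" "x' = Phiw w y" using Suc.IH[OF i(2)] by blast
    then show ?case using i by (intro exI[of _ "i # w"] exI[of _ y]) auto
  qed
  have bd: "bounded K" using assms compact_imp_bounded by auto
  show "K \<subseteq> closure vertices"
  proof
    fix x assume x: "x \<in> K"
    show "x \<in> closure vertices" unfolding closure_approachable
    proof (intro allI impI)
      fix e :: real assume e: "0 < e"
      have "(\<lambda>n. (diameter K + 1) * (1/2) ^ n) \<longlonglongrightarrow> (diameter K + 1) * 0"
        by (intro tendsto_intros LIMSEQ_realpow_zero) auto
      then have "eventually (\<lambda>n. (diameter K + 1) * (1/2) ^ n < e) sequentially"
        using e by (intro order_tendstoD) auto
      then obtain n where n: "(diameter K + 1) * (1/2) ^ n < e" by (auto simp: eventually_sequentially)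
      obtain w y where w: "set w \<subseteq> {..<3}" "length w = n" "y \<in> K" "x = Phiw w y" using split[OF x] by blast
      have "dist (Phiw w (q 0)) x = dist (q 0) y * (1/2) ^ n" by (simp add: w dist_Phiw power_divide del: q_simps)
      also have "\<dots> \<le> (diameter K + 1) * (1/2) ^ n"
        using diameter_bounded_bound[OF bd qK[of 0] w(3)] by (intro mult_right_mono) auto
      finally show "\<exists>y\<in>vertices. dist y x < e" using n w VertI[of w 0] by (intro bexI[of _ "Phiw w (q 0)"]) auto
    qed
  qed
qed

lemma SG_eq: "SG = closure vertices"
proof -
  have "closure vertices = (\<Union>i<3. Phi i ` closure vertices)"
    unfolding closure_Phi by (subst vertices_eq) (simp add: eval_nat_numeral lessThan_Suc)
  then have 1: "closure vertices = (\<Union>i\<in>{0..<3}. Phi i ` closure vertices)"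
    by (simp only: atLeast0LessThan)
  show ?thesis unfolding SG_def
  proof (rule the_equality)
    show "compact (closure vertices) \<and> closure vertices \<noteq> {} \<and> closure vertices = (\<Union>i\<in>{0..<3}. Phi i ` closure vertices)"
      using bounded_vertices q_vertices[of 0] 1 by (auto simp: compact_closure)
  qed (use invariant_set_unique in auto)
qed

lemma vertices_SG: "x \<in> vertices \<Longrightarrow> x \<in> SG"
  by (simp add: SG_eq closure_subset[THEN subsetD])

lemma Phi_SG: "i < 3 \<Longrightarrow> x \<in> SG \<Longrightarrow> Phi i x \<in> SG"
proof -
  assume i: "i < 3" and x: "x \<in> SG"
  have "Phi i x \<in> closure (Phi i ` vertices)" using x by (simp add: SG_eq flip: closure_Phi)
  also have "\<dots> \<subseteq> closure vertices" using i Phi_vertices by (intro closure_mono) auto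
  finally show ?thesis by (simp add: SG_eq)
qed

lemma Phiw_SG: "set w \<subseteq> {..<3} \<Longrightarrow> x \<in> SG \<Longrightarrow> Phiw w x \<in> SG"
  by (induction w) (auto simp: Phi_SG)

section \<open>Sides of the triangle and dyadic approximation of their parameters\<close>

definition side_point :: "nat \<Rightarrow> nat \<Rightarrow> real \<Rightarrow> complex" where
  "side_point i j s = q i + of_real s * (q j - q i)"

lemma Phi_side_point_left: "Phi i (side_point i j s) = side_point i j (s / 2)"
  and Phi_side_point_right: "Phi j (side_point i j s) = side_point i j ((1 + s) / 2)"
  by (simp_all add: side_point_def Phi_def field_simps)

lemma side_point_dyadic_vertices:
  assumes "i < 3" "j < 3" shows "k \<le> 2 ^ n \<Longrightarrow> side_point i j (real k / 2 ^ n) \<in> vertices"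
proof (induction n arbitrary: k)
  case 0
  then have "k = 0 \<or> k = 1" by auto
  then show ?case using assms by (auto simp: side_point_def q_vertices)
next
  case (Suc n)
  show ?case
  proof (cases "k \<le> 2 ^ n")
    case True
    then have "Phi i (side_point i j (real k / 2 ^ n)) \<in> vertices" using Suc assms Phi_vertices by blast
    then show ?thesis by (simp add: Phi_side_point_left mult.commute)
  next
    case False
    then have "k - 2 ^ n \<le> 2 ^ n" using Suc by auto
    then have "Phi j (side_point i j (real (k - 2 ^ n) / 2 ^ n)) \<in> vertices" using Suc assms Phi_vertices by blast
    moreover have "(1 + real (k - 2 ^ n) / 2 ^ n) / 2 = real k / 2 ^ Suc n"
      using False by (simp add: of_nat_diff field_simps)
    ultimately show ?thesis by (simp add: Phi_side_point_right)
  qed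
qed

definition dyadic_floor :: "nat \<Rightarrow> real \<Rightarrow> real" where
  "dyadic_floor n x = real (nat \<lfloor>2 ^ n * x\<rfloor>) / 2 ^ n"

lemma dyadic_floor_bounds:
  assumes "0 \<le> x" shows "dyadic_floor n x \<le> x" "x < dyadic_floor n x + 1 / 2 ^ n"
proof -
  have "0 \<le> 2 ^ n * x" using assms by simp
  then have "real (nat \<lfloor>2 ^ n * x\<rfloor>) \<le> 2 ^ n * x" "2 ^ n * x < real (nat \<lfloor>2 ^ n * x\<rfloor>) + 1"
    by (simp_all)
  then show "dyadic_floor n x \<le> x" "x < dyadic_floor n x + 1 / 2 ^ n"
    by (simp_all add: dyadic_floor_def field_simps)
qed

text \<open>The bound is attained at \<open>x = 1\<close>, so an index may be the right end point
  \<open>2^n\<close> and not name an interval.\<close>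

lemma dyadic_floor_index:
  fixes x :: real
  assumes "0 \<le> x" "x \<le> 1" shows "nat \<lfloor>2 ^ n * x\<rfloor> \<le> 2 ^ n"
proof -
  have "2 ^ n * x \<le> 2 ^ n" using assms by simp
  then have "\<lfloor>2 ^ n * x\<rfloor> \<le> \<lfloor>2 ^ n :: real\<rfloor>" by (rule floor_mono)
  also have "\<lfloor>2 ^ n :: real\<rfloor> = 2 ^ n" using floor_of_int[of "2 ^ n", where 'a = real] by simp
  finally show ?thesis by (simp add: nat_le_iff)
qed

lemma dyadic_floor_range: "0 \<le> x \<Longrightarrow> x \<le> 1 \<Longrightarrow> 0 \<le> dyadic_floor n x \<and> dyadic_floor n x \<le> 1"
  using dyadic_floor_bounds(1)[of x n] by (intro conjI) (simp add: dyadic_floor_def, linarith)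

lemma dyadic_floor_tendsto:
  assumes "0 \<le> x" shows "(\<lambda>n. dyadic_floor n x) \<longlonglongrightarrow> x"
proof (rule tendsto_sandwich)
  show "\<forall>\<^sub>F n in sequentially. x - (1/2) ^ n \<le> dyadic_floor n x"
    by (intro always_eventually allI) (use dyadic_floor_bounds(2)[OF assms] in \<open>simp add: power_divide less_imp_le diff_le_eq\<close>)
  show "\<forall>\<^sub>F n in sequentially. dyadic_floor n x \<le> x"
    using dyadic_floor_bounds(1)[OF assms] by simp
  have "(\<lambda>n. x - (1/2) ^ n) \<longlonglongrightarrow> x - 0" by (intro tendsto_intros LIMSEQ_realpow_zero) auto
  then show "(\<lambda>n. x - (1/2) ^ n) \<longlonglongrightarrow> x" by simp
qed simp

lemma side_point_dyadic_floor_vertices: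
  "i < 3 \<Longrightarrow> j < 3 \<Longrightarrow> 0 \<le> s \<Longrightarrow> s \<le> 1 \<Longrightarrow> side_point i j (dyadic_floor n s) \<in> vertices"
  unfolding dyadic_floor_def by (rule side_point_dyadic_vertices) (use dyadic_floor_index in auto)

lemma continuous_side_point [continuous_intros]: "continuous_on S g \<Longrightarrow> continuous_on S (\<lambda>x. side_point i j (g x))"
  unfolding side_point_def by (intro continuous_intros)

lemma side_point_SG:
  assumes "i < 3" "j < 3" "s \<in> {0..1}" shows "side_point i j s \<in> SG"
proof -
  have "(\<lambda>n. side_point i j (dyadic_floor n s)) \<longlonglongrightarrow> side_point i j s"
    unfolding side_point_def using assms by (intro tendsto_intros dyadic_floor_tendsto) auto
  then show ?thesis unfolding SG_eq closure_sequential using side_point_dyadic_floor_vertices assms by force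
qed

lemma bary_side_point: "l < 3 \<Longrightarrow> i < 3 \<Longrightarrow> j < 3 \<Longrightarrow> l \<noteq> i \<Longrightarrow> l \<noteq> j \<Longrightarrow> bary l (side_point i j s) = 0"
  unfolding side_point_def by (simp add: bary_affine bary_q)

section \<open>Graph energies and the trace\<close>

definition triangle_energy :: "(complex \<Rightarrow> real) \<Rightarrow> real" where
  "triangle_energy f = (f (q 0) - f (q 1))\<^sup>2 + (f (q 1) - f (q 2))\<^sup>2 + (f (q 0) - f (q 2))\<^sup>2"

text \<open>Splitting off the first letter makes each estimate an induction over the three children,
  with \<open>f\<close> replaced by \<open>f \<circ> Phi i\<close>.\<close>

fun level_energy :: "nat \<Rightarrow> (complex \<Rightarrow> real) \<Rightarrow> real" where
  "level_energy 0 f = triangle_energy f"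
| "level_energy (Suc n) f = (\<Sum>i<3. level_energy n (f \<circ> Phi i))"

lemma triangle_energy_nonneg [simp]: "0 \<le> triangle_energy f"
  by (simp add: triangle_energy_def)

lemma level_energy_nonneg [simp]: "0 \<le> level_energy n f"
  by (induction n arbitrary: f) (auto intro: sum_nonneg)

lemma sum_lessThan_3: "(\<Sum>i<3::nat. h i) = h 0 + h 1 + (h 2 :: real)"
  by (simp add: eval_nat_numeral)

lemma sum_3_perm:
  fixes h :: "nat \<Rightarrow> real"
  assumes "i < 3" "j < 3" "l < 3" "i \<noteq> j" "j \<noteq> l" "i \<noteq> l"
  shows "(\<Sum>k<3. h k) = h i + h j + h l"
proof -
  have "{..<3} = {i, j, l}" using assms by auto
  then show ?thesis using assms by simp
qed

lemma triangle_energy_perm: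
  assumes "i < 3" "j < 3" "l < 3" "i \<noteq> j" "j \<noteq> l" "i \<noteq> l"
  shows "triangle_energy f = (f (q i) - f (q j))\<^sup>2 + (f (q i) - f (q l))\<^sup>2 + (f (q j) - f (q l))\<^sup>2"
proof -
  have *: "triangle_energy f = (\<Sum>a<3. \<Sum>b<3. (f (q a) - f (q b))\<^sup>2) / 2"
    unfolding sum_lessThan_3 triangle_energy_def by (simp add: power2_commute)
  show ?thesis unfolding * sum_3_perm[OF assms] by (simp add: power2_commute)
qed

lemma words_eq: "words m = {w. set w \<subseteq> {0..<3} \<and> length w = m}"
  by (auto simp: words_def)

lemma finite_words [simp]: "finite (words m)"
  unfolding words_eq by (rule finite_lists_length_eq) simp

lemma words_0 [simp]: "words 0 = {[]}"
  by (auto simp: words_def)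

lemma sum_words_Suc: "(\<Sum>w\<in>words (Suc n). h w) = (\<Sum>i<3. \<Sum>w\<in>words n. h (i # w))"
proof -
  have "bij_betw (\<lambda>(i, w). i # w) ({..<3} \<times> words n) (words (Suc n))"
    by (rule bij_betwI[where g = "\<lambda>w. (hd w, tl w)"]) (auto simp: words_def length_Suc_conv)
  then have "(\<Sum>w\<in>words (Suc n). h w) = (\<Sum>(i, w)\<in>{..<3} \<times> words n. h (i # w))"
    by (subst sum.reindex_bij_betw[symmetric]) (auto simp: case_prod_unfold)
  then show ?thesis by (simp add: sum.cartesian_product)
qed

lemma level_energy_words: "level_energy n f = (\<Sum>w\<in>words n. triangle_energy (f \<circ> Phiw w))"
proof (induction n arbitrary: f)
  case (Suc n)
  have "f \<circ> Phi i \<circ> Phiw w = f \<circ> Phiw (i # w)" for i w by auto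
  then show ?case using Suc by (simp add: sum_words_Suc)
qed (simp add: comp_def triangle_energy_def)

lemma level_energy_add: "level_energy (m + n) f = (\<Sum>w\<in>words m. level_energy n (f \<circ> Phiw w))"
proof (induction m arbitrary: f)
  case (Suc m)
  have "f \<circ> Phi i \<circ> Phiw w = f \<circ> Phiw (i # w)" for i w by auto
  then show ?case using Suc by (simp add: sum_words_Suc)
qed (simp add: comp_def)

text \<open>\<open>Em\<close> runs over ordered pairs of corners and so counts each edge
  twice.\<close>

lemma Em_eq_level_energy: "Em n f = 2 * level_energy n f"
proof -
  have *: "{0..<3} = {0, 1, 2 :: nat}" by auto
  have "Em n f = (\<Sum>w\<in>words n. 2 * triangle_energy (f \<circ> Phiw w))"
    unfolding Em_def * by (simp add: insert_Diff_if triangle_energy_def power2_commute algebra_simps flip: sum.distrib)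
  then show ?thesis by (simp add: level_energy_words sum_distrib_left)
qed

text \<open>The difference of the two sides is a sum of squares measuring the deviation of the
  midpoint values \<open>x\<close>, \<open>y\<close>, \<open>z\<close> from the harmonic ones.\<close>
lemma triangle_energy_mono:
  fixes a b c x y z :: real
  shows "3 * ((a - b)\<^sup>2 + (b - c)\<^sup>2 + (a - c)\<^sup>2) \<le>
    5 * (((a - x)\<^sup>2 + (x - z)\<^sup>2 + (a - z)\<^sup>2) + ((x - b)\<^sup>2 + (b - y)\<^sup>2 + (x - y)\<^sup>2)
       + ((z - y)\<^sup>2 + (y - c)\<^sup>2 + (z - c)\<^sup>2))"
proof -
  define d where "d = x - (2 * a + 2 * b + c) / 5"
  define e where "e = y - (2 * b + 2 * c + a) / 5"
  define f where "f = z - (2 * a + 2 * c + b) / 5"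
  have "0 \<le> 5 * (2 * d\<^sup>2 + 2 * e\<^sup>2 + 2 * f\<^sup>2 + (d - e)\<^sup>2 + (e - f)\<^sup>2 + (d - f)\<^sup>2)" by simp
  also have "\<dots> = 5 * (((a - x)\<^sup>2 + (x - z)\<^sup>2 + (a - z)\<^sup>2) + ((x - b)\<^sup>2 + (b - y)\<^sup>2 + (x - y)\<^sup>2)
       + ((z - y)\<^sup>2 + (y - c)\<^sup>2 + (z - c)\<^sup>2)) - 3 * ((a - b)\<^sup>2 + (b - c)\<^sup>2 + (a - c)\<^sup>2)"
    unfolding d_def e_def f_def by (simp add: field_simps power2_eq_square)
  finally show ?thesis by simp
qed

lemma level_energy_mono_Suc: "level_energy n f \<le> 5/3 * level_energy (Suc n) f"
proof (induction n arbitrary: f)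
  case 0
  show ?case
    using triangle_energy_mono[of "f (q 0)" "f (q 1)" "f (q 2)" "f (Phi 0 (q 1))" "f (Phi 0 (q 2))" "f (Phi 1 (q 2))"]
    by (simp add: sum_lessThan_3 triangle_energy_def Phi_q_commute[of 1 0] Phi_q_commute[of 2 0] Phi_q_commute[of 2 1] power2_commute del: q_simps One_nat_def)
next
  case (Suc n)
  have "level_energy (Suc n) f \<le> (\<Sum>i<3. 5/3 * level_energy (Suc n) (f \<circ> Phi i))"
    unfolding level_energy.simps(2)[of n f] by (intro sum_mono Suc)
  then show ?case by (simp add: sum_distrib_left)
qed

definition scaled_energy :: "nat \<Rightarrow> (complex \<Rightarrow> real) \<Rightarrow> real" where
  "scaled_energy n f = (5/3) ^ n * level_energy n f"

lemma scaled_energy_nonneg [simp]: "0 \<le> scaled_energy n f"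
  by (simp add: scaled_energy_def)

lemma incseq_scaled_energy: "incseq (\<lambda>n. scaled_energy n f)"
  unfolding incseq_Suc_iff scaled_energy_def
proof
  fix n show "(5/3) ^ n * level_energy n f \<le> (5/3) ^ Suc n * level_energy (Suc n) f"
    using mult_left_mono[OF level_energy_mono_Suc[of n f], of "(5/3) ^ n"] by (simp add: mult_ac)
qed

text \<open>The scaled energies are nondecreasing, so convergence means boundedness.\<close>

lemma dom_energy_iff:
  "f \<in> dom_energy \<longleftrightarrow> continuous_on SG f \<and> (\<exists>M. \<forall>n. scaled_energy n f \<le> M)"
proof -
  have e: "(\<lambda>n. (5/3) ^ n * Em n f) = (\<lambda>n. 2 * scaled_energy n f)" by (auto simp: Em_eq_level_energy scaled_energy_def)
  have "convergent (\<lambda>n. 2 * scaled_energy n f) \<longleftrightarrow> convergent (\<lambda>n. scaled_energy n f)"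
    by (rule convergent_mult_const_iff) simp
  also have "\<dots> \<longleftrightarrow> (\<exists>M. \<forall>n. scaled_energy n f \<le> M)"
  proof
    assume "convergent (\<lambda>n. scaled_energy n f)"
    then obtain L where "(\<lambda>n. scaled_energy n f) \<longlonglongrightarrow> L" by (auto simp: convergent_def)
    then show "\<exists>M. \<forall>n. scaled_energy n f \<le> M" using incseq_le[OF incseq_scaled_energy] by blast
  next
    assume "\<exists>M. \<forall>n. scaled_energy n f \<le> M"
    then obtain M where "\<forall>n. scaled_energy n f \<le> M" by blast
    then show "convergent (\<lambda>n. scaled_energy n f)"
      using incseq_convergent[OF incseq_scaled_energy, of f M] convergentI by blast
  qed
  finally show ?thesis by (simp add: dom_energy_def e)
qed

lemma energy_LIMSEQ: "f \<in> dom_energy \<Longrightarrow> (\<lambda>n. 2 * scaled_energy n f) \<longlonglongrightarrow> energy f"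
proof -
  assume f: "f \<in> dom_energy"
  have e: "(\<lambda>n. (5/3) ^ n * Em n f) = (\<lambda>n. 2 * scaled_energy n f)" by (auto simp: Em_eq_level_energy scaled_energy_def)
  show ?thesis using f by (simp add: dom_energy_def energy_def e convergent_LIMSEQ_iff)
qed

lemma scaled_energy_le_energy: "f \<in> dom_energy \<Longrightarrow> 2 * scaled_energy n f \<le> energy f"
proof -
  assume "f \<in> dom_energy"
  then have "(\<lambda>n. 2 * scaled_energy n f) \<longlonglongrightarrow> energy f" by (rule energy_LIMSEQ)
  moreover have "incseq (\<lambda>n. 2 * scaled_energy n f)" using incseq_scaled_energy[of f] by (simp add: incseq_def)
  ultimately show ?thesis by (rule incseq_le[rotated])
qed

lemma energy_le: "f \<in> dom_energy \<Longrightarrow> (\<And>n. 2 * scaled_energy n f \<le> B) \<Longrightarrow> energy f \<le> B"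
  by (rule LIMSEQ_le_const2[OF energy_LIMSEQ]) auto

lemma energy_nonneg: "f \<in> dom_energy \<Longrightarrow> 0 \<le> energy f"
  using scaled_energy_le_energy[of f 0] scaled_energy_nonneg[of 0 f] by linarith

lemma scaled_energy_comp_le: "w \<in> words m \<Longrightarrow> scaled_energy n (f \<circ> Phiw w) \<le> scaled_energy (m + n) f"
proof -
  assume w: "w \<in> words m"
  have "level_energy n (f \<circ> Phiw w) \<le> level_energy (m + n) f"
    unfolding level_energy_add using w by (intro member_le_sum) auto
  then have "scaled_energy n (f \<circ> Phiw w) \<le> (5/3) ^ n * level_energy (m + n) f" by (simp add: scaled_energy_def)
  also have "\<dots> \<le> (5/3) ^ (m + n) * level_energy (m + n) f"
    by (intro mult_right_mono power_increasing) auto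
  finally show ?thesis by (simp add: scaled_energy_def)
qed

section \<open>Increments along one side, and the energy of the cells touching it\<close>

fun side_energy :: "nat \<Rightarrow> nat \<Rightarrow> nat \<Rightarrow> (complex \<Rightarrow> real) \<Rightarrow> real" where
  "side_energy 0 i j f = (f (q i) - f (q j))\<^sup>2"
| "side_energy (Suc n) i j f = side_energy n i j (f \<circ> Phi i) + side_energy n i j (f \<circ> Phi j)"

lemma side_energy_nonneg [simp]: "0 \<le> side_energy n i j f"
  by (induction n arbitrary: f) auto

lemma side_energy_cong:
  assumes "l < 3" "i < 3" "j < 3" "i \<noteq> l" "j \<noteq> l" "\<And>x. bary l x = 0 \<Longrightarrow> f x = g x"
  shows "side_energy n i j f = side_energy n i j g"
  using assms(6)
proof (induction n arbitrary: f g)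
  case 0 then show ?case using assms by (simp add: bary_q)
next
  case (Suc n)
  have "side_energy n i j (f \<circ> Phi i) = side_energy n i j (g \<circ> Phi i)" "side_energy n i j (f \<circ> Phi j) = side_energy n i j (g \<circ> Phi j)"
    using assms(1-5) by (auto intro!: Suc simp: bary_Phi)
  then show ?case by simp
qed

definition dyadic_energy :: "nat \<Rightarrow> (real \<Rightarrow> real) \<Rightarrow> real" where
  "dyadic_energy n u = (\<Sum>k<2^n. (u (real (Suc k) / 2 ^ n) - u (real k / 2 ^ n))\<^sup>2)"

lemma dyadic_energy_Suc: "dyadic_energy (Suc n) u = dyadic_energy n (\<lambda>s. u (s / 2)) + dyadic_energy n (\<lambda>s. u ((1 + s) / 2))"
proof -
  let ?h = "\<lambda>k. (u (real (Suc k) / 2 ^ Suc n) - u (real k / 2 ^ Suc n))\<^sup>2"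
  have p: "(2::nat) ^ Suc n = 2 ^ n + 2 ^ n" by simp
  have "dyadic_energy (Suc n) u = sum ?h {0..<2^n + 2^n}"
    unfolding dyadic_energy_def atLeast0LessThan p ..
  also have "\<dots> = sum ?h {0..<2^n} + sum ?h {2^n..<2^n + 2^n}"
    by (subst sum.atLeastLessThan_concat) simp_all
  also have "sum ?h {2^n..<2^n + 2^n} = (\<Sum>k<2^n. ?h (k + 2^n))"
    using sum.shift_bounds_nat_ivl[of ?h 0 "2^n" "2^n"] by (simp only: atLeast0LessThan add_0)
  also have "\<dots> = dyadic_energy n (\<lambda>s. u ((1 + s) / 2))"
  proof -
    have e: "real (k + 2 ^ n) / 2 ^ Suc n = (1 + real k / 2 ^ n) / 2" for k
      by (simp add: add_divide_distrib)
    show ?thesis unfolding dyadic_energy_def by (intro sum.cong refl) (simp only: e flip: add_Suc)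
  qed
  also have "sum ?h {0..<2^n} = dyadic_energy n (\<lambda>s. u (s / 2))"
  proof -
    have e: "real k / 2 ^ Suc n = real k / 2 ^ n / 2" for k by simp
    show ?thesis unfolding dyadic_energy_def atLeast0LessThan by (intro sum.cong refl) (simp only: e)
  qed
  finally show ?thesis .
qed

lemma side_energy_eq_dyadic_energy: "side_energy n i j f = dyadic_energy n (\<lambda>s. f (side_point i j s))"
proof (induction n arbitrary: f)
  case 0
  have "side_point i j 1 = q j" "side_point i j 0 = q i" by (simp_all add: side_point_def)
  then show ?case by (simp add: dyadic_energy_def power2_commute[of "f (q i)"])
next
  case (Suc n)
  show ?case unfolding side_energy.simps dyadic_energy_Suc Suc.IH comp_apply Phi_side_point_left Phi_side_point_right ..
qed

text \<open>Words in the two letters \<open>i\<close> and \<open>j\<close> name exactly the cells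
  that have an edge on the side from \<open>q i\<close> to \<open>q j\<close>.\<close>

fun strip_energy :: "nat \<Rightarrow> nat \<Rightarrow> nat \<Rightarrow> (complex \<Rightarrow> real) \<Rightarrow> real" where
  "strip_energy 0 i j f = triangle_energy f"
| "strip_energy (Suc n) i j f = strip_energy n i j (f \<circ> Phi i) + strip_energy n i j (f \<circ> Phi j)"

lemma side_energy_le_strip_energy:
  assumes "i < 3" "j < 3" "i \<noteq> j"
  shows "side_energy n i j f \<le> strip_energy n i j f"
proof (induction n arbitrary: f)
  case 0
  obtain l where l: "l < 3" "l \<noteq> i" "l \<noteq> j" "{i, j, l} = {0, 1, 2}" by (rule third_index[OF assms])
  have "triangle_energy f = (f (q i) - f (q j))\<^sup>2 + (f (q i) - f (q l))\<^sup>2 + (f (q j) - f (q l))\<^sup>2"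
    by (rule triangle_energy_perm) (use assms l(1-3) in auto)
  then show ?case by simp
next
  case (Suc n)
  then show ?case by (simp only: strip_energy.simps side_energy.simps add_mono)
qed

text \<open>A harmonic function that is constant on the top triangle is constant; hence the top
  triangle always carries a definite proportion of the harmonic energy.\<close>
lemma top_triangle_energy:
  fixes a b c x y z :: real
  shows "31 * ((a - b)\<^sup>2 + (a - c)\<^sup>2 + (b - c)\<^sup>2) \<le>
    50 * (((a - x)\<^sup>2 + (a - z)\<^sup>2 + (x - z)\<^sup>2) + ((x - b)\<^sup>2 + (x - y)\<^sup>2 + (b - y)\<^sup>2)
       + ((z - y)\<^sup>2 + (z - c)\<^sup>2 + (y - c)\<^sup>2))
    + 50 * ((z - y)\<^sup>2 + (z - c)\<^sup>2 + (y - c)\<^sup>2)"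
proof -
  define d where "d = x - (2 * a + 2 * b + c) / 5"
  define e where "e = y - (2 * b + 2 * c + a) / 5"
  define f where "f = z - (2 * a + 2 * c + b) / 5"
  \<comment> \<open>\<open>x - d\<close>, \<open>y - e\<close>, \<open>z - f\<close> are the
    harmonic midpoint values. The share 1/25 of the top cell is attained exactly when
    \<open>c\<close> is the mean of \<open>a\<close> and \<open>b\<close>.\<close>
  have h: "(a - b)\<^sup>2 + (a - c)\<^sup>2 + (b - c)\<^sup>2
      \<le> 25 * ((z - f - (y - e))\<^sup>2 + (z - f - c)\<^sup>2 + (y - e - c)\<^sup>2)"
  proof -
    have "0 \<le> 4 * (a - c + (b - c))\<^sup>2" by simp
    also have "\<dots> = 25 * ((z - f - (y - e))\<^sup>2 + (z - f - c)\<^sup>2 + (y - e - c)\<^sup>2) - ((a - b)\<^sup>2 + (a - c)\<^sup>2 + (b - c)\<^sup>2)"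
      unfolding d_def e_def f_def by (simp add: field_simps power2_eq_square)
    finally show ?thesis by simp
  qed
  have sq: "(r - s)\<^sup>2 \<le> 2 * r\<^sup>2 + 2 * s\<^sup>2" for r s :: real
    using zero_le_power2[of "r + s"] by (simp add: power2_eq_square algebra_simps)
  have "(z - f - (y - e))\<^sup>2 \<le> 2 * (z - y)\<^sup>2 + 2 * (e - f)\<^sup>2" "(z - f - c)\<^sup>2 \<le> 2 * (z - c)\<^sup>2 + 2 * f\<^sup>2"
    "(y - e - c)\<^sup>2 \<le> 2 * (y - c)\<^sup>2 + 2 * e\<^sup>2"
    using sq[of "z - y" "f - e"] sq[of "z - c" f] sq[of "y - c" e] by (simp_all add: algebra_simps power2_commute)
  moreover have "3 * ((a - b)\<^sup>2 + (a - c)\<^sup>2 + (b - c)\<^sup>2)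
      + 5 * (2 * d\<^sup>2 + 2 * e\<^sup>2 + 2 * f\<^sup>2 + (d - e)\<^sup>2 + (e - f)\<^sup>2 + (d - f)\<^sup>2)
     = 5 * (((a - x)\<^sup>2 + (a - z)\<^sup>2 + (x - z)\<^sup>2) + ((x - b)\<^sup>2 + (x - y)\<^sup>2 + (b - y)\<^sup>2)
       + ((z - y)\<^sup>2 + (z - c)\<^sup>2 + (y - c)\<^sup>2))"
    unfolding d_def e_def f_def by (simp add: field_simps power2_eq_square)
  moreover have "0 \<le> d\<^sup>2" "0 \<le> e\<^sup>2" "0 \<le> f\<^sup>2" "0 \<le> (d - e)\<^sup>2" "0 \<le> (d - f)\<^sup>2" by simp_all
  \<comment> \<open>Let E0 and E1 be the energies of levels 0 and 1, S that of the top cell and D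
    the quadratic form in \<open>d\<close>, \<open>e\<close>, \<open>f\<close>. Then E0 \<le> 50 S +
    50 D and D = E1 - 3/5 E0, which gives 31 = 1 + 30 on the left.\<close>
  ultimately show ?thesis using h by argo
qed

text \<open>The children touching the side miss the top cell, whose energy is bounded below by
  \<open>top_triangle_energy\<close>; the contraction factor is 29/30 = 2 - 31/30. In the induction
  the top cell contributes only to the energy increment on the right, and does so with a nonnegative
  amount.\<close>

lemma strip_energy_Suc_le:
  assumes "i < 3" "j < 3" "i \<noteq> j"
  shows "5/3 * strip_energy (Suc n) i j f \<le> 29/30 * strip_energy n i j f + 2 * (5/3 * level_energy (Suc n) f - level_energy n f)"
proof (induction n arbitrary: f)
  obtain l where l: "l < 3" "l \<noteq> i" "l \<noteq> j" "{i, j, l} = {0, 1, 2}" by (rule third_index[OF assms])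
  note l = l(1) l(2,3)[symmetric]
  {
    case 0
    have s: "triangle_energy g = (g (q i) - g (q j))\<^sup>2 + (g (q i) - g (q l))\<^sup>2 + (g (q j) - g (q l))\<^sup>2" for g
      using assms l by (intro triangle_energy_perm) auto
    have E: "(\<Sum>k<3. triangle_energy (f \<circ> Phi k)) = triangle_energy (f \<circ> Phi i) + triangle_energy (f \<circ> Phi j) + triangle_energy (f \<circ> Phi l)"
      using assms l by (intro sum_3_perm) auto
    have "31 * triangle_energy f \<le> 50 * (triangle_energy (f \<circ> Phi i) + triangle_energy (f \<circ> Phi j) + triangle_energy (f \<circ> Phi l)) + 50 * triangle_energy (f \<circ> Phi l)"
      using top_triangle_energy[of "f (q i)" "f (q j)" "f (q l)" "f (Phi i (q j))" "f (Phi i (q l))" "f (Phi j (q l))"]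
      unfolding s comp_apply Phi_q_same Phi_q_commute[of j i] Phi_q_commute[of l i] Phi_q_commute[of l j] .
    then show ?case unfolding level_energy.simps strip_energy.simps E by argo
  next
    case (Suc n)
    have e: "level_energy (Suc m) g = level_energy m (g \<circ> Phi i) + level_energy m (g \<circ> Phi j) + level_energy m (g \<circ> Phi l)" for m g
      unfolding level_energy.simps using assms l by (intro sum_3_perm) auto
    have "level_energy n (f \<circ> Phi l) \<le> 5/3 * level_energy (Suc n) (f \<circ> Phi l)" by (rule level_energy_mono_Suc)
    then show ?case using Suc[of "f \<circ> Phi i"] Suc[of "f \<circ> Phi j"]
      unfolding strip_energy.simps(2)[of "Suc n"] strip_energy.simps(2)[of n i j f] e[of "Suc n" f] e[of n f] by argo
  }
qed

lemma sum_side_energy_le_scaled_energy: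
  assumes "i < 3" "j < 3" "i \<noteq> j"
  shows "(\<Sum>n\<le>N. (5/3) ^ n * side_energy n i j f) \<le> 60 * scaled_energy N f"
proof -
  have step: "(5/3) ^ Suc n * strip_energy (Suc n) i j f \<le> 29/30 * ((5/3) ^ n * strip_energy n i j f) + 2 * (scaled_energy (Suc n) f - scaled_energy n f)" for n
  proof -
    have *: "5/3 * p * S \<le> 29/30 * (p * s) + 2 * (5/3 * p * E - p * e)"
      if "5/3 * S \<le> 29/30 * s + 2 * (5/3 * E - e)" "0 \<le> p" for p S s E e :: real
      using mult_left_mono[OF that] by (simp add: algebra_simps)
    show ?thesis unfolding scaled_energy_def power_Suc by (rule *[OF strip_energy_Suc_le[OF assms]]) simp
  qed
  have nn: "0 \<le> strip_energy n i j f" for n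
    using side_energy_le_strip_energy[OF assms, of n f] side_energy_nonneg[of n i j f] by linarith
  \<comment> \<open>The reserve of 29 copies of the last term closes the induction: the new sum
    holds 30 copies of its last term, and 30 times 29/30 is again 29. The energy increments
    telescope with the factor 60 = 30 times 2.\<close>
  have "(\<Sum>n\<le>N. (5/3) ^ n * strip_energy n i j f) + 29 * ((5/3) ^ N * strip_energy N i j f) \<le> 60 * scaled_energy N f"
  proof (induction N)
    case (Suc N) then show ?case using step[of N] unfolding sum.atMost_Suc by argo
  qed (simp add: scaled_energy_def)
  moreover have "(\<Sum>n\<le>N. (5/3) ^ n * side_energy n i j f) \<le> (\<Sum>n\<le>N. (5/3) ^ n * strip_energy n i j f)"
    by (intro sum_mono mult_left_mono side_energy_le_strip_energy assms) auto
  moreover have "0 \<le> 29 * ((5/3) ^ N * strip_energy N i j f)" using nn by simp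
  ultimately show ?thesis by linarith
qed

section \<open>Energy of the extension\<close>

text \<open>A midpoint is a junction with two presentations; labelling it like its side by the
  opposite vertex, with indices modulo 3, fixes one of them.\<close>

definition midpoint_opposite :: "nat \<Rightarrow> complex" where
  "midpoint_opposite k = Phi ((k + 1) mod 3) (q ((k + 2) mod 3))"

lemma Phi_q_midpoint_opposite:
  assumes "i < 3" "j < 3" "k < 3" "i \<noteq> j" "i \<noteq> k" "j \<noteq> k"
  shows "Phi i (q j) = midpoint_opposite k"
proof -
  have "(i = (k + 1) mod 3 \<and> j = (k + 2) mod 3) \<or> (j = (k + 1) mod 3 \<and> i = (k + 2) mod 3)"
    using assms(3) assms(4-6) assms(1,2) by (elim less3E) simp_all
  then show ?thesis using Phi_q_commute[of i j] by (auto simp: midpoint_opposite_def)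
qed

lemma bary_midpoint_opposite: "l < 3 \<Longrightarrow> k < 3 \<Longrightarrow> bary l (midpoint_opposite k) = (if l = k then 0 else 1/2)"
proof -
  assume "l < 3" "k < 3"
  then show ?thesis unfolding midpoint_opposite_def
    by (elim less3E) (simp_all add: bary_Phi bary_q numeral_2_eq_2[symmetric] del: q_simps)
qed

lemma midpoint_opposite_eq_iff: "k < 3 \<Longrightarrow> l < 3 \<Longrightarrow> midpoint_opposite k = midpoint_opposite l \<longleftrightarrow> k = l"
  using bary_midpoint_opposite[of k k] bary_midpoint_opposite[of k l] by (metis zero_neq_one divide_eq_0_iff zero_neq_numeral)

lemma midpoint_opposite_neq_q: "k < 3 \<Longrightarrow> i < 3 \<Longrightarrow> midpoint_opposite k \<noteq> q i"
  using bary_midpoint_opposite[of i k] bary_q[of i i] by (auto split: if_splits)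

text \<open>A side is labelled by the index of the opposite vertex; \<open>A\<close> is the set of sides of the current
  cell on which the boundary function is prescribed. On all other sides the value at the midpoint
  is copied from a prescribed point, or is the harmonic one if no side is prescribed.\<close>
definition midpoint_value :: "nat set \<Rightarrow> nat \<Rightarrow> (complex \<Rightarrow> real) \<Rightarrow> real" where
  "midpoint_value A k f =
    (if k \<in> A then f (midpoint_opposite k)
     else if A = {} then (2 * f (q ((k + 1) mod 3)) + 2 * f (q ((k + 2) mod 3)) + f (q k)) / 5
     else if is_singleton A then f (midpoint_opposite (the_elem A))
     else f (q k))"

text \<open>All values away from the three midpoints survive, because the descendants still read
  \<open>f\<close> along the prescribed sides at finer scales.\<close>

definition refinement :: "nat set \<Rightarrow> (complex \<Rightarrow> real) \<Rightarrow> complex \<Rightarrow> real" where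
  "refinement A f x = (if x = midpoint_opposite 0 then midpoint_value A 0 f else if x = midpoint_opposite 1 then midpoint_value A 1 f
     else if x = midpoint_opposite 2 then midpoint_value A 2 f else f x)"

lemma refinement_midpoint_opposite: "k < 3 \<Longrightarrow> refinement A f (midpoint_opposite k) = midpoint_value A k f"
  by (elim less3E) (simp_all add: refinement_def midpoint_opposite_eq_iff)

lemma refinement_other: "(\<And>k. k < 3 \<Longrightarrow> x \<noteq> midpoint_opposite k) \<Longrightarrow> refinement A f x = f x"
  by (simp add: refinement_def)

lemma refinement_q [simp]: "i < 3 \<Longrightarrow> refinement A f (q i) = f (q i)"
  by (rule refinement_other) (metis midpoint_opposite_neq_q)

text \<open>The only midpoint on side \<open>l\<close> is \<open>midpoint_opposite l\<close>, and
  there a prescribed side keeps its own value.\<close>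

lemma refinement_side:
  assumes "l \<in> A" "l < 3" "bary l x = 0" shows "refinement A f x = f x"
proof (cases "\<exists>k<3. x = midpoint_opposite k")
  case True
  then obtain k where k: "k < 3" "x = midpoint_opposite k" by blast
  then have "k = l" using assms bary_midpoint_opposite[of l k] by (auto split: if_splits)
  then show ?thesis using k assms by (simp add: refinement_midpoint_opposite midpoint_value_def)
qed (auto intro: refinement_other)

lemma refinement_linear: "refinement A (\<lambda>x. a * f x + b * g x) y = a * refinement A f y + b * refinement A g y"
  by (simp add: refinement_def midpoint_value_def field_simps)

text \<open>The first \<open>m\<close> letters lead to a cell of level \<open>m\<close>, all of whose sides are prescribed. A child of a
  cell meets all sides of the cell but the opposite one, hence \<open>A - {i}\<close>.\<close>
fun refined_value :: "nat \<Rightarrow> nat set \<Rightarrow> nat list \<Rightarrow> (complex \<Rightarrow> real) \<Rightarrow> complex \<Rightarrow> real" where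
  "refined_value m A [] f = f"
| "refined_value (Suc m) A (i # w) f = refined_value m A w (f \<circ> Phi i)"
| "refined_value 0 A (i # w) f = refined_value 0 (A - {i}) w (refinement A f \<circ> Phi i)"

lemma refined_value_linear: "refined_value m A w (\<lambda>x. a * f x + b * g x) y = a * refined_value m A w f y + b * refined_value m A w g y"
proof (induction m A w f arbitrary: g y rule: refined_value.induct)
  case (2 m A i w f)
  then show ?case by (simp add: comp_def)
next
  case (3 A i w f)
  then show ?case using 3[of "refinement A g \<circ> Phi i"] by (simp add: comp_def refinement_linear)
qed simp

text \<open>Computed cell by cell, so the estimates below do not depend on the values of
  neighbouring cells matching at shared vertices.\<close>

fun refined_energy :: "nat set \<Rightarrow> nat \<Rightarrow> (complex \<Rightarrow> real) \<Rightarrow> real" where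
  "refined_energy A 0 f = triangle_energy f"
| "refined_energy A (Suc n) f = (\<Sum>i<3. refined_energy (A - {i}) n (refinement A f \<circ> Phi i))"

lemma triangle_energy_cong: "(\<And>i. i < 3 \<Longrightarrow> f (q i) = g (q i)) \<Longrightarrow> triangle_energy f = triangle_energy g"
  unfolding triangle_energy_def by (simp del: q_simps)

lemma level_energy_eq_refined_energy:
  assumes "\<And>w i. set w \<subseteq> {..<3} \<Longrightarrow> i < 3 \<Longrightarrow> g (Phiw w (q i)) = refined_value 0 A w f (q i)"
  shows "level_energy n g = refined_energy A n f"
  using assms
proof (induction n arbitrary: g A f)
  case 0
  have "g (q i) = f (q i)" if "i < 3" for i using 0[of "[]" i] that by simp
  then show ?case unfolding level_energy.simps refined_energy.simps by (rule triangle_energy_cong)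
next
  case (Suc n)
  have "level_energy n (g \<circ> Phi i) = refined_energy (A - {i}) n (refinement A f \<circ> Phi i)" if i: "i < 3" for i
  proof (rule Suc.IH)
    fix w :: "nat list" and k :: nat assume "set w \<subseteq> {..<3}" "k < 3"
    then show "(g \<circ> Phi i) (Phiw w (q k)) = refined_value 0 (A - {i}) w (refinement A f \<circ> Phi i) (q k)"
      using Suc.prems[of "i # w" k] i by simp
  qed
  then show ?case by simp
qed

text \<open>The weights 2/5, 2/5, 1/5 are those of the harmonic midpoint values, and equality is the
  energy renormalisation factor 3/5.\<close>

lemma harmonic_step:
  fixes a b c :: real
  defines "x \<equiv> (2 * a + 2 * b + c) / 5" and "y \<equiv> (2 * b + 2 * c + a) / 5" and "z \<equiv> (2 * c + 2 * a + b) / 5"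
  shows "5 * (((a - x)\<^sup>2 + (x - z)\<^sup>2 + (a - z)\<^sup>2) + ((x - b)\<^sup>2 + (b - y)\<^sup>2 + (x - y)\<^sup>2)
       + ((z - y)\<^sup>2 + (y - c)\<^sup>2 + (z - c)\<^sup>2)) = 3 * ((a - b)\<^sup>2 + (b - c)\<^sup>2 + (a - c)\<^sup>2)"
  unfolding x_def y_def z_def by (simp add: field_simps power2_eq_square)

lemma Phi_q_mids:
  "Phi 0 (q 1) = midpoint_opposite 2" "Phi 1 (q 0) = midpoint_opposite 2" "Phi 1 (q 2) = midpoint_opposite 0" "Phi 2 (q 1) = midpoint_opposite 0"
  "Phi 0 (q 2) = midpoint_opposite 1" "Phi 2 (q 0) = midpoint_opposite 1"
  by (rule Phi_q_midpoint_opposite; simp)+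

lemma triangle_energy_harmonic: "(\<Sum>i<3. triangle_energy (refinement {} f \<circ> Phi i)) = 3/5 * triangle_energy f"
proof -
  have n: "midpoint_value {} 0 f = (2 * f (q 1) + 2 * f (q 2) + f (q 0)) / 5"
    "midpoint_value {} 1 f = (2 * f (q 2) + 2 * f (q 0) + f (q 1)) / 5"
    "midpoint_value {} 2 f = (2 * f (q 0) + 2 * f (q 1) + f (q 2)) / 5"
    by (simp_all add: midpoint_value_def numeral_2_eq_2[symmetric] del: q_simps)
  have r: "refinement {} f (q 0) = f (q 0)" "refinement {} f (q 1) = f (q 1)" "refinement {} f (q 2) = f (q 2)"
    "refinement {} f (midpoint_opposite 0) = midpoint_value {} 0 f" "refinement {} f (midpoint_opposite 1) = midpoint_value {} 1 f" "refinement {} f (midpoint_opposite 2) = midpoint_value {} 2 f"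
    by (simp_all add: refinement_midpoint_opposite refinement_q del: q_simps)
  show ?thesis
    unfolding sum_lessThan_3 triangle_energy_def comp_apply Phi_q_mids Phi_q_same r n
    using harmonic_step[of "f (q 0)" "f (q 1)" "f (q 2)"] by (simp add: power2_commute del: q_simps One_nat_def)
qed

text \<open>Children of a free cell are free, and harmonic refinement conserves the scaled energy.
  The whole future cost of a free cell is thus known at the moment when it arises.\<close>

lemma refined_energy_empty: "(5/3) ^ n * refined_energy {} n f = triangle_energy f"
proof (induction n arbitrary: f)
  case (Suc n)
  have "(5/3) ^ Suc n * refined_energy {} (Suc n) f = 5/3 * (\<Sum>i<3. (5/3) ^ n * refined_energy {} n (refinement {} f \<circ> Phi i))"
    by (simp add: sum_distrib_left mult_ac)
  also have "\<dots> = triangle_energy f" unfolding Suc triangle_energy_harmonic by simp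
  finally show ?case .
qed simp

text \<open>The energy created by one refinement is paid for by the increments of the children, so the
  budget of a cell counts the increments of each finer scale once, and those of the last scale twice.\<close>
fun side_budget :: "nat \<Rightarrow> nat \<Rightarrow> nat \<Rightarrow> (complex \<Rightarrow> real) \<Rightarrow> real" where
  "side_budget 0 i j f = side_energy 0 i j f"
| "side_budget (Suc n) i j f = 5/3 * ((side_energy 0 i j (f \<circ> Phi i) + side_budget n i j (f \<circ> Phi i))
     + (side_energy 0 i j (f \<circ> Phi j) + side_budget n i j (f \<circ> Phi j)))"

lemma side_budget_nonneg [simp]: "0 \<le> side_budget n i j f"
  by (induction n arbitrary: f) auto

lemma side_budget_commute: "side_budget n i j f = side_budget n j i f"
  by (induction n arbitrary: f) (auto simp: power2_commute)

lemma side_budget_cong: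
  assumes "l < 3" "i < 3" "j < 3" "i \<noteq> l" "j \<noteq> l" "\<And>x. bary l x = 0 \<Longrightarrow> f x = g x"
  shows "side_budget n i j f = side_budget n i j g"
  using assms(6)
proof (induction n arbitrary: f g)
  case 0 then show ?case using side_energy_cong[OF assms(1-5), of f g 0] by (simp only: side_budget.simps)
next
  case (Suc n)
  have b: "bary l (Phi i x) = 0" "bary l (Phi j x) = 0" if "bary l x = 0" for x
    using assms(1-5) that by (simp_all add: bary_Phi)
  have "side_budget n i j (f \<circ> Phi i) = side_budget n i j (g \<circ> Phi i)" "side_budget n i j (f \<circ> Phi j) = side_budget n i j (g \<circ> Phi j)"
    "side_energy 0 i j (f \<circ> Phi i) = side_energy 0 i j (g \<circ> Phi i)" "side_energy 0 i j (f \<circ> Phi j) = side_energy 0 i j (g \<circ> Phi j)"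
    by (rule Suc.IH side_energy_cong[OF assms(1-5)]; simp only: comp_apply b Suc.prems)+
  then show ?case by (simp only: side_budget.simps)
qed

text \<open>The budget reads only points of the side opposite \<open>q l\<close>, where refinement
  changes nothing. Budgets of children can therefore be expressed by the original
  \<open>f\<close>.\<close>

lemma side_budget_refinement:
  assumes "l \<in> A" "l < 3" "i < 3" "j < 3" "i \<noteq> l" "j \<noteq> l" "a < 3" "a \<noteq> l"
  shows "side_budget n i j (refinement A f \<circ> Phi a) = side_budget n i j (f \<circ> Phi a)"
proof (rule side_budget_cong[OF assms(2-6)])
  fix x assume "bary l x = 0"
  then have "bary l (Phi a x) = 0" using assms by (simp add: bary_Phi)
  then show "(refinement A f \<circ> Phi a) x = (f \<circ> Phi a) x" using assms refinement_side by simp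
qed

lemma side_budget_closed: "side_budget n i j f = (5/3) ^ n * side_energy n i j f + (\<Sum>k<n. (5/3) ^ Suc k * side_energy (Suc k) i j f)"
proof (induction n arbitrary: f)
  case (Suc n)
  have e: "(\<Sum>k<n. (5/3) ^ Suc (Suc k) * side_energy (Suc (Suc k)) i j f)
     = 5/3 * ((\<Sum>k<n. (5/3) ^ Suc k * side_energy (Suc k) i j (f \<circ> Phi i)) + (\<Sum>k<n. (5/3) ^ Suc k * side_energy (Suc k) i j (f \<circ> Phi j)))"
    unfolding side_energy.simps(2)[of "Suc _" i j f] power_Suc[of _ "Suc _"] sum_distrib_left sum.distrib[symmetric]
    by (intro sum.cong refl) algebra
  have alg: "5/3 * ((a + (p * x + S)) + (b + (p * y + T))) = 5/3 * p * (x + y) + (5/3 * (a + b) + 5/3 * (S + T))"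
    for a b p x y S T :: real by (simp add: algebra_simps add_divide_distrib)
  show ?case unfolding side_budget.simps Suc.IH sum.lessThan_Suc_shift e side_energy.simps(2)[of n i j f] side_energy.simps(2)[of 0 i j f]
    by (simp only: alg power_Suc power_0 mult_1_right)
qed simp

lemma side_budget_le: "side_budget n i j f \<le> 2 * (\<Sum>k\<le>n. (5/3) ^ k * side_energy k i j f)"
proof -
  have "(5/3) ^ n * side_energy n i j f \<le> (\<Sum>k\<le>n. (5/3) ^ k * side_energy k i j f)"
    by (rule member_le_sum) auto
  moreover have "(\<Sum>k<n. (5/3) ^ Suc k * side_energy (Suc k) i j f) \<le> (\<Sum>k\<le>n. (5/3) ^ k * side_energy k i j f)"
    unfolding lessThan_Suc_atMost[symmetric] sum.lessThan_Suc_shift by simp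
  ultimately show ?thesis unfolding side_budget_closed by linarith
qed

lemma sq_diff_le: "(r - s)\<^sup>2 \<le> 2 * (r - t)\<^sup>2 + 2 * (t - s)\<^sup>2" for r s t :: real
  using zero_le_power2[of "r + s - 2 * t"] by (simp add: power2_eq_square algebra_simps)

section \<open>Energy bounds for cells with one, two and three prescribed sides\<close>

context
  fixes i j l :: nat
  assumes ijl: "i < 3" "j < 3" "l < 3" "i \<noteq> j" "j \<noteq> l" "i \<noteq> l"
begin

lemma mids_ijl:
  "Phi i (q j) = midpoint_opposite l" "Phi j (q i) = midpoint_opposite l" "Phi i (q l) = midpoint_opposite j" "Phi l (q i) = midpoint_opposite j"
  "Phi j (q l) = midpoint_opposite i" "Phi l (q j) = midpoint_opposite i"
  using ijl by (auto intro!: Phi_q_midpoint_opposite)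

text \<open>All three midpoints receive the value at the middle of the prescribed side. The top
  child has two equal corners and is free, so it costs two squares once and for all.\<close>

lemma refined_energy_one_step:
  "(5/3) ^ Suc n * refined_energy {l} (Suc n) f = 5/3 * (2 * (f (midpoint_opposite l) - f (q l))\<^sup>2
     + (5/3) ^ n * refined_energy {l} n (refinement {l} f \<circ> Phi i) + (5/3) ^ n * refined_energy {l} n (refinement {l} f \<circ> Phi j))"
proof -
  have d: "{l} - {i} = {l}" "{l} - {j} = {l}" "{l} - {l} = {}" using ijl by auto
  have nv: "midpoint_value {l} i f = f (midpoint_opposite l)" "midpoint_value {l} j f = f (midpoint_opposite l)"
    using ijl by (auto simp: midpoint_value_def)
  have "triangle_energy (refinement {l} f \<circ> Phi l) = 2 * (f (midpoint_opposite l) - f (q l))\<^sup>2"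
    unfolding triangle_energy_perm[OF ijl] comp_apply mids_ijl Phi_q_same using ijl
    by (simp add: refinement_midpoint_opposite nv)
  then have l: "(5/3) ^ n * refined_energy {} n (refinement {l} f \<circ> Phi l) = 2 * (f (midpoint_opposite l) - f (q l))\<^sup>2"
    by (simp only: refined_energy_empty)
  have "(5/3) ^ Suc n * refined_energy {l} (Suc n) f = 5/3 * ((5/3) ^ n * refined_energy {l} n (refinement {l} f \<circ> Phi i)
     + (5/3) ^ n * refined_energy {l} n (refinement {l} f \<circ> Phi j) + (5/3) ^ n * refined_energy {} n (refinement {l} f \<circ> Phi l))"
    unfolding refined_energy.simps sum_3_perm[OF ijl] d by (simp add: algebra_simps)
  then show ?thesis unfolding l by simp
qed

lemma refined_energy_one_children:
  "(refinement {l} f \<circ> Phi i) (q l) = f (midpoint_opposite l)" "(refinement {l} f \<circ> Phi i) (q j) = f (midpoint_opposite l)"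
  "(refinement {l} f \<circ> Phi j) (q l) = f (midpoint_opposite l)" "(refinement {l} f \<circ> Phi j) (q i) = f (midpoint_opposite l)"
  unfolding comp_apply mids_ijl using ijl by (auto simp: refinement_midpoint_opposite midpoint_value_def)

end

text \<open>The hypothesis reproduces itself: in either lower child the apex and one end of the
  prescribed side both carry the midpoint value. It also turns the cost of the top child into an
  increment of one of the two halves of the side, which the budget contains.\<close>

lemma refined_energy_one_endpoint:
  assumes ijl: "i < 3" "j < 3" "l < 3" "i \<noteq> j" "j \<noteq> l" "i \<noteq> l"
    and "f (q l) = f (q i) \<or> f (q l) = f (q j)"
  shows "(5/3) ^ n * refined_energy {l} n f \<le> 2 * side_budget n i j f"
  using assms(7)
proof (induction n arbitrary: f)
  case 0
  then show ?case by (auto simp: triangle_energy_perm[OF ijl] power2_commute)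
next
  case (Suc n)
  have r: "side_budget n i j (refinement {l} f \<circ> Phi i) = side_budget n i j (f \<circ> Phi i)" "side_budget n i j (refinement {l} f \<circ> Phi j) = side_budget n i j (f \<circ> Phi j)"
    by (rule side_budget_refinement; use ijl in simp)+
  have 1: "(5/3) ^ n * refined_energy {l} n (refinement {l} f \<circ> Phi i) \<le> 2 * side_budget n i j (f \<circ> Phi i)"
    unfolding r(1)[symmetric] by (rule Suc.IH) (simp only: refined_energy_one_children[OF ijl] simp_thms)
  have 2: "(5/3) ^ n * refined_energy {l} n (refinement {l} f \<circ> Phi j) \<le> 2 * side_budget n i j (f \<circ> Phi j)"
    unfolding r(2)[symmetric] by (rule Suc.IH) (simp only: refined_energy_one_children[OF ijl] simp_thms)
  have "(f (midpoint_opposite l) - f (q l))\<^sup>2 \<le> side_energy 0 i j (f \<circ> Phi i) + side_energy 0 i j (f \<circ> Phi j)"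
    using Suc.prems by (auto simp: mids_ijl[OF ijl] power2_commute)
  with 1 2 show ?case unfolding refined_energy_one_step[OF ijl] side_budget.simps by simp
qed

text \<open>For an arbitrary apex value the first refinement already leads to the situation of
  \<open>refined_energy_one_endpoint\<close>, so the deviation of the apex from the side is paid
  only once.\<close>

lemma refined_energy_one:
  assumes ijl: "i < 3" "j < 3" "l < 3" "i \<noteq> j" "j \<noteq> l" "i \<noteq> l"
  shows "(5/3) ^ n * refined_energy {l} n f \<le> 4 * side_budget n i j f + 10 * (f (q l) - f (q i))\<^sup>2"
proof (cases n)
  case 0
  have "(f (q j) - f (q l))\<^sup>2 \<le> 2 * (f (q j) - f (q i))\<^sup>2 + 2 * (f (q i) - f (q l))\<^sup>2" by (rule sq_diff_le)
  then show ?thesis unfolding 0 refined_energy.simps side_budget.simps side_energy.simps triangle_energy_perm[OF ijl] power_0 mult_1_left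
    using power2_commute[of "f (q j)" "f (q i)"] power2_commute[of "f (q l)" "f (q i)"]
      zero_le_power2[of "f (q i) - f (q l)"] zero_le_power2[of "f (q i) - f (q j)"] by argo
next
  case (Suc k)
  have r: "side_budget k i j (refinement {l} f \<circ> Phi i) = side_budget k i j (f \<circ> Phi i)" "side_budget k i j (refinement {l} f \<circ> Phi j) = side_budget k i j (f \<circ> Phi j)"
    by (rule side_budget_refinement; use ijl in simp)+
  have 1: "(5/3) ^ k * refined_energy {l} k (refinement {l} f \<circ> Phi i) \<le> 2 * side_budget k i j (f \<circ> Phi i)"
    unfolding r(1)[symmetric] by (rule refined_energy_one_endpoint[OF ijl]) (simp only: refined_energy_one_children[OF ijl] simp_thms)
  have 2: "(5/3) ^ k * refined_energy {l} k (refinement {l} f \<circ> Phi j) \<le> 2 * side_budget k i j (f \<circ> Phi j)"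
    unfolding r(2)[symmetric] by (rule refined_energy_one_endpoint[OF ijl]) (simp only: refined_energy_one_children[OF ijl] simp_thms)
  have 3: "(f (midpoint_opposite l) - f (q l))\<^sup>2 \<le> 2 * side_energy 0 i j (f \<circ> Phi i) + 2 * (f (q l) - f (q i))\<^sup>2"
    using sq_diff_le[of "f (midpoint_opposite l)" "f (q l)" "f (q i)"] by (simp add: mids_ijl[OF ijl] power2_commute)
  have nn: "0 \<le> side_energy 0 i j (f \<circ> Phi j)" "0 \<le> side_budget k i j (f \<circ> Phi i)" "0 \<le> side_budget k i j (f \<circ> Phi j)" "0 \<le> (f (q l) - f (q i))\<^sup>2" by simp_all
  show ?thesis unfolding Suc refined_energy_one_step[OF ijl] side_budget.simps using 1 2 3 nn by argo
qed

text \<open>The sides opposite \<open>q i\<close> and \<open>q l\<close> are prescribed and meet in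
  \<open>q k\<close>. The child at \<open>q k\<close> again has two prescribed sides; each of the
  other two has one.\<close>

lemma refined_energy_two:
  assumes ijl: "i < 3" "k < 3" "l < 3" "i \<noteq> k" "k \<noteq> l" "i \<noteq> l"
  shows "(5/3) ^ n * refined_energy {i, l} n f \<le> 10 * (side_budget n k i f + side_budget n k l f)"
proof (induction n arbitrary: f)
  case 0
  have kil: "k < 3" "i < 3" "l < 3" "k \<noteq> i" "i \<noteq> l" "k \<noteq> l" using ijl by auto
  have "(f (q i) - f (q l))\<^sup>2 \<le> 2 * (f (q i) - f (q k))\<^sup>2 + 2 * (f (q k) - f (q l))\<^sup>2" by (rule sq_diff_le)
  then show ?case unfolding refined_energy.simps side_budget.simps side_energy.simps triangle_energy_perm[OF kil] power_0 mult_1_left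
    using power2_commute[of "f (q i)" "f (q k)"]
      zero_le_power2[of "f (q k) - f (q l)"] zero_le_power2[of "f (q k) - f (q i)"] by argo
next
  case (Suc n)
  let ?A = "{i, l}"
  let ?r = "refinement ?A f"
  have nn: "\<not> is_singleton ?A" using ijl by (auto simp: is_singleton_def)
  have d: "?A - {i} = {l}" "?A - {l} = {i}" "?A - {k} = ?A" using ijl by auto
  have t: "side_budget n k i (?r \<circ> Phi k) = side_budget n k i (f \<circ> Phi k)" "side_budget n k l (?r \<circ> Phi k) = side_budget n k l (f \<circ> Phi k)"
     "side_budget n k i (?r \<circ> Phi i) = side_budget n k i (f \<circ> Phi i)" "side_budget n k l (?r \<circ> Phi l) = side_budget n k l (f \<circ> Phi l)"
    by (rule side_budget_refinement[of l] side_budget_refinement[of i]; use ijl in simp; fail)+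
  have mids: "Phi i (q l) = midpoint_opposite k" "Phi l (q i) = midpoint_opposite k" "Phi i (q k) = midpoint_opposite l" "Phi k (q i) = midpoint_opposite l" "Phi k (q l) = midpoint_opposite i" "Phi l (q k) = midpoint_opposite i"
    using ijl by (auto intro!: Phi_q_midpoint_opposite)
  have rv: "?r (midpoint_opposite k) = f (q k)" "?r (midpoint_opposite l) = f (midpoint_opposite l)" "?r (midpoint_opposite i) = f (midpoint_opposite i)"
    using ijl nn by (auto simp: refinement_midpoint_opposite midpoint_value_def)
  have 1: "(5/3) ^ n * refined_energy ?A n (?r \<circ> Phi k) \<le> 10 * (side_budget n k i (f \<circ> Phi k) + side_budget n k l (f \<circ> Phi k))"
    unfolding t(1,2)[symmetric] by (rule Suc.IH)
  \<comment> \<open>The apex of this child was copied from \<open>q k\<close>, hence the apex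
    deviation is an increment of \<open>f\<close> in the child at \<open>q k\<close>. That child's
    budget has room for it with the factor 10.\<close>
  have "(5/3) ^ n * refined_energy {l} n (?r \<circ> Phi i) \<le> 4 * side_budget n k i (?r \<circ> Phi i) + 10 * ((?r \<circ> Phi i) (q l) - (?r \<circ> Phi i) (q k))\<^sup>2"
    by (rule refined_energy_one) (use ijl in auto)
  then have 2: "(5/3) ^ n * refined_energy {l} n (?r \<circ> Phi i) \<le> 4 * side_budget n k i (f \<circ> Phi i) + 10 * side_energy 0 k i (f \<circ> Phi k)"
    unfolding t comp_apply mids rv by (simp add: mids)
  have "(5/3) ^ n * refined_energy {i} n (?r \<circ> Phi l) \<le> 4 * side_budget n k l (?r \<circ> Phi l) + 10 * ((?r \<circ> Phi l) (q i) - (?r \<circ> Phi l) (q k))\<^sup>2"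
    by (rule refined_energy_one) (use ijl in auto)
  then have 3: "(5/3) ^ n * refined_energy {i} n (?r \<circ> Phi l) \<le> 4 * side_budget n k l (f \<circ> Phi l) + 10 * side_energy 0 k l (f \<circ> Phi k)"
    unfolding t comp_apply mids rv by (simp add: mids)
  have e: "(5/3) ^ Suc n * refined_energy ?A (Suc n) f = 5/3 * ((5/3) ^ n * refined_energy {l} n (?r \<circ> Phi i)
     + (5/3) ^ n * refined_energy ?A n (?r \<circ> Phi k) + (5/3) ^ n * refined_energy {i} n (?r \<circ> Phi l))"
    unfolding refined_energy.simps sum_3_perm[OF ijl] d by (simp add: algebra_simps)
  have nn: "0 \<le> side_energy 0 k i (f \<circ> Phi i)" "0 \<le> side_energy 0 k l (f \<circ> Phi l)" "0 \<le> side_budget n k i (f \<circ> Phi i)" "0 \<le> side_budget n k l (f \<circ> Phi l)"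
    by simp_all
  show ?case unfolding e side_budget.simps using 1 2 3 nn by argo
qed

text \<open>With all sides prescribed the refinement changes nothing, and each of the three children
  has two prescribed sides. Each side of the triangle distributes its budget to the two children at
  its ends.\<close>

lemma refined_energy_three:
  "(5/3) ^ n * refined_energy {..<3} n f \<le> 10 * (side_budget n 0 1 f + side_budget n 1 2 f + side_budget n 0 2 f)"
proof (cases n)
  case 0
  have "0 \<le> triangle_energy f" by simp
  then show ?thesis unfolding 0 by (simp add: triangle_energy_def del: q_simps)
next
  case (Suc k)
  let ?A = "{..<3} :: nat set"
  have A: "?A = {0, 1, 2}" by auto
  have d: "?A - {0} = {1, 2}" "?A - {1} = {0, 2}" "?A - {2} = {0, 1}" unfolding A by auto
  have r: "refinement ?A f = f"
  proof
    fix x show "refinement ?A f x = f x"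
      by (cases "\<exists>k<3. x = midpoint_opposite k") (auto simp: refinement_midpoint_opposite midpoint_value_def refinement_other)
  qed
  have e: "(5/3) ^ Suc k * refined_energy ?A (Suc k) f = 5/3 * ((5/3) ^ k * refined_energy {1, 2} k (f \<circ> Phi 0)
     + (5/3) ^ k * refined_energy {0, 2} k (f \<circ> Phi 1) + (5/3) ^ k * refined_energy {0, 1} k (f \<circ> Phi 2))"
    unfolding refined_energy.simps sum_lessThan_3 d r by (simp add: algebra_simps)
  have "(5/3) ^ k * refined_energy {1, 2} k (f \<circ> Phi 0) \<le> 10 * (side_budget k 0 1 (f \<circ> Phi 0) + side_budget k 0 2 (f \<circ> Phi 0))"
    "(5/3) ^ k * refined_energy {0, 2} k (f \<circ> Phi 1) \<le> 10 * (side_budget k 1 0 (f \<circ> Phi 1) + side_budget k 1 2 (f \<circ> Phi 1))"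
    "(5/3) ^ k * refined_energy {0, 1} k (f \<circ> Phi 2) \<le> 10 * (side_budget k 2 0 (f \<circ> Phi 2) + side_budget k 2 1 (f \<circ> Phi 2))"
    by (rule refined_energy_two; simp)+
  note b = this[unfolded side_budget_commute[of k 1 0] side_budget_commute[of k 2 0] side_budget_commute[of k 2 1]]
  have "0 \<le> side_energy 0 i j g" for i j g by simp
  note nn = this[of 0 1 "f \<circ> Phi 0"] this[of 0 1 "f \<circ> Phi 1"] this[of 1 2 "f \<circ> Phi 1"]
     this[of 1 2 "f \<circ> Phi 2"] this[of 0 2 "f \<circ> Phi 0"] this[of 0 2 "f \<circ> Phi 2"]
  have alg: "5/3 * (x0 + x1 + x2) \<le> 10 * (5/3 * ((a0 + t0) + (a1 + t1)) + 5/3 * ((b1 + s1) + (b2 + s2)) + 5/3 * ((c0 + r0) + (c2 + r2)))"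
    if "x0 \<le> 10 * (t0 + r0)" "x1 \<le> 10 * (t1 + s1)" "x2 \<le> 10 * (r2 + s2)"
      "0 \<le> a0" "0 \<le> a1" "0 \<le> b1" "0 \<le> b2" "0 \<le> c0" "0 \<le> c2"
    for x0 x1 x2 a0 t0 a1 t1 b1 s1 b2 s2 c0 r0 c2 r2 :: real
    using that by (simp add: ring_distribs add_divide_distrib)
  show ?thesis unfolding Suc e side_budget.simps by (rule alg[OF b nn])
qed

section \<open>Extension from vertices to the gasket\<close>

text \<open>Both phases of the recursion have one shape: a modification that spares the corners,
  common to all siblings, followed by the choice of a child. Only this is used for the independence
  of the address.\<close>

lemma refined_value_step:
  obtains m' f' B where "\<And>i. i < 3 \<Longrightarrow> f' (q i) = f (q i)"
    "\<And>a w. refined_value m A (a # w) f = refined_value m' (B a) w (f' \<circ> Phi a)"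
proof (cases m)
  case 0
  show ?thesis by (rule that[of "refinement A f" 0 "\<lambda>a. A - {a}"]) (simp_all add: 0)
next
  case (Suc k)
  show ?thesis by (rule that[of f k "\<lambda>_. A"]) (simp_all add: Suc)
qed

text \<open>By \<open>corner_unique\<close> an address of a corner stays in the child at that
  corner, and no step overwrites corner values.\<close>

lemma refined_value_corner:
  assumes "set v \<subseteq> {..<3}" "i < 3" "j < 3" "Phiw v (q j) = q i"
  shows "refined_value m A v f (q j) = f (q i)"
  using assms
proof (induction v arbitrary: m A f)
  case (Cons b v)
  obtain m' f' B where 1: "\<And>i. i < 3 \<Longrightarrow> f' (q i) = f (q i)"
    "\<And>a w. refined_value m A (a # w) f = refined_value m' (B a) w (f' \<circ> Phi a)" by (rule refined_value_step[of f m A]) blast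
  have "b = i \<and> Phiw v (q j) = q i"
    by (rule corner_unique) (use Cons.prems in \<open>auto intro: VertI\<close>)
  then show ?case using Cons 1 by simp
qed simp

text \<open>A common first letter is stripped from both words. If the first letters \<open>a\<close>
  and \<open>b\<close> differ, the vertex is the junction \<open>Phi a (q b) = Phi b (q a)\<close>,
  a corner of both siblings, and both read the same function there.\<close>

lemma refined_value_well_defined:
  assumes "set w \<subseteq> {..<3}" "set v \<subseteq> {..<3}" "i < 3" "j < 3" "Phiw w (q i) = Phiw v (q j)"
  shows "refined_value m A w f (q i) = refined_value m A v f (q j)"
  using assms
proof (induction w arbitrary: v m A f)
  case Nil
  then have "refined_value m A v f (q j) = f (q i)" by (intro refined_value_corner) auto
  then show ?case by simp
next
  case (Cons a w)
  obtain m' f' B where 1: "\<And>i. i < 3 \<Longrightarrow> f' (q i) = f (q i)"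
    "\<And>a w. refined_value m A (a # w) f = refined_value m' (B a) w (f' \<circ> Phi a)" by (rule refined_value_step[of f m A]) blast
  show ?case
  proof (cases v)
    case Nil
    have "refined_value m A (a # w) f (q i) = f (q j)"
      by (rule refined_value_corner) (use Cons.prems Nil in auto)
    then show ?thesis using Nil by simp
  next
    case (Cons b u)
    have p: "Phi a (Phiw w (q i)) = Phi b (Phiw u (q j))" using Cons.prems(5) Cons by simp
    have s: "set w \<subseteq> {..<3}" "a < 3" "set u \<subseteq> {..<3}" "b < 3" using Cons.prems Cons by auto
    show ?thesis
    proof (cases "a = b")
      case True
      then show ?thesis using p s Cons Cons.IH[OF s(1,3) Cons.prems(3,4), of m' "B a" "f' \<circ> Phi a"]
        by (simp add: 1 Phi_inj comp_def)
    next
      case False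
      have "Phiw w (q i) = q b" "Phiw u (q j) = q a"
        by (rule junction_unique[OF _ _ _ _ _ p] junction_unique[OF _ _ _ _ _ p[symmetric]];
            use s False Cons.prems VertI in auto)+
      then have "refined_value m' (B a) w (f' \<circ> Phi a) (q i) = (f' \<circ> Phi a) (q b)"
        "refined_value m' (B b) u (f' \<circ> Phi b) (q j) = (f' \<circ> Phi b) (q a)"
        by (auto simp only: intro!: refined_value_corner s Cons.prems(3,4))
      then show ?thesis using Cons by (simp add: 1 Phi_q_commute[of a b])
    qed
  qed
qed

text \<open>A choice over all addresses of \<open>x\<close>; \<open>vertex_extension_eq\<close>
  shows that any address may be used.\<close>

definition vertex_extension :: "nat \<Rightarrow> (complex \<Rightarrow> real) \<Rightarrow> complex \<Rightarrow> real" where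
  "vertex_extension m f x = (SOME y. \<exists>w i. set w \<subseteq> {..<3} \<and> i < 3 \<and> x = Phiw w (q i) \<and> y = refined_value m {..<3} w f (q i))"

lemma vertex_extension_eq:
  assumes "set w \<subseteq> {..<3}" "i < 3"
  shows "vertex_extension m f (Phiw w (q i)) = refined_value m {..<3} w f (q i)"
proof -
  let ?P = "\<lambda>y. \<exists>v j. set v \<subseteq> {..<3} \<and> j < 3 \<and> Phiw w (q i) = Phiw v (q j) \<and> y = refined_value m {..<3} v f (q j)"
  have "?P (refined_value m {..<3} w f (q i))" using assms by blast
  then have "?P (vertex_extension m f (Phiw w (q i)))" unfolding vertex_extension_def by (rule someI)
  then obtain v j where v: "set v \<subseteq> {..<3}" "j < 3" "Phiw w (q i) = Phiw v (q j)"
    "vertex_extension m f (Phiw w (q i)) = refined_value m {..<3} v f (q j)" by blast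
  show ?thesis unfolding v(4) by (rule refined_value_well_defined[symmetric, OF assms(1) v(1) assms(2) v(2,3)])
qed

lemma vertex_extension_linear:
  assumes "x \<in> vertices"
  shows "vertex_extension m (\<lambda>y. a * f y + b * g y) x = a * vertex_extension m f x + b * vertex_extension m g x"
proof -
  obtain w i where w: "set w \<subseteq> {..<3}" "i < 3" "x = Phiw w (q i)" using assms by (auto simp: vertices_def)
  show ?thesis unfolding w(3) vertex_extension_eq[OF w(1,2)] by (rule refined_value_linear)
qed

lemma refined_value_append: "length w = m \<Longrightarrow> refined_value m A (w @ v) f = refined_value 0 A v (f \<circ> Phiw w)"
proof (induction w arbitrary: m f)
  case Nil
  have "f \<circ> Phiw [] = f" by auto
  then show ?case using Nil by simp
next
  case (Cons a w)
  have "f \<circ> Phi a \<circ> Phiw w = f \<circ> Phiw (a # w)" by auto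
  then show ?case using Cons.IH[of "m - 1" "f \<circ> Phi a"] Cons.prems by (cases m) (auto simp: comp_def)
qed

lemma vertex_extension_Phiw:
  assumes "w \<in> words m" "set v \<subseteq> {..<3}" "i < 3"
  shows "vertex_extension m f (Phiw w (Phiw v (q i))) = refined_value 0 {..<3} v (f \<circ> Phiw w) (q i)"
proof -
  have "set (w @ v) \<subseteq> {..<3}" using assms by (auto simp: words_def)
  then have "vertex_extension m f (Phiw (w @ v) (q i)) = refined_value m {..<3} (w @ v) f (q i)"
    using assms(3) by (rule vertex_extension_eq)
  then show ?thesis using assms by (simp add: Phiw_append refined_value_append words_def)
qed

lemma scaled_energy_vertex_extension:
  "scaled_energy (m + n) (vertex_extension m f) = (5/3) ^ m * (\<Sum>w\<in>words m. (5/3) ^ n * refined_energy {..<3} n (f \<circ> Phiw w))"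
proof -
  have "level_energy n (vertex_extension m f \<circ> Phiw w) = refined_energy {..<3} n (f \<circ> Phiw w)" if "w \<in> words m" for w
    by (rule level_energy_eq_refined_energy) (simp add: vertex_extension_Phiw[OF that])
  then have "level_energy (m + n) (vertex_extension m f) = (\<Sum>w\<in>words m. refined_energy {..<3} n (f \<circ> Phiw w))"
    unfolding level_energy_add by (rule sum.cong[OF refl])
  then show ?thesis by (simp add: scaled_energy_def power_add sum_distrib_left mult_ac)
qed

text \<open>Coordinates of vertices are nonnegative, so a point with coordinate \<open>l\<close>
  equal to 0 has no letter \<open>l\<close> in its address. Side \<open>l\<close> therefore remains
  prescribed in every cell on the way.\<close>

lemma refined_value_side:
  assumes "set v \<subseteq> {..<3}" "i < 3" "l < 3" "l \<in> A" "bary l (Phiw v (q i)) = 0"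
  shows "refined_value 0 A v f (q i) = f (Phiw v (q i))"
  using assms
proof (induction v arbitrary: A f)
  case (Cons a v)
  let ?z = "Phiw v (q i)"
  have "bary l (Phi a ?z) = bary l ?z / 2 + (if l = a then 1/2 else 0)"
    using Cons.prems by (intro bary_Phi) auto
  moreover have "0 \<le> bary l ?z" using Cons.prems by (intro bary_Phiw_q_nonneg) auto
  ultimately have al: "a \<noteq> l" "bary l ?z = 0" using Cons.prems(5) by (auto split: if_splits)
  have "refined_value 0 (A - {a}) v (refinement A f \<circ> Phi a) (q i) = (refinement A f \<circ> Phi a) ?z"
    using Cons al by auto
  also have "\<dots> = f (Phi a ?z)" using refinement_side[of l A "Phi a ?z"] Cons.prems by simp
  finally show ?case by simp
qed simp

lemma vertex_extension_side:
  assumes "w \<in> words m" "y \<in> vertices" "l < 3" "bary l y = 0"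
  shows "vertex_extension m f (Phiw w y) = f (Phiw w y)"
proof -
  obtain v i where v: "set v \<subseteq> {..<3}" "i < 3" "y = Phiw v (q i)" using assms(2) by (auto simp: vertices_def)
  have "refined_value 0 {..<3} v (f \<circ> Phiw w) (q i) = (f \<circ> Phiw w) (Phiw v (q i))"
    by (rule refined_value_side[of _ _ l]) (use assms v in auto)
  then show ?thesis unfolding v(3) vertex_extension_Phiw[OF assms(1) v(1,2)] by simp
qed

section \<open>Modulus of continuity on the vertices from an energy bound\<close>

lemma scaled_energy_comp_Phi: "a < 3 \<Longrightarrow> scaled_energy n (g \<circ> Phi a) \<le> 3/5 * scaled_energy (Suc n) g"
proof -
  assume "a < 3"
  then have "level_energy n (g \<circ> Phi a) \<le> level_energy (Suc n) g" unfolding level_energy.simps by (intro member_le_sum) auto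
  then have "(5/3) ^ n * level_energy n (g \<circ> Phi a) \<le> (5/3) ^ n * level_energy (Suc n) g" by simp
  then show ?thesis by (simp add: scaled_energy_def)
qed

lemma corner_diff_le:
  assumes "scaled_energy 0 g \<le> M" "i < 3" "j < 3" shows "\<bar>g (q i) - g (q j)\<bar> \<le> sqrt M"
proof (rule real_le_rsqrt)
  have "(g (q i) - g (q j))\<^sup>2 \<le> triangle_energy g"
  proof (cases "i = j")
    case False
    obtain l where l: "l < 3" "l \<noteq> i" "l \<noteq> j" "{i, j, l} = {0, 1, 2}" by (rule third_index[OF assms(2,3) False])
    have "triangle_energy g = (g (q i) - g (q j))\<^sup>2 + (g (q i) - g (q l))\<^sup>2 + (g (q j) - g (q l))\<^sup>2"
      by (rule triangle_energy_perm) (use assms(2,3) l(1-3) False in auto)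
    then show ?thesis by simp
  qed simp
  then show "\<bar>g (q i) - g (q j)\<bar>\<^sup>2 \<le> M" using assms(1) by (simp add: scaled_energy_def)
qed

text \<open>Passing to a child multiplies the energy bound by 3/5, hence its root by at most 4/5.
  The constant 5 solves C = 1 + 4/5 C, where 1 is the cost of moving between two corners.\<close>

lemma oscillation_le:
  assumes "\<And>n. scaled_energy n g \<le> M" "x \<in> vertices" "i < 3"
  shows "\<bar>g x - g (q i)\<bar> \<le> 5 * sqrt M"
proof -
  obtain v k where v: "set v \<subseteq> {..<3}" "k < 3" "x = Phiw v (q k)" using assms(2) by (auto simp: vertices_def)
  have "\<bar>g (Phiw v (q k)) - g (q i)\<bar> \<le> 5 * sqrt M"
    using v(1) assms(1,3)
  proof (induction v arbitrary: g M i)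
    case Nil
    have "0 \<le> M" using Nil(2)[of 0] scaled_energy_nonneg[of 0 g] by linarith
    then show ?case using corner_diff_le[OF Nil(2)[of 0] v(2) Nil(3)] real_sqrt_ge_zero[of M]
      unfolding Phiw_Nil by linarith
  next
    case (Cons a v)
    have M: "0 \<le> M" using Cons.prems(2)[of 0] scaled_energy_nonneg[of 0 g] by linarith
    have a: "a < 3" using Cons.prems by simp
    have N: "scaled_energy n (g \<circ> Phi a) \<le> 3/5 * M" for n
      using scaled_energy_comp_Phi[OF a, of n g] Cons.prems(2)[of "Suc n"] by linarith
    then have "\<bar>(g \<circ> Phi a) (Phiw v (q k)) - (g \<circ> Phi a) (q a)\<bar> \<le> 5 * sqrt (3/5 * M)"
      using Cons.prems(1) by (intro Cons.IH[OF _ N a]) auto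
    moreover have "sqrt (3/5 * M) \<le> 4/5 * sqrt M"
    proof -
      have "sqrt (3/5) \<le> 4/5" by (rule real_le_lsqrt) (auto simp: power2_eq_square)
      then show ?thesis unfolding real_sqrt_mult using M by (intro mult_right_mono) auto
    qed
    moreover have "\<bar>g (q a) - g (q i)\<bar> \<le> sqrt M"
      using corner_diff_le[OF Cons.prems(2) a Cons.prems(3)] .
    ultimately show ?case by simp
  qed
  then show ?thesis by (simp add: v(3))
qed

text \<open>A vertex closer to \<open>q i\<close> than 2^-n lies in the cell of level
  \<open>n\<close> at that corner, because a point of another child has some coordinate at least 1/2
  that vanishes at \<open>q i\<close>. In that cell the energy bound is
  \<open>M * (3/5)^n\<close>.\<close>

lemma corner_modulus:
  assumes "\<And>n. scaled_energy n g \<le> M" "x \<in> vertices" "i < 3" "bary_dist x (q i) < (1/2) ^ n"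
  shows "\<bar>g x - g (q i)\<bar> \<le> 5 * sqrt (M * (3/5) ^ n)"
  using assms
proof (induction n arbitrary: g M x)
  case 0 then show ?case using oscillation_le[of g M x i] by simp
next
  case (Suc n)
  obtain a y where a: "a < 3" "y \<in> vertices" "x = Phi a y" using Suc.prems(2) by (rule vertices_cases)
  have "a = i"
  proof (rule ccontr)
    assume "a \<noteq> i"
    then have "bary a x \<ge> 1/2" "bary a (q i) = 0"
      using a Suc.prems bary_vertices_nonneg[OF a(2,1)] by (auto simp: bary_Phi bary_q)
    then have "1/2 \<le> bary_dist x (q i)" using bary_le_bary_dist[OF a(1), of x "q i"] by linarith
    moreover have "(1/2) ^ Suc n \<le> (1/2::real)" using power_decreasing[of 1 "Suc n" "1/2::real"] by simp
    ultimately show False using Suc.prems(4) by linarith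
  qed
  then have x: "x = Phi i y" using a by simp
  have "scaled_energy n (g \<circ> Phi i) \<le> 3/5 * M" for n
    using scaled_energy_comp_Phi[OF Suc.prems(3), of n g] Suc.prems(1)[of "Suc n"] by linarith
  moreover have "bary_dist y (q i) < (1/2) ^ n"
    using Suc.prems(4) bary_dist_Phi[OF Suc.prems(3), of y "q i"] by (simp add: x)
  ultimately have "\<bar>(g \<circ> Phi i) y - (g \<circ> Phi i) (q i)\<bar> \<le> 5 * sqrt (3/5 * M * (3/5) ^ n)"
    using a Suc.prems by (intro Suc.IH) (simp_all del: comp_apply add: comp_def)
  then show ?case by (simp add: x mult_ac)
qed

text \<open>Two nearby points in different cells of level 1 are both close to the common corner, so this case
  reduces to the modulus at a corner; the factor 3/5 of the energy in a child absorbs the recursion.\<close>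
lemma vertex_modulus:
  assumes "\<And>n. scaled_energy n g \<le> M" "x \<in> vertices" "y \<in> vertices" "4 * bary_dist x y < (1/2) ^ n"
  shows "\<bar>g x - g y\<bar> \<le> 10 * sqrt (M * (3/5) ^ n)"
  using assms
proof (induction n arbitrary: g M x y)
  case 0
  have "\<bar>g x - g (q 0)\<bar> \<le> 5 * sqrt M" "\<bar>g y - g (q 0)\<bar> \<le> 5 * sqrt M"
    using 0 by (auto intro!: oscillation_le simp del: q_simps)
  then show ?case by simp
next
  case (Suc n)
  obtain i x' where i: "i < 3" "x' \<in> vertices" "x = Phi i x'" using Suc.prems(2) by (rule vertices_cases)
  obtain j y' where j: "j < 3" "y' \<in> vertices" "y = Phi j y'" using Suc.prems(3) by (rule vertices_cases)
  have N: "scaled_energy n (g \<circ> Phi i) \<le> 3/5 * M" if "i < 3" for n i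
    using scaled_energy_comp_Phi[OF that, of n g] Suc.prems(1)[of "Suc n"] by linarith
  have e: "3/5 * M * (3/5) ^ n = M * (3/5) ^ Suc n" by simp
  show ?case
  proof (cases "i = j")
    case True
    have "4 * bary_dist x' y' < (1/2) ^ n"
      using Suc.prems(4) bary_dist_Phi[OF i(1), of x' y'] i j True by simp
    then have "\<bar>(g \<circ> Phi i) x' - (g \<circ> Phi i) y'\<bar> \<le> 10 * sqrt (3/5 * M * (3/5) ^ n)"
      by (rule Suc.IH[OF N[OF i(1)] i(2) j(2)])
    then show ?thesis unfolding e by (simp add: i(3) j(3) True)
  next
    case False
    \<comment> \<open>The factor 4 in the hypothesis is the constant of
      \<open>junction_bary_dist\<close>.\<close>
    have "bary_dist x (Phi i (q j)) < (1/2) ^ Suc n" "bary_dist y (Phi j (q i)) < (1/2) ^ Suc n"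
      using junction_bary_dist[OF i(1) j(1) False i(2) j(2)] junction_bary_dist[OF j(1) i(1) False[symmetric] j(2) i(2)]
        Suc.prems(4) i(3) j(3) bary_dist_commute[of x y] by auto
    then have "bary_dist x' (q j) < (1/2) ^ n" "bary_dist y' (q i) < (1/2) ^ n"
      by (simp_all add: i j bary_dist_Phi)
    then have "\<bar>(g \<circ> Phi i) x' - (g \<circ> Phi i) (q j)\<bar> \<le> 5 * sqrt (3/5 * M * (3/5) ^ n)"
      "\<bar>(g \<circ> Phi j) y' - (g \<circ> Phi j) (q i)\<bar> \<le> 5 * sqrt (3/5 * M * (3/5) ^ n)"
      by (simp_all only: corner_modulus[OF N[OF i(1)] i(2) j(1)] corner_modulus[OF N[OF j(1)] j(2) i(1)])
    then show ?thesis unfolding e by (simp add: i(3) j(3) Phi_q_commute[of j i])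
  qed
qed

lemma uniformly_continuous_on_vertices:
  assumes "\<And>n. scaled_energy n g \<le> M" shows "uniformly_continuous_on vertices g"
  unfolding uniformly_continuous_on_def
proof (intro allI impI)
  fix e :: real assume e: "0 < e"
  have "(\<lambda>n. 10 * sqrt (M * (3/5) ^ n)) \<longlonglongrightarrow> 10 * sqrt (M * 0)"
    by (intro tendsto_intros LIMSEQ_realpow_zero) auto
  then have "eventually (\<lambda>n. 10 * sqrt (M * (3/5) ^ n) < e) sequentially"
    using e by (intro order_tendstoD) auto
  then obtain n where n: "10 * sqrt (M * (3/5) ^ n) < e" by (auto simp: eventually_sequentially)
  show "\<exists>d>0. \<forall>x\<in>vertices. \<forall>x'\<in>vertices. dist x' x < d \<longrightarrow> dist (g x') (g x) < e"
  \<comment> \<open>24 is 4 from \<open>vertex_modulus\<close> times 6 from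
    \<open>bary_dist_le_norm\<close>.\<close>
  proof (intro exI[of _ "(1/2) ^ n / 24"] conjI ballI impI)
    fix x x' assume x: "x \<in> vertices" "x' \<in> vertices" "dist x' x < (1/2) ^ n / 24"
    have "4 * bary_dist x' x \<le> 24 * dist x' x" using bary_dist_le_norm[of x' x] by (simp add: dist_norm)
    then have "4 * bary_dist x' x < (1/2) ^ n" using x(3) by linarith
    then have "\<bar>g x' - g x\<bar> \<le> 10 * sqrt (M * (3/5) ^ n)" using assms x by (intro vertex_modulus)
    then show "dist (g x') (g x) < e" using n by (simp add: dist_real_def)
  qed simp
qed

section \<open>Continuous extension from the vertices to the whole gasket\<close>

definition approx_seq :: "complex \<Rightarrow> nat \<Rightarrow> complex" where
  "approx_seq x = (SOME s. (\<forall>n. s n \<in> vertices) \<and> s \<longlonglongrightarrow> x)"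

lemma approx_seq: "x \<in> SG \<Longrightarrow> approx_seq x n \<in> vertices" "x \<in> SG \<Longrightarrow> approx_seq x \<longlonglongrightarrow> x"
proof -
  assume "x \<in> SG"
  then have "\<exists>s. (\<forall>n. s n \<in> vertices) \<and> s \<longlonglongrightarrow> x" by (simp add: SG_eq closure_sequential)
  from someI_ex[OF this] show "approx_seq x n \<in> vertices" "approx_seq x \<longlonglongrightarrow> x"
    unfolding approx_seq_def by auto
qed

text \<open>The approximating sequence depends on \<open>x\<close> alone and not on
  \<open>g\<close>, so linearity in \<open>g\<close> follows from linearity of limits.\<close>

definition gasket_extension :: "(complex \<Rightarrow> real) \<Rightarrow> complex \<Rightarrow> real" where
  "gasket_extension g x = lim (\<lambda>n. g (approx_seq x n))"

lemma gasket_extension: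
  assumes "\<And>n. scaled_energy n g \<le> M"
  shows "continuous_on SG (gasket_extension g)" "\<And>x. x \<in> vertices \<Longrightarrow> gasket_extension g x = g x"
    "\<And>x. x \<in> SG \<Longrightarrow> (\<lambda>n. g (approx_seq x n)) \<longlonglongrightarrow> gasket_extension g x"
proof -
  obtain h where h: "uniformly_continuous_on SG h" "\<And>x. x \<in> vertices \<Longrightarrow> g x = h x"
    using uniformly_continuous_on_extension_on_closure[OF uniformly_continuous_on_vertices[OF assms]]
    unfolding SG_eq by metis
  have c: "continuous_on SG h" using h(1) by (rule uniformly_continuous_imp_continuous)
  have l: "(\<lambda>n. g (approx_seq x n)) \<longlonglongrightarrow> h x" if x: "x \<in> SG" for x
  proof -
    have "(\<lambda>n. h (approx_seq x n)) \<longlonglongrightarrow> h x"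
      using x approx_seq[OF x] by (intro continuous_on_tendsto_compose[OF c]) (auto intro: vertices_SG always_eventually)
    then show ?thesis using approx_seq(1)[OF x] h(2) by simp
  qed
  then have e: "gasket_extension g x = h x" if "x \<in> SG" for x using that unfolding gasket_extension_def by (blast intro: limI)
  show "continuous_on SG (gasket_extension g)" using c e by (simp cong: continuous_on_cong)
  show "\<And>x. x \<in> vertices \<Longrightarrow> gasket_extension g x = g x" using e h(2) vertices_SG by auto
  show "\<And>x. x \<in> SG \<Longrightarrow> (\<lambda>n. g (approx_seq x n)) \<longlonglongrightarrow> gasket_extension g x" using l e by auto
qed

lemma level_energy_cong: "(\<And>x. x \<in> vertices \<Longrightarrow> f x = g x) \<Longrightarrow> level_energy n f = level_energy n g"
proof (induction n arbitrary: f g)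
  case 0 then show ?case unfolding level_energy.simps by (intro triangle_energy_cong) (simp add: q_vertices)
next
  case (Suc n)
  have "level_energy n (f \<circ> Phi i) = level_energy n (g \<circ> Phi i)" if "i < 3" for i
    using that Suc.prems by (intro Suc.IH) (simp add: Phi_vertices)
  then show ?case by simp
qed

lemma scaled_energy_gasket_extension:
  assumes "\<And>n. scaled_energy n g \<le> M" shows "scaled_energy n (gasket_extension g) = scaled_energy n g"
proof -
  have "level_energy n (gasket_extension g) = level_energy n g" by (rule level_energy_cong) (rule gasket_extension(2)[OF assms])
  then show ?thesis by (simp add: scaled_energy_def)
qed

lemma gasket_extension_dom_energy:
  assumes "\<And>n. scaled_energy n g \<le> M" shows "gasket_extension g \<in> dom_energy" "energy (gasket_extension g) \<le> 2 * M"
proof -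
  show d: "gasket_extension g \<in> dom_energy"
    unfolding dom_energy_iff scaled_energy_gasket_extension[OF assms] using gasket_extension(1)[OF assms] assms by blast
  show "energy (gasket_extension g) \<le> 2 * M"
    by (rule energy_le[OF d]) (simp add: scaled_energy_gasket_extension[OF assms] assms)
qed

section \<open>Bounding the Gagliardo seminorm by dyadic increments\<close>

definition gagliardo :: "real \<Rightarrow> (real \<Rightarrow> real) \<Rightarrow> ennreal" where
  "gagliardo p u = (\<integral>\<^sup>+x\<in>{0..1}. \<integral>\<^sup>+y\<in>{0..1}. ennreal ((u x - u y)\<^sup>2 / \<bar>x - y\<bar> powr p) \<partial>lborel \<partial>lborel)"

definition dyadic_increment :: "(real \<Rightarrow> real) \<Rightarrow> nat \<Rightarrow> nat \<Rightarrow> real" where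
  "dyadic_increment u j k = (u (real (Suc k) / 2 ^ j) - u (real k / 2 ^ j))\<^sup>2"

text \<open>The intervals overlap, so that \<open>fat_increments u j x\<close> dominates the increments of \<open>u\<close> over all
  dyadic intervals of level \<open>j\<close> adjacent to \<open>x\<close>.\<close>
definition fat_increments :: "(real \<Rightarrow> real) \<Rightarrow> nat \<Rightarrow> real \<Rightarrow> real" where
  "fat_increments u j x = (\<Sum>k<2^j. dyadic_increment u j k * indicator {(real k - 2) / 2 ^ j..(real k + 2) / 2 ^ j} x)"

lemma fat_increments_nonneg [simp]: "0 \<le> fat_increments u j x"
  unfolding fat_increments_def by (intro sum_nonneg mult_nonneg_nonneg) (auto simp: dyadic_increment_def)

lemma borel_measurable_fat_increments [measurable]: "fat_increments u j \<in> borel_measurable borel"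
  unfolding fat_increments_def by measurable

lemma nn_integral_fat_increments: "(\<integral>\<^sup>+x. ennreal (fat_increments u j x) \<partial>lborel) = ennreal (4 / 2 ^ j * dyadic_energy j u)"
proof -
  let ?I = "\<lambda>k. {(real k - 2) / 2 ^ j..(real k + 2) / 2 ^ j}"
  have "(\<integral>\<^sup>+x. ennreal (fat_increments u j x) \<partial>lborel) = (\<integral>\<^sup>+x. (\<Sum>k<2^j. ennreal (dyadic_increment u j k) * indicator (?I k) x) \<partial>lborel)"
    unfolding fat_increments_def
    by (intro nn_integral_cong) (simp add: sum_ennreal[symmetric] ennreal_mult' dyadic_increment_def ennreal_indicator flip: sum_ennreal)
  also have "\<dots> = (\<Sum>k<2^j. ennreal (dyadic_increment u j k) * emeasure lborel (?I k))"
    by (subst nn_integral_sum) (auto simp: nn_integral_cmult)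
  also have "\<dots> = (\<Sum>k<2^j. ennreal (dyadic_increment u j k * (4 / 2 ^ j)))"
  proof (intro sum.cong refl)
    fix k
    have "(real k - 2) / 2 ^ j \<le> (real k + 2) / 2 ^ j" by (intro divide_right_mono) auto
    then have "emeasure lborel (?I k) = ennreal ((real k + 2) / 2 ^ j - (real k - 2) / 2 ^ j)" by simp
    also have "(real k + 2) / 2 ^ j - (real k - 2) / 2 ^ j = 4 / 2 ^ j" by (simp flip: diff_divide_distrib)
    finally have "emeasure lborel (?I k) = ennreal (4 / 2 ^ j)" .
    moreover have "0 \<le> dyadic_increment u j k" by (simp add: dyadic_increment_def)
    ultimately show "ennreal (dyadic_increment u j k) * emeasure lborel (?I k) = ennreal (dyadic_increment u j k * (4 / 2 ^ j))"
      by (metis ennreal_mult')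
  qed
  also have "\<dots> = ennreal (\<Sum>k<2^j. dyadic_increment u j k * (4 / 2 ^ j))"
    by (rule sum_ennreal) (simp add: dyadic_increment_def)
  also have "(\<Sum>k<2^j. dyadic_increment u j k * (4 / 2 ^ j)) = 4 / 2 ^ j * dyadic_energy j u"
    by (simp add: dyadic_energy_def dyadic_increment_def sum_distrib_left mult.commute)
  finally show ?thesis .
qed

lemma adjacent_le_fat_increments:
  assumes "k \<le> 2 ^ n" "k' \<le> 2 ^ n" "k \<le> Suc k'" "k' \<le> Suc k" "\<bar>x - real k / 2 ^ n\<bar> \<le> 1 / 2 ^ n"
  shows "(u (real k / 2 ^ n) - u (real k' / 2 ^ n))\<^sup>2 \<le> fat_increments u n x"
proof (cases "k = k'")
  case False
  \<comment> \<open>The smaller index stays below \<open>2 ^ n\<close> even if the other one is the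
    right end point, and so names an interval of the sum.\<close>
  define K where "K = min k k'"
  have K: "K < 2 ^ n" using assms False by (auto simp: K_def)
  have "\<bar>real k - real K\<bar> \<le> 1" using assms False by (auto simp: K_def)
  then have "\<bar>(real k - real K) / 2 ^ n\<bar> \<le> 1 / 2 ^ n" by (simp add: abs_divide divide_right_mono)
  then have "\<bar>real k / 2 ^ n - real K / 2 ^ n\<bar> \<le> 1 / 2 ^ n" by (simp add: diff_divide_distrib)
  then have "real K / 2 ^ n - 2 * (1 / 2 ^ n) \<le> x" "x \<le> real K / 2 ^ n + 2 * (1 / 2 ^ n)"
    using assms(5) by linarith+
  then have "x \<in> {(real K - 2) / 2 ^ n..(real K + 2) / 2 ^ n}"
    by (simp add: diff_divide_distrib add_divide_distrib)
  then have "dyadic_increment u n K = dyadic_increment u n K * indicator {(real K - 2) / 2 ^ n..(real K + 2) / 2 ^ n} x" by simp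
  also have "\<dots> \<le> fat_increments u n x" unfolding fat_increments_def
    by (rule member_le_sum) (use K in \<open>auto simp: dyadic_increment_def\<close>)
  finally have "dyadic_increment u n K \<le> fat_increments u n x" .
  moreover have "(u (real k / 2 ^ n) - u (real k' / 2 ^ n))\<^sup>2 = dyadic_increment u n K"
  proof (cases "k < k'")
    case True
    then have "K = k" "k' = Suc k" using assms by (auto simp: K_def)
    then show ?thesis by (simp only: dyadic_increment_def power2_commute[of "u (real k / 2 ^ n)"])
  next
    case False
    then have "K = k'" "k = Suc k'" using assms \<open>k \<noteq> k'\<close> by (auto simp: K_def)
    then show ?thesis by (simp only: dyadic_increment_def)
  qed
  ultimately show ?thesis by simp
qed simp

lemma dyadic_floor_near: "0 \<le> x \<Longrightarrow> \<bar>x - real (nat \<lfloor>2 ^ n * x\<rfloor>) / 2 ^ n\<bar> \<le> 1 / 2 ^ n"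
  using dyadic_floor_bounds[of x n] by (simp add: dyadic_floor_def)

lemma dyadic_floor_diff_le_fat_increments:
  assumes "0 \<le> x" "x \<le> 1" "0 \<le> y" "y \<le> 1" "\<bar>x - y\<bar> \<le> 1 / 2 ^ n"
  shows "(u (dyadic_floor n x) - u (dyadic_floor n y))\<^sup>2 \<le> fat_increments u n x"
  unfolding dyadic_floor_def
proof (rule adjacent_le_fat_increments)
  have "\<bar>2 ^ n * x - 2 ^ n * y\<bar> = 2 ^ n * \<bar>x - y\<bar>" by (simp add: abs_mult flip: right_diff_distrib)
  also have "\<dots> \<le> 1" using assms(5) by (simp add: field_simps)
  finally have d: "\<bar>2 ^ n * x - 2 ^ n * y\<bar> \<le> 1" .
  have "\<lfloor>2 ^ n * x\<rfloor> \<le> \<lfloor>2 ^ n * y + 1\<rfloor>" "\<lfloor>2 ^ n * y\<rfloor> \<le> \<lfloor>2 ^ n * x + 1\<rfloor>"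
    using d by (intro floor_mono; linarith)+
  moreover have "0 \<le> \<lfloor>2 ^ n * x\<rfloor>" "0 \<le> \<lfloor>2 ^ n * y\<rfloor>" using assms by simp_all
  ultimately show "nat \<lfloor>2 ^ n * x\<rfloor> \<le> Suc (nat \<lfloor>2 ^ n * y\<rfloor>)" "nat \<lfloor>2 ^ n * y\<rfloor> \<le> Suc (nat \<lfloor>2 ^ n * x\<rfloor>)"
    by linarith+
qed (use assms dyadic_floor_index dyadic_floor_near in auto)

text \<open>The index at level \<open>n + 1\<close> is twice the index at level \<open>n\<close>, or
  one more, so the two points are equal or adjacent at the finer level.\<close>

lemma dyadic_floor_step_le_fat_increments:
  assumes "0 \<le> x" "x \<le> 1"
  shows "(u (dyadic_floor (Suc n) x) - u (dyadic_floor n x))\<^sup>2 \<le> fat_increments u (Suc n) x"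
proof -
  define k where "k = nat \<lfloor>2 ^ n * x\<rfloor>"
  define l where "l = nat \<lfloor>2 ^ Suc n * x\<rfloor>"
  have k: "real k \<le> 2 ^ n * x" "2 ^ n * x < real k + 1"
    and l: "real l \<le> 2 ^ Suc n * x" "2 ^ Suc n * x < real l + 1"
    using assms by (simp_all add: k_def l_def)
  have "real (2 * k) < real (l + 1)" "real l < real (2 * k + 2)" using k l by simp_all
  then have kl: "2 * k \<le> l" "l \<le> Suc (2 * k)" unfolding of_nat_less_iff by linarith+
  have "k \<le> 2 ^ n" "l \<le> 2 ^ Suc n" using assms dyadic_floor_index unfolding k_def l_def by blast+
  then have "(u (real l / 2 ^ Suc n) - u (real (2 * k) / 2 ^ Suc n))\<^sup>2 \<le> fat_increments u (Suc n) x"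
    using kl dyadic_floor_near[OF assms(1), of "Suc n"] by (intro adjacent_le_fat_increments) (auto simp: l_def)
  then show ?thesis by (simp add: dyadic_floor_def k_def l_def)
qed

text \<open>Iterating (r + s)^2 \<le> 2 r^2 + 2 s^2 along the levels gives the weights
  \<open>2 ^ Suc i\<close>.\<close>

lemma dyadic_floor_chain:
  assumes "0 \<le> x" "x \<le> 1"
  shows "(u (dyadic_floor (n + N) x) - u (dyadic_floor n x))\<^sup>2 \<le> (\<Sum>i<N. 2 ^ Suc i * fat_increments u (Suc (n + i)) x)"
proof (induction N arbitrary: n)
  case (Suc N)
  have "(u (dyadic_floor (n + Suc N) x) - u (dyadic_floor n x))\<^sup>2
     \<le> 2 * (u (dyadic_floor (Suc n + N) x) - u (dyadic_floor (Suc n) x))\<^sup>2 + 2 * (u (dyadic_floor (Suc n) x) - u (dyadic_floor n x))\<^sup>2"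
    using sq_diff_le[of "u (dyadic_floor (Suc n + N) x)" "u (dyadic_floor n x)" "u (dyadic_floor (Suc n) x)"] by simp
  also have "\<dots> \<le> 2 * (\<Sum>i<N. 2 ^ Suc i * fat_increments u (Suc (Suc n + i)) x) + 2 * fat_increments u (Suc n) x"
    using Suc[of "Suc n"] dyadic_floor_step_le_fat_increments[OF assms, of u n] by linarith
  also have "\<dots> = (\<Sum>i<Suc N. 2 ^ Suc i * fat_increments u (Suc (n + i)) x)"
    unfolding sum.lessThan_Suc_shift by (simp add: sum_distrib_left mult.assoc)
  finally show ?case .
qed simp

lemma dyadic_floor_pair_le:
  assumes "0 \<le> x" "x \<le> 1" "0 \<le> y" "y \<le> 1" "\<bar>x - y\<bar> \<le> 1 / 2 ^ n"
  shows "(u (dyadic_floor (n + N) x) - u (dyadic_floor (n + N) y))\<^sup>2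
    \<le> 3 * (\<Sum>i\<le>N. 2 ^ i * (fat_increments u (n + i) x + fat_increments u (n + i) y))"
proof -
  have t: "(a - d)\<^sup>2 \<le> 3 * ((a - b)\<^sup>2 + (b - c)\<^sup>2 + (d - c)\<^sup>2)" for a b c d :: real
  proof -
    have "0 \<le> ((a - b) - (b - c))\<^sup>2 + ((b - c) + (d - c))\<^sup>2 + ((a - b) + (d - c))\<^sup>2" by simp
    then show ?thesis by (simp add: power2_eq_square algebra_simps)
  qed
  have "(u (dyadic_floor (n + N) x) - u (dyadic_floor (n + N) y))\<^sup>2
    \<le> 3 * ((u (dyadic_floor (n + N) x) - u (dyadic_floor n x))\<^sup>2 + (u (dyadic_floor n x) - u (dyadic_floor n y))\<^sup>2 + (u (dyadic_floor (n + N) y) - u (dyadic_floor n y))\<^sup>2)"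
    by (rule t)
  also have "\<dots> \<le> 3 * ((\<Sum>i<N. 2 ^ Suc i * fat_increments u (Suc (n + i)) x) + (fat_increments u n x + fat_increments u n y)
      + (\<Sum>i<N. 2 ^ Suc i * fat_increments u (Suc (n + i)) y))"
  proof -
    have "(u (dyadic_floor n x) - u (dyadic_floor n y))\<^sup>2 \<le> fat_increments u n x + fat_increments u n y"
      using dyadic_floor_diff_le_fat_increments[OF assms, of u] fat_increments_nonneg[of u n y] by linarith
    then show ?thesis using dyadic_floor_chain[OF assms(1,2), of u n N] dyadic_floor_chain[OF assms(3,4), of u n N]
      by (intro mult_left_mono add_mono) auto
  qed
  also have "\<dots> = 3 * (\<Sum>i\<le>N. 2 ^ i * (fat_increments u (n + i) x + fat_increments u (n + i) y))"
    unfolding lessThan_Suc_atMost[symmetric] sum.lessThan_Suc_shift by (simp add: ring_distribs sum.distrib)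
  finally show ?thesis .
qed

text \<open>What the increments of level \<open>j\<close> contribute to the integrand. Here
  \<open>n\<close> is a possible scale of the distance of \<open>x\<close> and \<open>y\<close>,
  \<open>(20/3) ^ Suc n\<close> bounds the kernel at that scale, and \<open>2 ^ (j - n)\<close> is
  the loss of \<open>dyadic_floor_chain\<close> between the levels \<open>n\<close> and
  \<open>j\<close>.\<close>

definition gagliardo_majorant :: "(real \<Rightarrow> real) \<Rightarrow> nat \<Rightarrow> real \<Rightarrow> real \<Rightarrow> real" where
  "gagliardo_majorant u j x y = (\<Sum>n\<le>j. 3 * (20/3) ^ Suc n * 2 ^ (j - n) *
     ((fat_increments u j x + fat_increments u j y) * indicator {..1 / 2 ^ n} \<bar>x - y\<bar>))"

lemma gagliardo_majorant_nonneg [simp]: "0 \<le> gagliardo_majorant u j x y"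
  unfolding gagliardo_majorant_def by (intro sum_nonneg mult_nonneg_nonneg add_nonneg_nonneg) auto

lemma gagliardo_majorant_ge:
  assumes "0 \<le> x" "x \<le> 1" "0 \<le> y" "y \<le> 1" "\<bar>x - y\<bar> \<le> 1 / 2 ^ n"
  shows "(20/3) ^ Suc n * (u (dyadic_floor (n + N) x) - u (dyadic_floor (n + N) y))\<^sup>2 \<le> (\<Sum>j<Suc (n + N). gagliardo_majorant u j x y)"
proof -
  have "(20/3) ^ Suc n * (u (dyadic_floor (n + N) x) - u (dyadic_floor (n + N) y))\<^sup>2
    \<le> (20/3) ^ Suc n * (3 * (\<Sum>i\<le>N. 2 ^ i * (fat_increments u (n + i) x + fat_increments u (n + i) y)))"
    by (intro mult_left_mono dyadic_floor_pair_le assms) simp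
  also have "\<dots> = (\<Sum>i\<le>N. 3 * (20/3) ^ Suc n * 2 ^ i * (fat_increments u (n + i) x + fat_increments u (n + i) y))"
    by (simp add: sum_distrib_left mult_ac)
  also have "\<dots> \<le> (\<Sum>i\<le>N. gagliardo_majorant u (n + i) x y)"
  proof (rule sum_mono)
    fix i
    have "3 * (20/3) ^ Suc n * 2 ^ i * (fat_increments u (n + i) x + fat_increments u (n + i) y)
      = 3 * (20/3) ^ Suc n * 2 ^ (n + i - n) *
     ((fat_increments u (n + i) x + fat_increments u (n + i) y) * indicator {..1 / 2 ^ n} \<bar>x - y\<bar>)"
      using assms(5) by simp
    also have "\<dots> \<le> gagliardo_majorant u (n + i) x y" unfolding gagliardo_majorant_def
      by (rule member_le_sum[where f = "\<lambda>m. 3 * (20/3) ^ Suc m * 2 ^ (n + i - m) *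
     ((fat_increments u (n + i) x + fat_increments u (n + i) y) * indicator {..1 / 2 ^ m} \<bar>x - y\<bar>)"]) auto
    finally show "3 * (20/3) ^ Suc n * 2 ^ i * (fat_increments u (n + i) x + fat_increments u (n + i) y) \<le> gagliardo_majorant u (n + i) x y" .
  qed
  also have "\<dots> = (\<Sum>j\<in>(+) n ` {..N}. gagliardo_majorant u j x y)"
    by (subst sum.reindex) (auto simp: inj_on_def)
  also have "\<dots> \<le> (\<Sum>j<Suc (n + N). gagliardo_majorant u j x y)"
    by (intro sum_mono2) auto
  finally show ?thesis .
qed

lemma dyadic_scale:
  fixes d :: real
  assumes "0 < d" "d \<le> 1"
  obtains n where "1 / 2 ^ Suc n < d" "d \<le> 1 / 2 ^ n"
proof -
  define P where "P n \<longleftrightarrow> 1 / 2 ^ Suc n < d" for n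
  have "\<exists>n. (1/2) ^ n < d" using real_arch_pow_inv[OF assms(1), of "1/2"] by auto
  then obtain n0 where "(1/2) ^ n0 < d" by blast
  moreover have "(1/2) ^ Suc n0 \<le> (1/2 :: real) ^ n0" by simp
  ultimately have "P n0" unfolding P_def by (simp add: power_divide)
  then have L: "P (LEAST n. P n)" by (rule LeastI)
  define n where "n = (LEAST n. P n)"
  have "d \<le> 1 / 2 ^ n"
  proof (cases n)
    case (Suc k)
    then have "\<not> P k" using not_less_Least[of k P] n_def by simp
    then show ?thesis unfolding Suc P_def by (simp only: not_less)
  qed (use assms in simp)
  then show ?thesis using that[of n] L unfolding P_def n_def by blast
qed

text \<open>For a distance between 2^-(n+1) and 2^-n the kernel is at most (20/3)^(n+1). The bound
  for the roundings at level n + N is uniform in N and passes to the limit by continuity of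
  \<open>u\<close>.\<close>

lemma gagliardo_integrand_le:
  assumes u: "continuous_on {0..1} u" and p: "2 powr p = 20/3"
    and xy: "x \<in> {0..1}" "y \<in> {0..1}"
  shows "ennreal ((u x - u y)\<^sup>2 / \<bar>x - y\<bar> powr p) \<le> (\<Sum>j. ennreal (gagliardo_majorant u j x y))"
proof (cases "x = y")
  case False
  then have "0 < \<bar>x - y\<bar>" "\<bar>x - y\<bar> \<le> 1" using xy by auto
  then obtain n where n: "1 / 2 ^ Suc n < \<bar>x - y\<bar>" "\<bar>x - y\<bar> \<le> 1 / 2 ^ n" by (rule dyadic_scale)
  have p0: "0 \<le> p"
  proof (rule ccontr)
    assume "\<not> 0 \<le> p"
    then have "2 powr p \<le> 2 powr 0" by (intro powr_mono) auto
    then show False using p by simp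
  qed
  have "(1 / 2 ^ Suc n) powr p \<le> \<bar>x - y\<bar> powr p" using n p0 by (intro powr_mono2) auto
  moreover have "(1 / 2 ^ Suc n) powr p = 1 / (20/3) ^ Suc n"
  proof -
    have "(2 ^ Suc n) powr p = (2 powr p) ^ Suc n"
      by (metis powr_realpow powr_powr powr_power mult.commute zero_less_numeral powr_gt_zero)
    moreover have "(1 / 2 ^ Suc n) powr p = 1 / (2 ^ Suc n) powr p" by (subst powr_divide) auto
    ultimately show ?thesis unfolding p by (simp only:)
  qed
  ultimately have "1 / (20/3) ^ Suc n \<le> \<bar>x - y\<bar> powr p" by argo
  then have "1 / \<bar>x - y\<bar> powr p \<le> 1 / (1 / (20/3) ^ Suc n)" by (intro divide_left_mono mult_pos_pos) (use False in auto)
  then have k: "1 / \<bar>x - y\<bar> powr p \<le> (20/3) ^ Suc n" by (simp only: div_by_1 divide_divide_eq_right mult_1_left)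
  have "(u x - u y)\<^sup>2 / \<bar>x - y\<bar> powr p \<le> (20/3) ^ Suc n * (u x - u y)\<^sup>2"
    using mult_right_mono[OF k, of "(u x - u y)\<^sup>2"] by simp
  then have "ennreal ((u x - u y)\<^sup>2 / \<bar>x - y\<bar> powr p) \<le> ennreal ((20/3) ^ Suc n * (u x - u y)\<^sup>2)"
    by (rule ennreal_leI)
  also have "\<dots> \<le> (\<Sum>j. ennreal (gagliardo_majorant u j x y))"
  proof (rule LIMSEQ_le_const2)
    have c: "(\<lambda>N. u (dyadic_floor (n + N) z)) \<longlonglongrightarrow> u z" if z: "z \<in> {0..1}" for z
    proof -
      have "(\<lambda>N. dyadic_floor (N + n) z) \<longlonglongrightarrow> z" using z by (intro LIMSEQ_ignore_initial_segment dyadic_floor_tendsto) auto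
      then have "(\<lambda>N. dyadic_floor (n + N) z) \<longlonglongrightarrow> z" by (simp add: add.commute)
      then show ?thesis
        using z dyadic_floor_range by (intro continuous_on_tendsto_compose[OF u]) auto
    qed
    show "(\<lambda>N. ennreal ((20/3) ^ Suc n * (u (dyadic_floor (n + N) x) - u (dyadic_floor (n + N) y))\<^sup>2))
       \<longlonglongrightarrow> ennreal ((20/3) ^ Suc n * (u x - u y)\<^sup>2)"
      by (intro tendsto_intros c xy)
    have "ennreal ((20/3) ^ Suc n * (u (dyadic_floor (n + N) x) - u (dyadic_floor (n + N) y))\<^sup>2) \<le> (\<Sum>j. ennreal (gagliardo_majorant u j x y))" for N
    proof -
      have "ennreal ((20/3) ^ Suc n * (u (dyadic_floor (n + N) x) - u (dyadic_floor (n + N) y))\<^sup>2)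
         \<le> ennreal (\<Sum>j<Suc (n + N). gagliardo_majorant u j x y)"
        using xy n by (intro ennreal_leI gagliardo_majorant_ge) auto
      also have "\<dots> = (\<Sum>j<Suc (n + N). ennreal (gagliardo_majorant u j x y))"
        by (rule sum_ennreal[symmetric]) simp
      also have "\<dots> \<le> (\<Sum>j. ennreal (gagliardo_majorant u j x y))" by (rule sum_le_suminf) auto
      finally show ?thesis .
    qed
    then show "\<exists>N. \<forall>k\<ge>N. ennreal ((20/3) ^ Suc n * (u (dyadic_floor (n + k) x) - u (dyadic_floor (n + k) y))\<^sup>2) \<le> (\<Sum>j. ennreal (gagliardo_majorant u j x y))"
      by blast
  qed
  finally show ?thesis .
qed simp

lemma nn_integral_band:
  assumes [measurable]: "f \<in> borel_measurable borel" and "0 \<le> (r :: real)"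
  shows "(\<integral>\<^sup>+x. \<integral>\<^sup>+y. f x * indicator {..r} \<bar>x - y\<bar> \<partial>lborel \<partial>lborel)
     = ennreal (2 * r) * (\<integral>\<^sup>+x. f x \<partial>lborel)"
proof -
  have "(\<integral>\<^sup>+y. f x * indicator {..r} \<bar>x - y\<bar> \<partial>lborel) = f x * ennreal (2 * r)" for x
  proof -
    have "(\<integral>\<^sup>+y. f x * indicator {..r} \<bar>x - y\<bar> \<partial>lborel) = (\<integral>\<^sup>+y. f x * indicator {x - r..x + r} y \<partial>lborel)"
      by (intro nn_integral_cong) (auto simp: indicator_def abs_le_iff)
    also have "\<dots> = f x * ennreal (2 * r)" using assms(2) by (simp add: nn_integral_cmult)
    finally show ?thesis .
  qed
  then show ?thesis by (simp add: nn_integral_multc mult.commute)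
qed

text \<open>The band has width \<open>2 / 2^n\<close> and the intervals have length
  \<open>4 / 2^j\<close>. Together they absorb \<open>2 ^ (j - n)\<close> and reduce (20/3)^n to
  (5/3)^n, leaving 320 (5/3)^n; summing over n \<le> j costs a factor 5/2, whence 800.\<close>

lemma nn_integral_gagliardo_majorant:
  "(\<integral>\<^sup>+x. \<integral>\<^sup>+y. ennreal (gagliardo_majorant u j x y) \<partial>lborel \<partial>lborel) \<le> ennreal (800 * (5/3) ^ j * dyadic_energy j u)"
proof -
  let ?B = "\<lambda>n x y. indicator {..1 / 2 ^ n} \<bar>x - y :: real\<bar> :: ennreal"
  let ?c = "\<lambda>n. 3 * (20/3) ^ Suc n * 2 ^ (j - n) :: real"
  have d0: "0 \<le> dyadic_energy j u" by (auto simp: dyadic_energy_def intro: sum_nonneg)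
  have e: "ennreal (gagliardo_majorant u j x y) = (\<Sum>n\<le>j. ennreal (?c n) * (ennreal (fat_increments u j x) * ?B n x y + ennreal (fat_increments u j y) * ?B n x y))" for x y
  proof -
    have "ennreal (gagliardo_majorant u j x y) = (\<Sum>n\<le>j. ennreal (?c n * ((fat_increments u j x + fat_increments u j y) * indicator {..1 / 2 ^ n} \<bar>x - y\<bar>)))"
      unfolding gagliardo_majorant_def by (rule sum_ennreal[symmetric]) simp
    also have "\<dots> = (\<Sum>n\<le>j. ennreal (?c n) * (ennreal (fat_increments u j x) * ?B n x y + ennreal (fat_increments u j y) * ?B n x y))"
    proof -
      have "ennreal (c * ((a + b) * t)) = ennreal c * (ennreal a * ennreal t + ennreal b * ennreal t)"
        if "0 \<le> c" "0 \<le> a" "0 \<le> b" "0 \<le> t" for a b c t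
        using that by (simp add: ennreal_mult ennreal_plus distrib_right)
      from this[where t = "indicator {..1 / 2 ^ _} \<bar>x - y\<bar>", unfolded ennreal_indicator]
      show ?thesis by (intro sum.cong refl) simp
    qed
    finally show ?thesis .
  qed
  have 1: "(\<integral>\<^sup>+x. \<integral>\<^sup>+y. ennreal (fat_increments u j x) * ?B n x y \<partial>lborel \<partial>lborel) = ennreal (2 * (1 / 2 ^ n)) * ennreal (4 / 2 ^ j * dyadic_energy j u)" for n
    by (subst nn_integral_band) (auto simp: nn_integral_fat_increments)
  have 2: "(\<integral>\<^sup>+x. \<integral>\<^sup>+y. ennreal (fat_increments u j y) * ?B n x y \<partial>lborel \<partial>lborel) = ennreal (2 * (1 / 2 ^ n)) * ennreal (4 / 2 ^ j * dyadic_energy j u)" for n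
  proof -
    have "(\<integral>\<^sup>+x. \<integral>\<^sup>+y. ennreal (fat_increments u j y) * ?B n x y \<partial>lborel \<partial>lborel)
       = (\<integral>\<^sup>+y. \<integral>\<^sup>+x. ennreal (fat_increments u j y) * ?B n x y \<partial>lborel \<partial>lborel)"
      by (rule lborel_pair.Fubini') measurable
    also have "\<dots> = (\<integral>\<^sup>+x. \<integral>\<^sup>+y. ennreal (fat_increments u j x) * ?B n x y \<partial>lborel \<partial>lborel)"
      by (intro nn_integral_cong) (auto simp: indicator_def abs_minus_commute)
    finally show ?thesis unfolding 1 .
  qed
  have "(\<integral>\<^sup>+x. \<integral>\<^sup>+y. ennreal (gagliardo_majorant u j x y) \<partial>lborel \<partial>lborel)
    = (\<Sum>n\<le>j. ennreal (?c n) * ((\<integral>\<^sup>+x. \<integral>\<^sup>+y. ennreal (fat_increments u j x) * ?B n x y \<partial>lborel \<partial>lborel)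
        + (\<integral>\<^sup>+x. \<integral>\<^sup>+y. ennreal (fat_increments u j y) * ?B n x y \<partial>lborel \<partial>lborel)))"
  proof -
    have m [measurable]: "(\<lambda>y. ennreal (fat_increments u j x) * ?B n x y) \<in> borel_measurable lborel"
      "(\<lambda>y. ennreal (fat_increments u j y) * ?B n x y) \<in> borel_measurable lborel"
      "(\<lambda>x. \<integral>\<^sup>+y. ennreal (fat_increments u j x) * ?B n x y \<partial>lborel) \<in> borel_measurable lborel"
      "(\<lambda>x. \<integral>\<^sup>+y. ennreal (fat_increments u j y) * ?B n x y \<partial>lborel) \<in> borel_measurable lborel" for n x
      by measurable
    have i: "(\<integral>\<^sup>+y. ennreal (gagliardo_majorant u j x y) \<partial>lborel) = (\<Sum>n\<le>j. ennreal (?c n) *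
       ((\<integral>\<^sup>+y. ennreal (fat_increments u j x) * ?B n x y \<partial>lborel) + (\<integral>\<^sup>+y. ennreal (fat_increments u j y) * ?B n x y \<partial>lborel)))" for x
      unfolding e by (subst nn_integral_sum) (auto simp: nn_integral_cmult nn_integral_add m simp del: ennreal_mult)
    show ?thesis unfolding i
      by (subst nn_integral_sum) (auto simp: nn_integral_cmult nn_integral_add m)
  qed
  also have "\<dots> = (\<Sum>n\<le>j. ennreal (320 * (5/3) ^ n * dyadic_energy j u))"
  proof (intro sum.cong refl)
    fix n assume "n \<in> {..j}"
    then have "(2::real) ^ j = 2 ^ (j - n) * 2 ^ n" by (simp flip: power_add)
    moreover have "(20/3::real) ^ n = (5/3) ^ n * 2 ^ n * 2 ^ n" by (simp flip: power_mult_distrib)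
    ultimately have a: "?c n * (2 * (1 / 2 ^ n) * (4 / 2 ^ j * dyadic_energy j u) + 2 * (1 / 2 ^ n) * (4 / 2 ^ j * dyadic_energy j u)) = 320 * (5/3) ^ n * dyadic_energy j u"
      by (simp add: field_simps)
    show "ennreal (?c n) * ((\<integral>\<^sup>+x. \<integral>\<^sup>+y. ennreal (fat_increments u j x) * ?B n x y \<partial>lborel \<partial>lborel)
        + (\<integral>\<^sup>+x. \<integral>\<^sup>+y. ennreal (fat_increments u j y) * ?B n x y \<partial>lborel \<partial>lborel)) = ennreal (320 * (5/3) ^ n * dyadic_energy j u)"
    proof -
      have *: "ennreal c * (ennreal a * ennreal b + ennreal a * ennreal b) = ennreal (c * (a * b + a * b))"
        if "0 \<le> c" "0 \<le> a" "0 \<le> b" for a b c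
        using that by (simp only: ennreal_mult[symmetric] ennreal_plus[symmetric] mult_nonneg_nonneg add_nonneg_nonneg)
      show ?thesis unfolding 1 2 a[symmetric] by (rule *) (use d0 in auto)
    qed
  qed
  also have "\<dots> = ennreal (\<Sum>n\<le>j. 320 * (5/3) ^ n * dyadic_energy j u)"
    using d0 by (intro sum_ennreal) auto
  also have "\<dots> \<le> ennreal (800 * (5/3) ^ j * dyadic_energy j u)"
  proof (rule ennreal_leI)
    have "(\<Sum>n\<le>j. (5/3) ^ n) \<le> (5/2 :: real) * (5/3) ^ j" by (induction j) auto
    then have "(\<Sum>n\<le>j. (5/3) ^ n) * (320 * dyadic_energy j u) \<le> (5/2) * (5/3) ^ j * (320 * dyadic_energy j u)"
      using d0 by (intro mult_right_mono) auto
    also have "\<dots> = 800 * (5/3) ^ j * dyadic_energy j u" by simp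
    also have "(\<Sum>n\<le>j. (5/3) ^ n) * (320 * dyadic_energy j u) = (\<Sum>n\<le>j. 320 * (5/3) ^ n * dyadic_energy j u)"
      unfolding sum_distrib_right by (intro sum.cong refl) (simp only: mult_ac)
    finally show "(\<Sum>n\<le>j. 320 * (5/3) ^ n * dyadic_energy j u) \<le> 800 * (5/3) ^ j * dyadic_energy j u" .
  qed
  finally show ?thesis .
qed

lemma measurable_gagliardo_majorant [measurable]: "(\<lambda>z. gagliardo_majorant u j (fst z) (snd z)) \<in> borel_measurable (borel \<Otimes>\<^sub>M borel)"
  unfolding gagliardo_majorant_def by measurable

lemma gagliardo_le:
  assumes u: "continuous_on {0..1} u" and p: "2 powr p = 20/3"
    and M: "\<And>N. (\<Sum>n\<le>N. (5/3) ^ n * dyadic_energy n u) \<le> M"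
  shows "gagliardo p u \<le> ennreal (800 * M)"
proof -
  have d0: "0 \<le> dyadic_energy j u" for j unfolding dyadic_energy_def by (rule sum_nonneg) simp
  have "gagliardo p u \<le> (\<integral>\<^sup>+x. \<integral>\<^sup>+y. (\<Sum>j. ennreal (gagliardo_majorant u j x y)) \<partial>lborel \<partial>lborel)"
    unfolding gagliardo_def
  proof (rule nn_integral_mono)
    fix x :: real
    show "(\<integral>\<^sup>+y\<in>{0..1}. ennreal ((u x - u y)\<^sup>2 / \<bar>x - y\<bar> powr p) \<partial>lborel) * indicator {0..1} x
       \<le> (\<integral>\<^sup>+y. (\<Sum>j. ennreal (gagliardo_majorant u j x y)) \<partial>lborel)"
    proof (cases "x \<in> {0..1}")
      case True
      have "(\<integral>\<^sup>+y\<in>{0..1}. ennreal ((u x - u y)\<^sup>2 / \<bar>x - y\<bar> powr p) \<partial>lborel)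
         \<le> (\<integral>\<^sup>+y. (\<Sum>j. ennreal (gagliardo_majorant u j x y)) \<partial>lborel)"
      proof (rule nn_integral_mono)
        fix y :: real
        show "ennreal ((u x - u y)\<^sup>2 / \<bar>x - y\<bar> powr p) * indicator {0..1} y \<le> (\<Sum>j. ennreal (gagliardo_majorant u j x y))"
        proof (cases "y \<in> {0..1}")
          case True2: True
          show ?thesis using gagliardo_integrand_le[OF u p True True2] unfolding indicator_simps(1)[OF True2] mult_1_right .
        qed simp
      qed
      then show ?thesis unfolding indicator_simps(1)[OF True] mult_1_right .
    qed simp
  qed
  also have "\<dots> = (\<integral>\<^sup>+x. (\<Sum>j. \<integral>\<^sup>+y. ennreal (gagliardo_majorant u j x y) \<partial>lborel) \<partial>lborel)"
    by (intro nn_integral_cong nn_integral_suminf) (unfold gagliardo_majorant_def, measurable)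
  also have "\<dots> = (\<Sum>j. \<integral>\<^sup>+x. \<integral>\<^sup>+y. ennreal (gagliardo_majorant u j x y) \<partial>lborel \<partial>lborel)"
  proof (rule nn_integral_suminf)
    fix j
    have "(\<lambda>z. ennreal (gagliardo_majorant u j (fst z) (snd z))) \<in> borel_measurable (lborel \<Otimes>\<^sub>M lborel)" by measurable
    then show "(\<lambda>x. \<integral>\<^sup>+y. ennreal (gagliardo_majorant u j x y) \<partial>lborel) \<in> borel_measurable lborel"
      by (intro lborel.borel_measurable_nn_integral) (simp add: case_prod_beta')
  qed
  also have "\<dots> \<le> ennreal (800 * M)"
  proof (rule suminf_le_const[OF summableI])
    fix N
    have "(\<Sum>j<N. \<integral>\<^sup>+x. \<integral>\<^sup>+y. ennreal (gagliardo_majorant u j x y) \<partial>lborel \<partial>lborel) \<le> (\<Sum>j<N. ennreal (800 * (5/3) ^ j * dyadic_energy j u))"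
      by (intro sum_mono nn_integral_gagliardo_majorant)
    also have "\<dots> = ennreal (\<Sum>j<N. 800 * (5/3) ^ j * dyadic_energy j u)"
      using d0 by (intro sum_ennreal) auto
    also have "\<dots> \<le> ennreal (800 * M)"
    proof (rule ennreal_leI)
      have "(\<Sum>j<N. (5/3) ^ j * dyadic_energy j u) \<le> (\<Sum>j\<le>N. (5/3) ^ j * dyadic_energy j u)"
        using d0 by (intro sum_mono2) auto
      also have "\<dots> \<le> M" by (rule M)
      finally show "(\<Sum>j<N. 800 * (5/3) ^ j * dyadic_energy j u) \<le> 800 * M"
        by (simp add: mult.assoc flip: sum_distrib_left)
    qed
    finally show "(\<Sum>j<N. \<integral>\<^sup>+x. \<integral>\<^sup>+y. ennreal (gagliardo_majorant u j x y) \<partial>lborel \<partial>lborel) \<le> ennreal (800 * M)" .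
  qed
  finally show ?thesis .
qed

section \<open>Bounding dyadic increments by the Gagliardo seminorm\<close>

text \<open>The factor \<open>4 ^ l\<close> makes the quantity scale invariant: rescaling half of
  the interval to unit length turns level \<open>l + 1\<close> into level \<open>l\<close>.\<close>

definition band_integral :: "nat \<Rightarrow> (real \<Rightarrow> real) \<Rightarrow> ennreal" where
  "band_integral l u = (\<integral>\<^sup>+x\<in>{0..1}. \<integral>\<^sup>+y\<in>{0..1}. ennreal (4 ^ l * (u x - u y)\<^sup>2 * indicator {..1 / 2 ^ l} \<bar>x - y\<bar>) \<partial>lborel \<partial>lborel)"

lemma set_nn_integral_affine:
  assumes [measurable]: "h \<in> borel_measurable borel" and "0 < (c::real)"
  shows "ennreal c * (\<integral>\<^sup>+x\<in>{0..1}. h (t + c * x) \<partial>lborel) = (\<integral>\<^sup>+x\<in>{t..t + c}. h x \<partial>lborel)"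
proof -
  have "(\<integral>\<^sup>+x\<in>{t..t + c}. h x \<partial>lborel) = ennreal \<bar>c\<bar> * (\<integral>\<^sup>+x. h (t + c * x) * indicator {t..t + c} (t + c * x) \<partial>lborel)"
    using assms(2) by (intro nn_integral_real_affine) auto
  also have "(\<integral>\<^sup>+x. h (t + c * x) * indicator {t..t + c} (t + c * x) \<partial>lborel) = (\<integral>\<^sup>+x\<in>{0..1}. h (t + c * x) \<partial>lborel)"
    using assms(2) by (intro nn_integral_cong) (auto simp: indicator_def mult_le_cancel_left1 zero_le_mult_iff)
  finally show ?thesis using assms(2) by simp
qed

lemma set_nn_integral_affine2:
  assumes f [measurable]: "(\<lambda>z. f (fst z) (snd z)) \<in> borel_measurable (borel \<Otimes>\<^sub>M borel)" and c: "0 < (c::real)" "0 < (d::real)"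
  shows "ennreal c * ennreal d * (\<integral>\<^sup>+x\<in>{0..1}. \<integral>\<^sup>+y\<in>{0..1}. f (s + c * x) (t + d * y) \<partial>lborel \<partial>lborel)
     = (\<integral>\<^sup>+x\<in>{s..s + c}. \<integral>\<^sup>+y\<in>{t..t + d}. f x y \<partial>lborel \<partial>lborel)"
proof -
  have fx: "f x \<in> borel_measurable borel" for x
    using measurable_compose[OF measurable_Pair1'[of x borel borel] f] by simp
  have m [measurable]: "(\<lambda>x. \<integral>\<^sup>+y\<in>{a..b}. f x y \<partial>lborel) \<in> borel_measurable borel" for a b
  proof -
    have "(\<lambda>z. f (fst z) (snd z) * indicator {a..b} (snd z)) \<in> borel_measurable (borel \<Otimes>\<^sub>M lborel)"
      by measurable
    then show ?thesis by (intro lborel.borel_measurable_nn_integral) (simp add: case_prod_beta')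
  qed
  have "ennreal c * ennreal d * (\<integral>\<^sup>+x\<in>{0..1}. \<integral>\<^sup>+y\<in>{0..1}. f (s + c * x) (t + d * y) \<partial>lborel \<partial>lborel)
    = ennreal c * (\<integral>\<^sup>+x\<in>{0..1}. (ennreal d * (\<integral>\<^sup>+y\<in>{0..1}. f (s + c * x) (t + d * y) \<partial>lborel)) \<partial>lborel)"
  proof -
    \<comment> \<open>Measurability of the substituted inner integral is inherited from this one, of
      which it is the multiple by \<open>1/d\<close>.\<close>
    have "(\<lambda>x. (\<integral>\<^sup>+y\<in>{t..t+d}. f (s + c * x) y \<partial>lborel)) \<in> borel_measurable lborel" by measurable
    then have "(\<lambda>x. ennreal (1/d) * (\<integral>\<^sup>+y\<in>{t..t+d}. f (s + c * x) y \<partial>lborel)) \<in> borel_measurable lborel" by measurable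
    moreover have "ennreal (1/d) * (\<integral>\<^sup>+y\<in>{t..t+d}. f (s + c * x) y \<partial>lborel) = (\<integral>\<^sup>+y\<in>{0..1}. f (s + c * x) (t + d * y) \<partial>lborel)" for x
      unfolding set_nn_integral_affine[OF fx c(2), symmetric] using c
      by (simp add: mult.assoc[symmetric] ennreal_mult[symmetric])
    ultimately have "(\<lambda>x. \<integral>\<^sup>+y\<in>{0..1}. f (s + c * x) (t + d * y) \<partial>lborel) \<in> borel_measurable lborel" by simp
    then show ?thesis by (simp add: mult.assoc nn_integral_cmult)
  qed
  also have "\<dots> = ennreal c * (\<integral>\<^sup>+x\<in>{0..1}. (\<integral>\<^sup>+y\<in>{t..t + d}. f (s + c * x) y \<partial>lborel) \<partial>lborel)"
    by (simp only: set_nn_integral_affine[OF fx c(2)])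
  also have "\<dots> = (\<integral>\<^sup>+x\<in>{s..s + c}. \<integral>\<^sup>+y\<in>{t..t + d}. f x y \<partial>lborel \<partial>lborel)"
    by (rule set_nn_integral_affine[OF m c(1)])
  finally show ?thesis .
qed

lemma set_nn_integral_mono2:
  assumes "A \<subseteq> A'" "B \<subseteq> B'" "\<And>x y. x \<in> A \<Longrightarrow> y \<in> B \<Longrightarrow> f x y \<le> g x y"
  shows "(\<integral>\<^sup>+x\<in>A. \<integral>\<^sup>+y\<in>B. f x y \<partial>lborel \<partial>lborel) \<le> (\<integral>\<^sup>+x\<in>A'. \<integral>\<^sup>+y\<in>B'. g x y \<partial>lborel \<partial>lborel)"
proof (rule nn_integral_mono)
  fix x
  have "(\<integral>\<^sup>+y\<in>B. f x y \<partial>lborel) \<le> (\<integral>\<^sup>+y\<in>B'. g x y \<partial>lborel)" if "x \<in> A"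
    by (rule nn_integral_mono) (use assms that in \<open>auto simp: indicator_def\<close>)
  then show "(\<integral>\<^sup>+y\<in>B. f x y \<partial>lborel) * indicator A x \<le> (\<integral>\<^sup>+y\<in>B'. g x y \<partial>lborel) * indicator A' x"
    using assms(1) by (auto simp: indicator_def)
qed

text \<open>Young's inequality in unequal form, the first link paying 3 so that the rest pays only
  3/2. Any growth rate below 5/3 would do; equal weights would give 2.\<close>

lemma weighted_chain: "(a 0 - a N)\<^sup>2 \<le> (\<Sum>j<N. 3 * (3/2) ^ j * (a j - a (Suc j))\<^sup>2)" for a :: "nat \<Rightarrow> real"
proof (induction N arbitrary: a)
  case (Suc N)
  have s: "(r + t)\<^sup>2 \<le> 3 * r\<^sup>2 + 3/2 * t\<^sup>2" for r t :: real
  proof -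
    have "0 \<le> (2 * r - t)\<^sup>2" by simp
    then show ?thesis by (simp add: power2_eq_square algebra_simps)
  qed
  have "(a 0 - a (Suc N))\<^sup>2 \<le> 3 * (a 0 - a 1)\<^sup>2 + 3/2 * (a 1 - a (Suc N))\<^sup>2"
    using s[of "a 0 - a 1" "a 1 - a (Suc N)"] by simp
  also have "\<dots> \<le> 3 * (a 0 - a 1)\<^sup>2 + 3/2 * (\<Sum>j<N. 3 * (3/2) ^ j * (a (Suc j) - a (Suc (Suc j)))\<^sup>2)"
    using Suc[of "\<lambda>j. a (Suc j)"] by simp
  also have "\<dots> = (\<Sum>j<Suc N. 3 * (3/2) ^ j * (a j - a (Suc j))\<^sup>2)"
    unfolding sum.lessThan_Suc_shift by (simp add: sum_distrib_left mult_ac)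
  finally show ?case .
qed simp

context
  fixes u :: "real \<Rightarrow> real"
  assumes cont_u: "continuous_on UNIV u"
begin

lemma borel_u: "u \<in> borel_measurable borel"
  using cont_u by (rule borel_measurable_continuous_onI)

text \<open>After rescaling, the halves give integrals over the two diagonal quarters of the unit
  square. These overlap only in a null set, and the Jacobian 1/4 accounts for the change from
  \<open>4 ^ Suc l\<close> to \<open>4 ^ l\<close>.\<close>

lemma band_integral_Suc:
  "band_integral l (\<lambda>s. u (s / 2)) + band_integral l (\<lambda>s. u ((1 + s) / 2)) \<le> band_integral (Suc l) u"
proof -
  note borel_u [measurable]
  define f where "f x y = ennreal (4 ^ Suc l * (u x - u y)\<^sup>2 * indicator {..1 / 2 ^ Suc l} \<bar>x - y\<bar>)" for x y
  have f: "(\<lambda>z. f (fst z) (snd z)) \<in> borel_measurable (borel \<Otimes>\<^sub>M borel)" unfolding f_def by measurable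
  have q: "ennreal (1/2) * ennreal (1/2) * ennreal (4 ^ Suc l * r) = ennreal (4 ^ l * r)" for r
    by (subst ennreal_mult'[symmetric], simp)+ simp
  have h: "(\<integral>\<^sup>+x\<in>{0..1}. \<integral>\<^sup>+y\<in>{0..1}. ennreal (4 ^ l * (u (t + 1/2 * x) - u (t + 1/2 * y))\<^sup>2 * indicator {..1 / 2 ^ l} \<bar>x - y\<bar>) \<partial>lborel \<partial>lborel)
     = (\<integral>\<^sup>+x\<in>{t..t + 1/2}. \<integral>\<^sup>+y\<in>{t..t + 1/2}. f x y \<partial>lborel \<partial>lborel)" for t
  proof -
    have i: "indicator {..1 / 2 ^ Suc l} \<bar>(t + 1/2 * x) - (t + 1/2 * y)\<bar> = (indicator {..1 / 2 ^ l} \<bar>x - y\<bar> :: real)" for x y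
    proof -
      have "(t + 1/2 * x) - (t + 1/2 * y) = (x - y) / 2" by (simp add: diff_divide_distrib)
      then have "\<bar>(t + 1/2 * x) - (t + 1/2 * y)\<bar> = \<bar>x - y\<bar> / 2" by (simp only: abs_divide abs_numeral)
      then show ?thesis by (simp add: indicator_def)
    qed
    have "ennreal (4 ^ l * (u (t + 1/2 * x) - u (t + 1/2 * y))\<^sup>2 * indicator {..1 / 2 ^ l} \<bar>x - y\<bar>)
      = ennreal (1/2) * ennreal (1/2) * f (t + 1/2 * x) (t + 1/2 * y)" for x y
      unfolding f_def i mult.assoc q[unfolded mult.assoc] ..
    then have "(\<integral>\<^sup>+x\<in>{0..1}. \<integral>\<^sup>+y\<in>{0..1}. ennreal (4 ^ l * (u (t + 1/2 * x) - u (t + 1/2 * y))\<^sup>2 * indicator {..1 / 2 ^ l} \<bar>x - y\<bar>) \<partial>lborel \<partial>lborel)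
      = (\<integral>\<^sup>+x\<in>{0..1}. \<integral>\<^sup>+y\<in>{0..1}. ennreal (1/2) * ennreal (1/2) * f (t + 1/2 * x) (t + 1/2 * y) \<partial>lborel \<partial>lborel)"
      by (simp only:)
    also have "\<dots> = ennreal (1/2) * ennreal (1/2) * (\<integral>\<^sup>+x\<in>{0..1}. \<integral>\<^sup>+y\<in>{0..1}. f (t + 1/2 * x) (t + 1/2 * y) \<partial>lborel \<partial>lborel)"
      unfolding f_def by (simp add: mult.assoc nn_integral_cmult)
    also have "\<dots> = (\<integral>\<^sup>+x\<in>{t..t + 1/2}. \<integral>\<^sup>+y\<in>{t..t + 1/2}. f x y \<partial>lborel \<partial>lborel)"
      by (rule set_nn_integral_affine2[OF f]) auto
    finally show ?thesis .
  qed
  have m [measurable]: "(\<lambda>x. \<integral>\<^sup>+y\<in>{0..1}. f x y \<partial>lborel) \<in> borel_measurable lborel"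
    unfolding f_def by measurable
  have e: "(\<lambda>s. u (s / 2)) = (\<lambda>s. u (0 + 1/2 * s))" "(\<lambda>s. u ((1 + s) / 2)) = (\<lambda>s. u (1/2 + 1/2 * s))"
    by (simp_all add: add_divide_distrib)
  have "band_integral l (\<lambda>s. u (s / 2)) + band_integral l (\<lambda>s. u ((1 + s) / 2))
     = (\<integral>\<^sup>+x\<in>{0..0 + 1/2}. \<integral>\<^sup>+y\<in>{0..0 + 1/2}. f x y \<partial>lborel \<partial>lborel) + (\<integral>\<^sup>+x\<in>{1/2..1/2 + 1/2}. \<integral>\<^sup>+y\<in>{1/2..1/2 + 1/2}. f x y \<partial>lborel \<partial>lborel)"
    unfolding band_integral_def e h ..
  also have "\<dots> \<le> (\<integral>\<^sup>+x\<in>{0..1/2}. \<integral>\<^sup>+y\<in>{0..1}. f x y \<partial>lborel \<partial>lborel) + (\<integral>\<^sup>+x\<in>{1/2..1}. \<integral>\<^sup>+y\<in>{0..1}. f x y \<partial>lborel \<partial>lborel)"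
    by (intro add_mono set_nn_integral_mono2) auto
  also have "\<dots> = (\<integral>\<^sup>+x. (\<integral>\<^sup>+y\<in>{0..1}. f x y \<partial>lborel) * indicator {0..1/2} x + (\<integral>\<^sup>+y\<in>{0..1}. f x y \<partial>lborel) * indicator {1/2..1} x \<partial>lborel)"
    by (rule nn_integral_add[symmetric]) measurable
  also have "\<dots> = (\<integral>\<^sup>+x\<in>{0..1}. \<integral>\<^sup>+y\<in>{0..1}. f x y \<partial>lborel \<partial>lborel)"
  proof (rule nn_integral_cong_AE)
    show "AE x in lborel. (\<integral>\<^sup>+y\<in>{0..1}. f x y \<partial>lborel) * indicator {0..1/2} x + (\<integral>\<^sup>+y\<in>{0..1}. f x y \<partial>lborel) * indicator {1/2..1} x
       = (\<integral>\<^sup>+y\<in>{0..1}. f x y \<partial>lborel) * indicator {0..1} x"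
      using AE_lborel_singleton[of "1/2::real"] by eventually_elim (auto simp: indicator_def)
  qed
  also have "\<dots> = band_integral (Suc l) u" unfolding band_integral_def f_def ..
  finally show ?thesis .
qed

text \<open>The substitution has Jacobian 2^j 2^(j+1) = 2 times 4^j, and its image is a rectangle at
  the corner 0 that lies inside the band of width 2^-j.\<close>

lemma scaled_increment_le_band_integral:
  "(\<integral>\<^sup>+x\<in>{0..1}. \<integral>\<^sup>+y\<in>{0..1}. ennreal ((u (x / 2 ^ j) - u (y / 2 ^ Suc j))\<^sup>2) \<partial>lborel \<partial>lborel) \<le> 2 * band_integral j u"
proof -
  note borel_u [measurable]
  define f where "f x y = ennreal (2 * (4 ^ j * (u x - u y)\<^sup>2))" for x y
  have f: "(\<lambda>z. f (fst z) (snd z)) \<in> borel_measurable (borel \<Otimes>\<^sub>M borel)" unfolding f_def by measurable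
  have e: "ennreal ((u (x / 2 ^ j) - u (y / 2 ^ Suc j))\<^sup>2) = ennreal (1 / 2 ^ j) * ennreal (1 / 2 ^ Suc j) * f (0 + 1 / 2 ^ j * x) (0 + 1 / 2 ^ Suc j * y)" for x y
  proof -
    have "(4::real) ^ j = 2 ^ j * 2 ^ j" by (simp flip: power_mult_distrib)
    then show ?thesis unfolding f_def by (simp add: ennreal_mult'[symmetric])
  qed
  have "(\<integral>\<^sup>+x\<in>{0..1}. \<integral>\<^sup>+y\<in>{0..1}. ennreal ((u (x / 2 ^ j) - u (y / 2 ^ Suc j))\<^sup>2) \<partial>lborel \<partial>lborel)
    = ennreal (1 / 2 ^ j) * ennreal (1 / 2 ^ Suc j) * (\<integral>\<^sup>+x\<in>{0..1}. \<integral>\<^sup>+y\<in>{0..1}. f (0 + 1 / 2 ^ j * x) (0 + 1 / 2 ^ Suc j * y) \<partial>lborel \<partial>lborel)"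
    unfolding e f_def by (simp add: mult.assoc nn_integral_cmult)
  also have "\<dots> = (\<integral>\<^sup>+x\<in>{0..0 + 1 / 2 ^ j}. \<integral>\<^sup>+y\<in>{0..0 + 1 / 2 ^ Suc j}. f x y \<partial>lborel \<partial>lborel)"
    by (rule set_nn_integral_affine2[OF f]) auto
  also have "\<dots> \<le> (\<integral>\<^sup>+x\<in>{0..1}. \<integral>\<^sup>+y\<in>{0..1}. 2 * ennreal (4 ^ j * (u x - u y)\<^sup>2 * indicator {..1 / 2 ^ j} \<bar>x - y\<bar>) \<partial>lborel \<partial>lborel)"
  proof (rule set_nn_integral_mono2)
    have p: "1 / 2 ^ k \<le> (1::real)" for k by simp
    show "{0..0 + 1 / 2 ^ j} \<subseteq> {0..1::real}" "{0..0 + 1 / 2 ^ Suc j} \<subseteq> {0..1::real}"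
      using p[of j] p[of "Suc j"] by auto
    fix x y :: real assume xy: "x \<in> {0..0 + 1 / 2 ^ j}" "y \<in> {0..0 + 1 / 2 ^ Suc j}"
    have "1 / 2 ^ Suc j \<le> (1 / 2 ^ j :: real)" by (rule divide_left_mono) auto
    then have "\<bar>x - y\<bar> \<le> 1 / 2 ^ j" using xy by auto
    then show "f x y \<le> 2 * ennreal (4 ^ j * (u x - u y)\<^sup>2 * indicator {..1 / 2 ^ j} \<bar>x - y\<bar>)"
      unfolding f_def by (simp add: ennreal_mult)
  qed
  also have "\<dots> = 2 * band_integral j u" unfolding band_integral_def by (simp add: mult.assoc nn_integral_cmult)
  finally show ?thesis .
qed

text \<open>Telescoping along the points \<open>x\<close>, \<open>y/2\<close>, \<open>x/4\<close>, \<open>y/8\<close>, ... and integrating over both \<open>x\<close> and \<open>y\<close>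
  turns every increment into a double integral over a square at the corner.\<close>
lemma endpoint_le_band_integral:
  "(\<integral>\<^sup>+x\<in>{0..1}. ennreal ((u x - u 0)\<^sup>2) \<partial>lborel) \<le> (\<Sum>j. ennreal (6 * (3/2) ^ j) * band_integral j u)"
proof -
  note borel_u [measurable]
  define a where "a x y j = u ((if even j then x else y) / 2 ^ j)" for x y :: real and j :: nat
  have am [measurable]: "(\<lambda>z. a (fst z) (snd z) j) \<in> borel_measurable (borel \<Otimes>\<^sub>M borel)" for j
    unfolding a_def by measurable
  have am1 [measurable]: "(\<lambda>y. a x y j) \<in> borel_measurable borel" for j x
    unfolding a_def by measurable
  have pt: "ennreal ((u x - u 0)\<^sup>2) \<le> (\<Sum>j. ennreal (3 * (3/2) ^ j * (a x y j - a x y (Suc j))\<^sup>2))" for x y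
  proof (rule LIMSEQ_le_const2)
    have "(\<lambda>j. (if even j then x else y) / 2 ^ j) \<longlonglongrightarrow> 0"
    proof (rule Lim_null_comparison)
      show "\<forall>\<^sub>F j in sequentially. norm ((if even j then x else y) / 2 ^ j) \<le> (\<bar>x\<bar> + \<bar>y\<bar>) * (1/2) ^ j"
        by (intro always_eventually allI) (simp add: power_divide divide_right_mono)
      have "(\<lambda>j. (\<bar>x\<bar> + \<bar>y\<bar>) * (1/2) ^ j) \<longlonglongrightarrow> (\<bar>x\<bar> + \<bar>y\<bar>) * 0"
        by (intro tendsto_intros LIMSEQ_realpow_zero) auto
      then show "(\<lambda>j. (\<bar>x\<bar> + \<bar>y\<bar>) * (1/2) ^ j) \<longlonglongrightarrow> 0" by simp
    qed
    then have "(\<lambda>j. a x y j) \<longlonglongrightarrow> u 0" unfolding a_def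
      by (intro continuous_on_tendsto_compose[OF cont_u]) auto
    then have "(\<lambda>N. ennreal ((a x y 0 - a x y N)\<^sup>2)) \<longlonglongrightarrow> ennreal ((a x y 0 - u 0)\<^sup>2)"
      by (intro tendsto_intros)
    then show "(\<lambda>N. ennreal ((a x y 0 - a x y N)\<^sup>2)) \<longlonglongrightarrow> ennreal ((u x - u 0)\<^sup>2)"
      by (simp add: a_def)
    have "ennreal ((a x y 0 - a x y N)\<^sup>2) \<le> (\<Sum>j. ennreal (3 * (3/2) ^ j * (a x y j - a x y (Suc j))\<^sup>2))" for N
    proof -
      have "ennreal ((a x y 0 - a x y N)\<^sup>2) \<le> ennreal (\<Sum>j<N. 3 * (3/2) ^ j * (a x y j - a x y (Suc j))\<^sup>2)"
        by (intro ennreal_leI weighted_chain)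
      also have "\<dots> = (\<Sum>j<N. ennreal (3 * (3/2) ^ j * (a x y j - a x y (Suc j))\<^sup>2))"
        by (rule sum_ennreal[symmetric]) simp
      also have "\<dots> \<le> (\<Sum>j. ennreal (3 * (3/2) ^ j * (a x y j - a x y (Suc j))\<^sup>2))"
        by (rule sum_le_suminf) auto
      finally show ?thesis .
    qed
    then show "\<exists>N. \<forall>n\<ge>N. ennreal ((a x y 0 - a x y n)\<^sup>2) \<le> (\<Sum>j. ennreal (3 * (3/2) ^ j * (a x y j - a x y (Suc j))\<^sup>2))"
      by blast
  qed
  let ?D = "\<lambda>j x y. ennreal ((a x y j - a x y (Suc j))\<^sup>2)"
  have K: "(\<integral>\<^sup>+x\<in>{0..1}. \<integral>\<^sup>+y\<in>{0..1}. ?D j x y \<partial>lborel \<partial>lborel) \<le> 2 * band_integral j u" for j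
  proof (cases "even j")
    case True
    then have "?D j x y = ennreal ((u (x / 2 ^ j) - u (y / 2 ^ Suc j))\<^sup>2)" for x y by (simp add: a_def)
    then show ?thesis using scaled_increment_le_band_integral by simp
  next
    case False
    then have e: "?D j x y = ennreal ((u (y / 2 ^ j) - u (x / 2 ^ Suc j))\<^sup>2)" for x y by (simp add: a_def)
    \<comment> \<open>In odd steps the coarser point of the chain is the one built from
      \<open>y\<close>, so the variables are exchanged first.\<close>
    have "(\<integral>\<^sup>+x\<in>{0..1}. \<integral>\<^sup>+y\<in>{0..1}. ?D j x y \<partial>lborel \<partial>lborel)
      = (\<integral>\<^sup>+x. \<integral>\<^sup>+y. ennreal ((u (y / 2 ^ j) - u (x / 2 ^ Suc j))\<^sup>2) * indicator {0..1} y * indicator {0..1} x \<partial>lborel \<partial>lborel)"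
      unfolding e by (simp add: nn_integral_multc)
    also have "\<dots> = (\<integral>\<^sup>+y. \<integral>\<^sup>+x. ennreal ((u (y / 2 ^ j) - u (x / 2 ^ Suc j))\<^sup>2) * indicator {0..1} y * indicator {0..1} x \<partial>lborel \<partial>lborel)"
      by (rule lborel_pair.Fubini') measurable
    also have "\<dots> = (\<integral>\<^sup>+x\<in>{0..1}. \<integral>\<^sup>+y\<in>{0..1}. ennreal ((u (x / 2 ^ j) - u (y / 2 ^ Suc j))\<^sup>2) \<partial>lborel \<partial>lborel)"
    proof (rule nn_integral_cong)
      fix y :: real
      have "(\<integral>\<^sup>+x. ennreal ((u (y / 2 ^ j) - u (x / 2 ^ Suc j))\<^sup>2) * indicator {0..1} y * indicator {0..1} x \<partial>lborel)
        = (\<integral>\<^sup>+x. ennreal ((u (y / 2 ^ j) - u (x / 2 ^ Suc j))\<^sup>2) * indicator {0..1} x * indicator {0..1} y \<partial>lborel)"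
        by (simp only: mult_ac)
      also have "\<dots> = (\<integral>\<^sup>+x\<in>{0..1}. ennreal ((u (y / 2 ^ j) - u (x / 2 ^ Suc j))\<^sup>2) \<partial>lborel) * indicator {0..1} y"
        by (rule nn_integral_multc) measurable
      finally show "(\<integral>\<^sup>+x. ennreal ((u (y / 2 ^ j) - u (x / 2 ^ Suc j))\<^sup>2) * indicator {0..1} y * indicator {0..1} x \<partial>lborel)
        = (\<integral>\<^sup>+x\<in>{0..1}. ennreal ((u (y / 2 ^ j) - u (x / 2 ^ Suc j))\<^sup>2) \<partial>lborel) * indicator {0..1} y" .
    qed
    also have "\<dots> \<le> 2 * band_integral j u" by (rule scaled_increment_le_band_integral)
    finally show ?thesis .
  qed
  have Dm [measurable]: "(\<lambda>y. ?D j x y) \<in> borel_measurable lborel" for j x by measurable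
  have Dm2 [measurable]: "(\<lambda>x. \<integral>\<^sup>+y\<in>{0..1}. ?D j x y \<partial>lborel) \<in> borel_measurable lborel" for j
    unfolding a_def by measurable
  have "(\<integral>\<^sup>+x\<in>{0..1}. ennreal ((u x - u 0)\<^sup>2) \<partial>lborel)
    \<le> (\<integral>\<^sup>+x. (\<Sum>j. ennreal (3 * (3/2) ^ j) * ((\<integral>\<^sup>+y\<in>{0..1}. ?D j x y \<partial>lborel) * indicator {0..1} x)) \<partial>lborel)"
  proof (rule nn_integral_mono)
    fix x :: real
    \<comment> \<open>The unit interval has measure 1, so averaging over the auxiliary variable
      \<open>y\<close> is free.\<close>
    have "ennreal ((u x - u 0)\<^sup>2) = (\<integral>\<^sup>+y\<in>{0..1::real}. ennreal ((u x - u 0)\<^sup>2) \<partial>lborel)"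
      by (subst nn_integral_cmult_indicator) auto
    also have "\<dots> \<le> (\<integral>\<^sup>+y. (\<Sum>j. ennreal (3 * (3/2) ^ j) * (?D j x y * indicator {0..1} y)) \<partial>lborel)"
    proof (rule nn_integral_mono)
      fix y :: real
      show "ennreal ((u x - u 0)\<^sup>2) * indicator {0..1} y \<le> (\<Sum>j. ennreal (3 * (3/2) ^ j) * (?D j x y * indicator {0..1} y))"
        using pt[of x y] by (simp add: indicator_def ennreal_mult mult.assoc)
    qed
    also have "\<dots> = (\<Sum>j. ennreal (3 * (3/2) ^ j) * (\<integral>\<^sup>+y\<in>{0..1}. ?D j x y \<partial>lborel))"
      by (subst nn_integral_suminf) (auto simp: nn_integral_cmult)
    finally show "ennreal ((u x - u 0)\<^sup>2) * indicator {0..1} x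
       \<le> (\<Sum>j. ennreal (3 * (3/2) ^ j) * ((\<integral>\<^sup>+y\<in>{0..1}. ?D j x y \<partial>lborel) * indicator {0..1} x))"
      by (simp add: indicator_def)
  qed
  also have "\<dots> = (\<Sum>j. ennreal (3 * (3/2) ^ j) * (\<integral>\<^sup>+x\<in>{0..1}. \<integral>\<^sup>+y\<in>{0..1}. ?D j x y \<partial>lborel \<partial>lborel))"
    by (subst nn_integral_suminf) (auto simp: nn_integral_cmult)
  also have "\<dots> \<le> (\<Sum>j. ennreal (6 * (3/2) ^ j) * band_integral j u)"
  proof (intro suminf_le summableI)
    fix j
    have "ennreal (3 * (3/2) ^ j) * (\<integral>\<^sup>+x\<in>{0..1}. \<integral>\<^sup>+y\<in>{0..1}. ?D j x y \<partial>lborel \<partial>lborel) \<le> ennreal (3 * (3/2) ^ j) * (2 * band_integral j u)"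
      by (intro mult_left_mono K) auto
    also have "\<dots> = ennreal (3 * (3/2) ^ j * 2) * band_integral j u"
      by (subst ennreal_mult) (auto simp: mult.assoc)
    finally show "ennreal (3 * (3/2) ^ j) * (\<integral>\<^sup>+x\<in>{0..1}. \<integral>\<^sup>+y\<in>{0..1}. ?D j x y \<partial>lborel \<partial>lborel) \<le> ennreal (6 * (3/2) ^ j) * band_integral j u"
      by simp
  qed
  finally show ?thesis .
qed

end

lemma set_nn_integral_reflect:
  assumes [measurable]: "h \<in> borel_measurable borel"
  shows "(\<integral>\<^sup>+x\<in>{0..1::real}. h (1 - x) \<partial>lborel) = (\<integral>\<^sup>+x\<in>{0..1}. h x \<partial>lborel)"
proof -
  have "(\<integral>\<^sup>+x\<in>{0..1}. h x \<partial>lborel) = ennreal \<bar>-1\<bar> * (\<integral>\<^sup>+x. h (1 + -1 * x) * indicator {0..1} (1 + -1 * x) \<partial>lborel)"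
    by (intro nn_integral_real_affine) auto
  also have "\<dots> = (\<integral>\<^sup>+x\<in>{0..1}. h (1 - x) \<partial>lborel)"
    by (auto simp: indicator_def intro!: nn_integral_cong)
  finally show ?thesis by simp
qed

lemma band_integral_reflect:
  assumes u: "continuous_on UNIV u" shows "band_integral l (\<lambda>s. u (1 - s)) = band_integral l u"
proof -
  have [measurable]: "u \<in> borel_measurable borel" using u by (rule borel_measurable_continuous_onI)
  let ?f = "\<lambda>x y. ennreal (4 ^ l * (u x - u y)\<^sup>2 * indicator {..1 / 2 ^ l} \<bar>x - y\<bar>)"
  have "band_integral l (\<lambda>s. u (1 - s)) = (\<integral>\<^sup>+x\<in>{0..1}. \<integral>\<^sup>+y\<in>{0..1}. ?f (1 - x) (1 - y) \<partial>lborel \<partial>lborel)"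
  proof -
    have *: "\<bar>(1 - x) - (1 - y)\<bar> = \<bar>x - y\<bar>" for x y :: real
    proof -
      have "(1 - x) - (1 - y) = - (x - y)" by simp
      then show ?thesis by (simp only: abs_minus_cancel)
    qed
    show ?thesis unfolding band_integral_def * ..
  qed
  also have "\<dots> = (\<integral>\<^sup>+x\<in>{0..1}. \<integral>\<^sup>+y\<in>{0..1}. ?f (1 - x) y \<partial>lborel \<partial>lborel)"
  proof -
    have **: "(\<integral>\<^sup>+y\<in>{0..1}. ?f (1 - x) (1 - y) \<partial>lborel) = (\<integral>\<^sup>+y\<in>{0..1}. ?f (1 - x) y \<partial>lborel)" for x
      by (rule set_nn_integral_reflect[where h = "\<lambda>y. ?f (1 - x) y"]) measurable
    show ?thesis by (intro nn_integral_cong) (simp only: **)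
  qed
  also have "\<dots> = (\<integral>\<^sup>+x\<in>{0..1}. \<integral>\<^sup>+y\<in>{0..1}. ?f x y \<partial>lborel \<partial>lborel)"
    by (rule set_nn_integral_reflect[where h = "\<lambda>x. \<integral>\<^sup>+y\<in>{0..1}. ?f x y \<partial>lborel"]) measurable
  finally show ?thesis unfolding band_integral_def .
qed

lemma continuous_on_halves:
  fixes u :: "real \<Rightarrow> real"
  assumes "continuous_on UNIV u"
  shows "continuous_on UNIV (\<lambda>s. u (s / 2))" "continuous_on UNIV (\<lambda>s. u ((1 + s) / 2))" "continuous_on UNIV (\<lambda>s. u (1 - s))"
  by (auto intro!: continuous_on_compose2[OF assms] continuous_intros)

text \<open>Both end values are compared with \<open>u x\<close> and averaged over \<open>x\<close>;
  the end 1 reduces to the end 0 by reflection. The constant is 24 = (2 + 2) times 6.\<close>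

lemma ends_le_band_integral:
  assumes u: "continuous_on UNIV u"
  shows "ennreal ((u 1 - u 0)\<^sup>2) \<le> (\<Sum>j. ennreal (24 * (3/2) ^ j) * band_integral j u)"
proof -
  have [measurable]: "u \<in> borel_measurable borel" using u by (rule borel_measurable_continuous_onI)
  let ?S = "\<Sum>j. ennreal (6 * (3/2) ^ j) * band_integral j u"
  let ?A = "\<integral>\<^sup>+x\<in>{0..1}. ennreal ((u x - u 0)\<^sup>2) \<partial>lborel"
  let ?B = "\<integral>\<^sup>+x\<in>{0..1}. ennreal ((u x - u 1)\<^sup>2) \<partial>lborel"
  have A: "?A \<le> ?S" by (rule endpoint_le_band_integral[OF u])
  have "?B = (\<integral>\<^sup>+x\<in>{0..1}. ennreal ((u (1 - x) - u 1)\<^sup>2) \<partial>lborel)"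
    by (rule set_nn_integral_reflect[where h = "\<lambda>x. ennreal ((u x - u 1)\<^sup>2)", symmetric]) measurable
  also have "\<dots> \<le> ?S"
    using endpoint_le_band_integral[OF continuous_on_halves(3)[OF u]] by (simp add: band_integral_reflect[OF u])
  finally have B: "?B \<le> ?S" .
  have "ennreal ((u 1 - u 0)\<^sup>2) = (\<integral>\<^sup>+x\<in>{0..1::real}. ennreal ((u 1 - u 0)\<^sup>2) \<partial>lborel)"
    by (subst nn_integral_cmult_indicator) auto
  also have "\<dots> \<le> (\<integral>\<^sup>+x. 2 * (ennreal ((u x - u 0)\<^sup>2) * indicator {0..1} x) + 2 * (ennreal ((u x - u 1)\<^sup>2) * indicator {0..1} x) \<partial>lborel)"
  proof (rule nn_integral_mono)
    fix x :: real
    have "ennreal ((u 1 - u 0)\<^sup>2) \<le> ennreal (2 * (u x - u 0)\<^sup>2 + 2 * (u x - u 1)\<^sup>2)"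
      using sq_diff_le[of "u 1" "u 0" "u x"] by (intro ennreal_leI) (simp add: power2_commute)
    also have "\<dots> = 2 * ennreal ((u x - u 0)\<^sup>2) + 2 * ennreal ((u x - u 1)\<^sup>2)"
      by (simp add: ennreal_mult)
    finally show "ennreal ((u 1 - u 0)\<^sup>2) * indicator {0..1} x
      \<le> 2 * (ennreal ((u x - u 0)\<^sup>2) * indicator {0..1} x) + 2 * (ennreal ((u x - u 1)\<^sup>2) * indicator {0..1} x)"
      by (simp add: indicator_def)
  qed
  also have "\<dots> = 2 * ?A + 2 * ?B" by (simp add: nn_integral_add nn_integral_cmult)
  also have "\<dots> \<le> 2 * ?S + 2 * ?S" using A B by (intro add_mono mult_left_mono) auto
  also have "\<dots> = 4 * ?S" by (simp flip: distrib_right)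
  also have "\<dots> = (\<Sum>j. 4 * (ennreal (6 * (3/2) ^ j) * band_integral j u))" by simp
  also have "\<dots> = (\<Sum>j. ennreal (24 * (3/2) ^ j) * band_integral j u)"
  proof -
    have "4 * ennreal (6 * r) = ennreal (24 * r)" if "0 \<le> r" for r
    proof -
      have "4 * ennreal (6 * r) = ennreal (4 * (6 * r))" using that by (subst ennreal_mult) auto
      then show ?thesis by simp
    qed
    then show ?thesis by (simp only: mult.assoc[symmetric]) simp
  qed
  finally show ?thesis .
qed

lemma dyadic_energy_nonneg [simp]: "0 \<le> dyadic_energy n u"
  unfolding dyadic_energy_def by (rule sum_nonneg) simp

text \<open>The estimate for the ends is applied on each dyadic interval of level \<open>n\<close>,
  and \<open>band_integral_Suc\<close> collects the rescaled right-hand sides \<open>n\<close>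
  levels deeper.\<close>

lemma dyadic_energy_le_band_integral:
  assumes "continuous_on UNIV u"
  shows "ennreal (dyadic_energy n u) \<le> (\<Sum>j. ennreal (24 * (3/2) ^ j) * band_integral (n + j) u)"
  using assms
proof (induction n arbitrary: u)
  case 0
  then show ?case using ends_le_band_integral by (simp add: dyadic_energy_def)
next
  case (Suc n)
  let ?l = "\<lambda>s. u (s / 2)" and ?r = "\<lambda>s. u ((1 + s) / 2)"
  have "ennreal (dyadic_energy (Suc n) u) = ennreal (dyadic_energy n ?l) + ennreal (dyadic_energy n ?r)"
    by (simp add: dyadic_energy_Suc)
  also have "\<dots> \<le> (\<Sum>j. ennreal (24 * (3/2) ^ j) * band_integral (n + j) ?l) + (\<Sum>j. ennreal (24 * (3/2) ^ j) * band_integral (n + j) ?r)"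
    by (intro add_mono Suc.IH continuous_on_halves Suc.prems)
  also have "\<dots> = (\<Sum>j. ennreal (24 * (3/2) ^ j) * (band_integral (n + j) ?l + band_integral (n + j) ?r))"
    by (subst suminf_add) (auto simp: distrib_left)
  also have "\<dots> \<le> (\<Sum>j. ennreal (24 * (3/2) ^ j) * band_integral (Suc n + j) u)"
    using band_integral_Suc[OF Suc.prems] by (intro suminf_le mult_left_mono) auto
  finally show ?case .
qed

text \<open>The sum stops at the scale of \<open>d\<close> and is dominated by its last term; 20/17
  = 1 / (1 - 3/20).\<close>

lemma geometric_band_le:
  fixes d p :: real
  assumes "0 < d" "2 powr p = 20/3" "0 \<le> p"
  shows "(\<Sum>l<L. (20/3) ^ l * indicator {..1 / 2 ^ l} d) \<le> 20/17 / d powr p"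
proof (induction L)
  case (Suc L)
  show ?case
  proof (cases "d \<le> 1 / 2 ^ L")
    case True
    have "(\<Sum>l<Suc L. (20/3) ^ l * indicator {..1 / 2 ^ l} d) \<le> (\<Sum>l<Suc L. (20/3::real) ^ l)"
      by (intro sum_mono) (auto simp: indicator_def)
    also have "\<dots> \<le> 20/17 * (20/3) ^ L" by (induction L) auto
    also have "\<dots> \<le> 20/17 / d powr p"
    proof -
      have "d powr p \<le> (1 / 2 ^ L) powr p" using True assms by (intro powr_mono2) auto
      also have "(1 / 2 ^ L) powr p = 1 / (20/3) ^ L"
      proof -
        have "(2 ^ L) powr p = (2 powr p) ^ L"
          by (metis powr_realpow powr_powr powr_power mult.commute zero_less_numeral powr_gt_zero)
        moreover have "(1 / 2 ^ L) powr p = 1 / (2 ^ L) powr p" by (subst powr_divide) auto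
        ultimately show ?thesis unfolding assms(2) by (simp only:)
      qed
      finally have "1 / (1 / (20/3) ^ L) \<le> 1 / d powr p" using assms(1) by (intro divide_left_mono mult_pos_pos) auto
      then show ?thesis by simp
    qed
    finally show ?thesis .
  next
    case False
    then show ?thesis using Suc by simp
  qed
qed (use assms in simp)

text \<open>Tonelli's theorem moves the sum under the integral, where (5/3)^l 4^l = (20/3)^l turns
  it into the geometric sum that the kernel dominates.\<close>

lemma sum_band_integral_le_gagliardo:
  assumes u: "continuous_on UNIV u" and p: "2 powr p = 20/3" "0 \<le> p"
  shows "(\<Sum>l. ennreal ((5/3) ^ l) * band_integral l u) \<le> ennreal (20/17) * gagliardo p u"
proof -
  have [measurable]: "u \<in> borel_measurable borel" using u by (rule borel_measurable_continuous_onI)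
  let ?f = "\<lambda>l x y. ennreal (4 ^ l * (u x - u y)\<^sup>2 * indicator {..1 / 2 ^ l} \<bar>x - y\<bar>)"
  have m: "(\<lambda>x. (\<integral>\<^sup>+y\<in>{0..1}. ?f l x y \<partial>lborel)) \<in> borel_measurable lborel" for l by measurable
  have "(\<Sum>l. ennreal ((5/3) ^ l) * band_integral l u) = (\<integral>\<^sup>+x. (\<Sum>l. ennreal ((5/3) ^ l) * ((\<integral>\<^sup>+y\<in>{0..1}. ?f l x y \<partial>lborel) * indicator {0..1} x)) \<partial>lborel)"
    unfolding band_integral_def using m by (subst nn_integral_suminf) (auto simp: nn_integral_cmult)
  also have "\<dots> \<le> (\<integral>\<^sup>+x. ennreal (20/17) * ((\<integral>\<^sup>+y\<in>{0..1}. ennreal ((u x - u y)\<^sup>2 / \<bar>x - y\<bar> powr p) \<partial>lborel) * indicator {0..1} x) \<partial>lborel)"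
  proof (rule nn_integral_mono)
    fix x :: real
    have "(\<Sum>l. ennreal ((5/3) ^ l) * (\<integral>\<^sup>+y\<in>{0..1}. ?f l x y \<partial>lborel))
      = (\<integral>\<^sup>+y. (\<Sum>l. ennreal ((5/3) ^ l) * (?f l x y * indicator {0..1} y)) \<partial>lborel)"
      by (subst nn_integral_suminf) (auto simp: nn_integral_cmult)
    also have "\<dots> \<le> (\<integral>\<^sup>+y. ennreal (20/17) * (ennreal ((u x - u y)\<^sup>2 / \<bar>x - y\<bar> powr p) * indicator {0..1} y) \<partial>lborel)"
    proof (rule nn_integral_mono)
      fix y :: real
      have "(\<Sum>l. ennreal ((5/3) ^ l) * ?f l x y) \<le> ennreal (20/17 * ((u x - u y)\<^sup>2 / \<bar>x - y\<bar> powr p))"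
      proof (rule suminf_le_const[OF summableI])
        fix L
        have e: "ennreal ((5/3) ^ l) * ?f l x y = ennreal ((u x - u y)\<^sup>2 * ((20/3) ^ l * indicator {..1 / 2 ^ l} \<bar>x - y\<bar>))" for l
        proof -
          have "(20/3 :: real) ^ l = (5/3) ^ l * 4 ^ l" by (simp flip: power_mult_distrib)
          then show ?thesis by (subst ennreal_mult[symmetric]) (auto simp: mult_ac)
        qed
        have "(\<Sum>l<L. ennreal ((5/3) ^ l) * ?f l x y) = ennreal ((u x - u y)\<^sup>2 * (\<Sum>l<L. (20/3) ^ l * indicator {..1 / 2 ^ l} \<bar>x - y\<bar>))"
          unfolding e sum_distrib_left by (rule sum_ennreal) simp
        also have "\<dots> \<le> ennreal (20/17 * ((u x - u y)\<^sup>2 / \<bar>x - y\<bar> powr p))"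
        proof (cases "x = y")
          case False
          then show ?thesis
            using mult_left_mono[OF geometric_band_le[of "\<bar>x - y\<bar>" p L], of "(u x - u y)\<^sup>2"] p
            by (intro ennreal_leI) (simp add: mult_ac)
        qed simp
        finally show "(\<Sum>l<L. ennreal ((5/3) ^ l) * ?f l x y) \<le> ennreal (20/17 * ((u x - u y)\<^sup>2 / \<bar>x - y\<bar> powr p))" .
      qed
      also have "\<dots> = ennreal (20/17) * ennreal ((u x - u y)\<^sup>2 / \<bar>x - y\<bar> powr p)"
        by (rule ennreal_mult) auto
      finally have *: "(\<Sum>l. ennreal ((5/3) ^ l) * ?f l x y) \<le> ennreal (20/17) * ennreal ((u x - u y)\<^sup>2 / \<bar>x - y\<bar> powr p)" .
      show "(\<Sum>l. ennreal ((5/3) ^ l) * (?f l x y * indicator {0..1} y)) \<le> ennreal (20/17) * (ennreal ((u x - u y)\<^sup>2 / \<bar>x - y\<bar> powr p) * indicator {0..1} y)"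
      proof (cases "y \<in> {0..1}")
        case True
        show ?thesis unfolding indicator_simps(1)[OF True] mult_1_right by (rule *)
      qed simp
    qed
    also have "\<dots> = ennreal (20/17) * (\<integral>\<^sup>+y\<in>{0..1}. ennreal ((u x - u y)\<^sup>2 / \<bar>x - y\<bar> powr p) \<partial>lborel)"
      by (rule nn_integral_cmult) measurable
    finally have *: "(\<Sum>l. ennreal ((5/3) ^ l) * (\<integral>\<^sup>+y\<in>{0..1}. ?f l x y \<partial>lborel)) \<le> \<dots>" .
    show "(\<Sum>l. ennreal ((5/3) ^ l) * ((\<integral>\<^sup>+y\<in>{0..1}. ?f l x y \<partial>lborel) * indicator {0..1} x))
       \<le> ennreal (20/17) * ((\<integral>\<^sup>+y\<in>{0..1}. ennreal ((u x - u y)\<^sup>2 / \<bar>x - y\<bar> powr p) \<partial>lborel) * indicator {0..1} x)"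
    proof (cases "x \<in> {0..1}")
      case True
      show ?thesis unfolding indicator_simps(1)[OF True] mult_1_right by (rule *)
    qed simp
  qed
  also have "\<dots> = ennreal (20/17) * gagliardo p u"
    unfolding gagliardo_def by (rule nn_integral_cmult) measurable
  finally show ?thesis .
qed

lemma suminf_shift_le: "(\<Sum>n<N. f (n + j)) \<le> (\<Sum>l. f l)" for f :: "nat \<Rightarrow> ennreal"
proof -
  have "(\<Sum>n<N. f (n + j)) = (\<Sum>l\<in>(\<lambda>n. n + j) ` {..<N}. f l)"
    by (subst sum.reindex) (auto simp: inj_on_def)
  also have "\<dots> \<le> (\<Sum>l<N + j. f l)" by (intro sum_mono2) auto
  also have "\<dots> \<le> (\<Sum>l. f l)" by (rule sum_le_suminf) auto
  finally show ?thesis .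
qed

text \<open>Writing (5/3)^n (3/2)^j as (9/10)^j (5/3)^(n+j) separates a convergent series in
  \<open>j\<close> from a shift of one series in n + j. The constant is 24 times 10 times 20/17,
  which is below 300.\<close>

lemma sum_dyadic_energy_le_gagliardo_UNIV:
  assumes u: "continuous_on UNIV u" and p: "2 powr p = 20/3" "0 \<le> p"
  shows "ennreal (\<Sum>n<N. (5/3) ^ n * dyadic_energy n u) \<le> ennreal 300 * gagliardo p u"
proof -
  let ?Z = "\<lambda>l. ennreal ((5/3) ^ l) * band_integral l u"
  have e: "ennreal ((5/3) ^ n) * (ennreal (24 * (3/2) ^ j) * band_integral (n + j) u) = ennreal (24 * (9/10) ^ j) * ?Z (n + j)" for n j
  proof -
    have "(5/3) ^ n * (24 * (3/2) ^ j) = 24 * (9/10) ^ j * (5/3 :: real) ^ (n + j)"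
      by (simp add: power_add flip: power_mult_distrib)
    then have "ennreal ((5/3) ^ n) * ennreal (24 * (3/2) ^ j) = ennreal (24 * (9/10) ^ j) * ennreal ((5/3) ^ (n + j))"
      by (subst (1 2) ennreal_mult[symmetric]) auto
    then show ?thesis by (simp only: mult.assoc[symmetric])
  qed
  have "ennreal (\<Sum>n<N. (5/3) ^ n * dyadic_energy n u) = (\<Sum>n<N. ennreal ((5/3) ^ n) * ennreal (dyadic_energy n u))"
    by (subst sum_ennreal[symmetric]) (auto simp: ennreal_mult)
  also have "\<dots> \<le> (\<Sum>n<N. ennreal ((5/3) ^ n) * (\<Sum>j. ennreal (24 * (3/2) ^ j) * band_integral (n + j) u))"
    by (intro sum_mono mult_left_mono dyadic_energy_le_band_integral u) auto
  also have "\<dots> = (\<Sum>n<N. \<Sum>j. ennreal (24 * (9/10) ^ j) * ?Z (n + j))"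
    unfolding ennreal_suminf_cmult[symmetric] e ..
  also have "\<dots> = (\<Sum>j. \<Sum>n<N. ennreal (24 * (9/10) ^ j) * ?Z (n + j))"
    by (rule suminf_sum[symmetric]) auto
  also have "\<dots> \<le> (\<Sum>j. ennreal (24 * (9/10) ^ j) * (\<Sum>l. ?Z l))"
  proof (intro suminf_le summableI)
    fix j
    show "(\<Sum>n<N. ennreal (24 * (9/10) ^ j) * ?Z (n + j)) \<le> ennreal (24 * (9/10) ^ j) * (\<Sum>l. ?Z l)"
      unfolding sum_distrib_left[symmetric] by (intro mult_left_mono suminf_shift_le) auto
  qed
  also have "\<dots> = (\<Sum>j. ennreal (24 * (9/10) ^ j)) * (\<Sum>l. ?Z l)" by (rule ennreal_suminf_multc)
  also have "(\<Sum>j. ennreal (24 * (9/10) ^ j)) = ennreal 240"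
  proof -
    have "(\<lambda>j. 24 * (9/10 :: real) ^ j) sums (24 * (1 / (1 - 9/10)))"
      by (intro sums_mult geometric_sums) auto
    then show ?thesis by (intro suminf_ennreal_eq) auto
  qed
  also have "ennreal 240 * (\<Sum>l. ?Z l) \<le> ennreal 240 * (ennreal (20/17) * gagliardo p u)"
    by (intro mult_left_mono sum_band_integral_le_gagliardo u p) auto
  also have "\<dots> = ennreal (240 * (20/17)) * gagliardo p u" by (subst ennreal_mult) (auto simp: mult.assoc)
  also have "\<dots> \<le> ennreal 300 * gagliardo p u" by (intro mult_right_mono ennreal_leI) auto
  finally show ?thesis .
qed

lemma sum_dyadic_energy_le_gagliardo:
  assumes u: "continuous_on {0..1} u" and p: "2 powr p = 20/3" "0 \<le> p"
  shows "ennreal (\<Sum>n<N. (5/3) ^ n * dyadic_energy n u) \<le> ennreal 300 * gagliardo p u"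
proof -
  \<comment> \<open>Constant continuation beyond the ends keeps all values on the unit interval and
    gives continuity, hence Borel measurability, on the whole line.\<close>
  define v where "v x = u (max 0 (min 1 x))" for x
  have v: "continuous_on UNIV v" unfolding v_def
    by (rule continuous_on_compose2[OF u]) (auto intro!: continuous_intros)
  have uv: "v x = u x" if "x \<in> {0..1}" for x using that by (simp add: v_def)
  have "real k / 2 ^ n \<in> {0..1}" if "k \<le> 2 ^ n" for k n
  proof -
    have "real k \<le> 2 ^ n" using that by (metis of_nat_le_iff of_nat_numeral of_nat_power)
    then show ?thesis by simp
  qed
  then have d: "dyadic_energy n v = dyadic_energy n u" for n
    unfolding dyadic_energy_def by (intro sum.cong refl) (metis uv lessThan_iff Suc_leI less_imp_le)
  have "gagliardo p v = gagliardo p u" unfolding gagliardo_def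
    by (intro nn_integral_cong) (auto simp: indicator_def uv intro!: nn_integral_cong)
  then show ?thesis using sum_dyadic_energy_le_gagliardo_UNIV[OF v p, of N] by (simp only: d)
qed

section \<open>Trace and extension theorems\<close>

lemma exponent_eq:
  fixes \<beta> :: real
  assumes "\<beta> = 1/2 + ln (5/3) / ln 4"
  shows "2 powr (1 + 2 * \<beta>) = 20/3" "0 \<le> 1 + 2 * \<beta>"
proof -
  have l4: "ln (4::real) = 2 * ln 2" using ln_realpow[of 2 2] by simp
  have b: "(1 + 2 * \<beta>) * ln 2 = ln 4 + ln (5/3)"
    unfolding assms l4 by (simp add: field_simps)
  have "2 powr (1 + 2 * \<beta>) = exp (ln 4 + ln (5/3))" unfolding powr_def b[symmetric] by simp
  also have "\<dots> = 20/3" by (simp add: exp_add)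
  finally show "2 powr (1 + 2 * \<beta>) = 20/3" .
  have "0 \<le> ln (5/3::real)" "0 \<le> ln (4::real)" by simp_all
  then show "0 \<le> 1 + 2 * \<beta>" unfolding assms by simp
qed

text \<open>The factor by which the seminorm changes when an edge of length 2^-m is stretched to
  unit length: two Jacobians against the homogeneity of the kernel. It equals (5/3)^m when 2^p =
  20/3.\<close>

definition edge_scale :: "real \<Rightarrow> nat \<Rightarrow> real" where
  "edge_scale p m = (1/2) ^ m * (1/2) ^ m / ((1/2) ^ m) powr p"

lemma edge_scale_pos: "0 < edge_scale p m"
  by (simp add: edge_scale_def)

lemma gagliardo_cong: "(\<And>x. x \<in> {0..1} \<Longrightarrow> u x = v x) \<Longrightarrow> gagliardo p u = gagliardo p v"
  unfolding gagliardo_def by (intro nn_integral_cong) (auto simp: indicator_def intro!: nn_integral_cong)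

lemma gagliardo_scale:
  assumes h: "continuous_on {0..1} h"
  shows "(\<integral>\<^sup>+x\<in>{0..(1/2)^m}. \<integral>\<^sup>+y\<in>{0..(1/2)^m}. ennreal (\<bar>h (x * 2 ^ m) - h (y * 2 ^ m)\<bar>\<^sup>2 / \<bar>x - y\<bar> powr p) \<partial>lborel \<partial>lborel)
     = ennreal (edge_scale p m) * gagliardo p h"
proof -
  define v where "v x = h (max 0 (min 1 x))" for x
  have v: "continuous_on UNIV v" unfolding v_def
    by (rule continuous_on_compose2[OF h]) (auto intro!: continuous_intros)
  have [measurable]: "v \<in> borel_measurable borel" using v by (rule borel_measurable_continuous_onI)
  have hv: "v x = h x" if "x \<in> {0..1}" for x using that by (simp add: v_def)
  define c :: real where "c = (1/2) ^ m"
  have c: "0 < c" "c * 2 ^ m = 1" by (simp_all add: c_def power_divide)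
  define f where "f x y = ennreal ((v (x * 2 ^ m) - v (y * 2 ^ m))\<^sup>2 / \<bar>x - y\<bar> powr p)" for x y
  have f: "(\<lambda>z. f (fst z) (snd z)) \<in> borel_measurable (borel \<Otimes>\<^sub>M borel)" unfolding f_def by measurable
  have sc: "x * 2 ^ m \<in> {0..1}" if "x \<in> {0..c}" for x
    using mult_right_mono[of x c "2 ^ m"] that c by auto
  have e: "f (0 + c * x) (0 + c * y) = ennreal (1 / c powr p) * ennreal ((v x - v y)\<^sup>2 / \<bar>x - y\<bar> powr p)" for x y
  proof -
    have "c * z * 2 ^ m = (c * 2 ^ m) * z" for z by (simp only: mult_ac)
    then have 1: "(0 + c * z) * 2 ^ m = z" for z unfolding c(2) by simp
    have "0 + c * x - (0 + c * y) = c * (x - y)" by (simp add: right_diff_distrib)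
    then have 2: "\<bar>0 + c * x - (0 + c * y)\<bar> = c * \<bar>x - y\<bar>" using c(1) by (simp only: abs_mult abs_of_pos)
    have 3: "(c * \<bar>x - y\<bar>) powr p = c powr p * \<bar>x - y\<bar> powr p" using c(1) by (simp add: powr_mult)
    show ?thesis unfolding f_def 1 2 3 by (subst ennreal_mult[symmetric]) simp_all
  qed
  have "(\<integral>\<^sup>+x\<in>{0..c}. \<integral>\<^sup>+y\<in>{0..c}. ennreal (\<bar>h (x * 2 ^ m) - h (y * 2 ^ m)\<bar>\<^sup>2 / \<bar>x - y\<bar> powr p) \<partial>lborel \<partial>lborel)
    = (\<integral>\<^sup>+x\<in>{0..c}. \<integral>\<^sup>+y\<in>{0..c}. f x y \<partial>lborel \<partial>lborel)"
  proof (rule nn_integral_cong)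
    fix x :: real
    show "(\<integral>\<^sup>+y\<in>{0..c}. ennreal (\<bar>h (x * 2 ^ m) - h (y * 2 ^ m)\<bar>\<^sup>2 / \<bar>x - y\<bar> powr p) \<partial>lborel) * indicator {0..c} x
      = (\<integral>\<^sup>+y\<in>{0..c}. f x y \<partial>lborel) * indicator {0..c} x"
    proof (cases "x \<in> {0..c}")
      case True
      have "(\<integral>\<^sup>+y\<in>{0..c}. ennreal (\<bar>h (x * 2 ^ m) - h (y * 2 ^ m)\<bar>\<^sup>2 / \<bar>x - y\<bar> powr p) \<partial>lborel) = (\<integral>\<^sup>+y\<in>{0..c}. f x y \<partial>lborel)"
      proof (rule nn_integral_cong)
        fix y :: real
        show "ennreal (\<bar>h (x * 2 ^ m) - h (y * 2 ^ m)\<bar>\<^sup>2 / \<bar>x - y\<bar> powr p) * indicator {0..c} y = f x y * indicator {0..c} y"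
        proof (cases "y \<in> {0..c}")
          case y: True
          show ?thesis unfolding f_def hv[OF sc[OF True]] hv[OF sc[OF y]] by simp
        qed simp
      qed
      then show ?thesis by simp
    qed simp
  qed
  also have "\<dots> = ennreal c * ennreal c * (\<integral>\<^sup>+x\<in>{0..1}. \<integral>\<^sup>+y\<in>{0..1}. f (0 + c * x) (0 + c * y) \<partial>lborel \<partial>lborel)"
    using set_nn_integral_affine2[OF f c(1) c(1), of 0 0] by simp
  also have "(\<integral>\<^sup>+x\<in>{0..1}. \<integral>\<^sup>+y\<in>{0..1}. f (0 + c * x) (0 + c * y) \<partial>lborel \<partial>lborel) = ennreal (1 / c powr p) * gagliardo p v"
    unfolding e gagliardo_def by (simp add: mult.assoc nn_integral_cmult)
  also have "ennreal c * ennreal c * (ennreal (1 / c powr p) * gagliardo p v) = ennreal (c * c * (1 / c powr p)) * gagliardo p v"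
  proof -
    have "ennreal (c * c * r) = ennreal c * ennreal c * ennreal r" if "0 \<le> r" for r
      using that c(1) by (simp add: ennreal_mult)
    from this[of "1 / c powr p"] show ?thesis by (simp add: mult.assoc)
  qed
  also have "c * c * (1 / c powr p) = edge_scale p m" by (simp add: edge_scale_def c_def)
  also have "gagliardo p v = gagliardo p h" by (rule gagliardo_cong) (rule hv)
  finally show ?thesis unfolding c_def .
qed

lemma edge_eq: "edge m w i j x = Phiw w (side_point i j (x * 2 ^ m))"
  unfolding edge_def side_point_def Phiw_affine ..

lemma sum_edges:
  fixes h :: "nat list \<Rightarrow> nat \<Rightarrow> nat \<Rightarrow> 'a::comm_monoid_add"
  shows "(\<Sum>(w, i, j)\<in>edges m. h w i j) = (\<Sum>w\<in>words m. h w 0 1 + h w 1 2 + h w 0 2)"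
proof -
  have "edges m = words m \<times> {(0, 1), (1, 2), (0, 2)}"
    by (auto simp: edges_def elim: less3E)
  then have "(\<Sum>(w, i, j)\<in>edges m. h w i j) = (\<Sum>w\<in>words m. \<Sum>(i, j)\<in>{(0, 1), (1, 2), (0, 2)}. h w i j)"
    by (simp only: sum.cartesian_product)
  then show ?thesis by (simp add: add.assoc)
qed

lemma finite_edges [simp]: "finite (edges m)"
proof (rule finite_subset)
  show "edges m \<subseteq> words m \<times> {..<3} \<times> {..<3}" by (auto simp: edges_def)
qed simp

definition edge_fun :: "(complex \<Rightarrow> real) \<Rightarrow> nat list \<Rightarrow> nat \<Rightarrow> nat \<Rightarrow> real \<Rightarrow> real" where
  "edge_fun f w i j s = f (Phiw w (side_point i j s))"

lemma dyadic_energy_edge_fun: "dyadic_energy n (edge_fun f w i j) = side_energy n i j (f \<circ> Phiw w)"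
  unfolding side_energy_eq_dyadic_energy edge_fun_def comp_apply ..

lemma Hnorm2_eq:
  assumes "\<And>w i j. (w, i, j) \<in> edges m \<Longrightarrow> continuous_on {0..1} (edge_fun f w i j)"
  shows "Hnorm2 \<beta> m f = ennreal (edge_scale (1 + 2 * \<beta>) m) * (\<Sum>(w, i, j)\<in>edges m. gagliardo (1 + 2 * \<beta>) (edge_fun f w i j))"
proof -
  have "Hnorm2 \<beta> m f = (\<Sum>(w, i, j)\<in>edges m. ennreal (edge_scale (1 + 2 * \<beta>) m) * gagliardo (1 + 2 * \<beta>) (edge_fun f w i j))"
    unfolding Hnorm2_def
  proof (rule sum.cong[OF refl], clarify)
    fix w i j assume "(w, i, j) \<in> edges m"
    then show "(\<integral>\<^sup>+x\<in>{0..(1/2)^m}. \<integral>\<^sup>+y\<in>{0..(1/2)^m}. ennreal (\<bar>f (edge m w i j x) - f (edge m w i j y)\<bar>\<^sup>2 / \<bar>x - y\<bar> powr (1 + 2 * \<beta>)) \<partial>lborel \<partial>lborel)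
      = ennreal (edge_scale (1 + 2 * \<beta>) m) * gagliardo (1 + 2 * \<beta>) (edge_fun f w i j)"
      using gagliardo_scale[OF assms, of w i j m "1 + 2 * \<beta>"] by (simp only: edge_eq edge_fun_def)
  qed
  then show ?thesis by (simp add: sum_distrib_left case_prod_beta')
qed

lemma continuous_Phiw [continuous_intros]: "continuous_on S g \<Longrightarrow> continuous_on S (\<lambda>x. Phiw w (g x))"
  by (induction w) (simp_all add: continuous_Phi)

lemma edge_fun_continuous_SG:
  assumes "continuous_on SG f" "(w, i, j) \<in> edges m"
  shows "continuous_on {0..1} (edge_fun f w i j)"
  unfolding edge_fun_def
proof (rule continuous_on_compose2[OF assms(1)])
  show "continuous_on {0..1} (\<lambda>s. Phiw w (side_point i j s))" by (intro continuous_intros)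
  show "(\<lambda>s. Phiw w (side_point i j s)) ` {0..1} \<subseteq> SG"
    using assms(2) by (auto intro!: Phiw_SG side_point_SG simp: edges_def words_def)
qed

lemma SGm_iff: "x \<in> SGm m \<longleftrightarrow> (\<exists>w i j s. (w, i, j) \<in> edges m \<and> s \<in> {0..1} \<and> x = Phiw w (side_point i j s))"
proof
  assume "x \<in> SGm m"
  then obtain w i j t where t: "(w, i, j) \<in> edges m" "t \<in> {0..(1/2)^m}" "x = edge m w i j t"
    by (auto simp: SGm_def)
  have "t * 2 ^ m \<le> (1/2) ^ m * 2 ^ m" using t(2) by (intro mult_right_mono) auto
  then have "t * 2 ^ m \<in> {0..1}" using t(2) by (simp add: power_divide)
  then show "\<exists>w i j s. (w, i, j) \<in> edges m \<and> s \<in> {0..1} \<and> x = Phiw w (side_point i j s)"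
    using t edge_eq by blast
next
  assume "\<exists>w i j s. (w, i, j) \<in> edges m \<and> s \<in> {0..1} \<and> x = Phiw w (side_point i j s)"
  then obtain w i j s where s: "(w, i, j) \<in> edges m" "s \<in> {0..1}" "x = Phiw w (side_point i j s)" by blast
  have "x = edge m w i j (s * (1/2) ^ m)" by (simp add: edge_eq s(3) power_divide)
  moreover have "s * (1/2) ^ m \<in> {0..(1/2)^m}" using s(2) by (simp add: mult_le_cancel_right1)
  ultimately show "x \<in> SGm m" using s(1) unfolding SGm_def by blast
qed

lemma edge_fun_continuous_SGm:
  assumes "continuous_on (SGm m) f" "(w, i, j) \<in> edges m"
  shows "continuous_on {0..1} (edge_fun f w i j)"
  unfolding edge_fun_def
proof (rule continuous_on_compose2[OF assms(1)])
  show "continuous_on {0..1} (\<lambda>s. Phiw w (side_point i j s))" by (intro continuous_intros)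
  show "(\<lambda>s. Phiw w (side_point i j s)) ` {0..1} \<subseteq> SGm m"
    using assms(2) SGm_iff by blast
qed

text \<open>Every edge is bounded separately by the full energy, hence the number of edges in the
  constant. 24000 is 800 times 30, and 60 has become 30 because \<open>energy\<close> counts ordered
  pairs.\<close>

lemma trace_bound:
  assumes p: "2 powr (1 + 2 * \<beta>) = 20/3" and F: "F \<in> dom_energy"
  shows "Hnorm2 \<beta> m F \<le> ennreal (edge_scale (1 + 2 * \<beta>) m * (card (edges m) * 24000) * energy F)"
proof -
  have cF: "continuous_on SG F" using F by (simp add: dom_energy_def)
  have "gagliardo (1 + 2 * \<beta>) (edge_fun F w i j) \<le> ennreal (800 * (30 * energy F))" if e: "(w, i, j) \<in> edges m" for w i j
  proof (rule gagliardo_le[OF edge_fun_continuous_SG[OF cF e] p])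
    fix N
    have "(\<Sum>n\<le>N. (5/3) ^ n * side_energy n i j (F \<circ> Phiw w)) \<le> 60 * scaled_energy N (F \<circ> Phiw w)"
      using e by (intro sum_side_energy_le_scaled_energy) (auto simp: edges_def)
    moreover have "scaled_energy N (F \<circ> Phiw w) \<le> scaled_energy (m + N) F" using e by (intro scaled_energy_comp_le) (auto simp: edges_def)
    moreover have "2 * scaled_energy (m + N) F \<le> energy F" by (rule scaled_energy_le_energy[OF F])
    ultimately show "(\<Sum>n\<le>N. (5/3) ^ n * dyadic_energy n (edge_fun F w i j)) \<le> 30 * energy F"
      unfolding dyadic_energy_edge_fun by linarith
  qed
  then have "(\<Sum>(w, i, j)\<in>edges m. gagliardo (1 + 2 * \<beta>) (edge_fun F w i j)) \<le> of_nat (card (edges m)) * ennreal (800 * (30 * energy F))"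
    by (intro sum_bounded_above) auto
  then have "ennreal (edge_scale (1 + 2 * \<beta>) m) * (\<Sum>(w, i, j)\<in>edges m. gagliardo (1 + 2 * \<beta>) (edge_fun F w i j))
      \<le> ennreal (edge_scale (1 + 2 * \<beta>) m) * (of_nat (card (edges m)) * ennreal (800 * (30 * energy F)))"
    by (rule mult_left_mono) simp
  moreover have "Hnorm2 \<beta> m F = ennreal (edge_scale (1 + 2 * \<beta>) m) * (\<Sum>(w, i, j)\<in>edges m. gagliardo (1 + 2 * \<beta>) (edge_fun F w i j))"
    by (rule Hnorm2_eq) (rule edge_fun_continuous_SG[OF cF])
  ultimately have "Hnorm2 \<beta> m F \<le> ennreal (edge_scale (1 + 2 * \<beta>) m) * (of_nat (card (edges m)) * ennreal (800 * (30 * energy F)))"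
    by simp
  also have "\<dots> = ennreal (edge_scale (1 + 2 * \<beta>) m * (real (card (edges m)) * (800 * (30 * energy F))))"
    using energy_nonneg[OF F] edge_scale_pos[of "1 + 2 * \<beta>" m]
    by (subst (1 2) ennreal_mult) (auto simp: ennreal_of_nat_eq_real_of_nat)
  also have "edge_scale (1 + 2 * \<beta>) m * (real (card (edges m)) * (800 * (30 * energy F))) = edge_scale (1 + 2 * \<beta>) m * (card (edges m) * 24000) * energy F"
    by simp
  finally show ?thesis .
qed

lemma scaled_energy_vertex_extension_le:
  "scaled_energy (m + n) (vertex_extension m f) \<le> (5/3) ^ m * (\<Sum>(w, i, j)\<in>edges m. 20 * (\<Sum>k<Suc n. (5/3) ^ k * dyadic_energy k (edge_fun f w i j)))"
proof -
  let ?S = "\<lambda>w i j. \<Sum>k<Suc n. (5/3) ^ k * dyadic_energy k (edge_fun f w i j)"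
  have "(5/3) ^ n * refined_energy {..<3} n (f \<circ> Phiw w) \<le> 20 * ?S w 0 1 + 20 * ?S w 1 2 + 20 * ?S w 0 2" for w
  proof -
    have "side_budget n i j (f \<circ> Phiw w) \<le> 2 * ?S w i j" for i j
      using side_budget_le[of n i j "f \<circ> Phiw w"] by (simp only: dyadic_energy_edge_fun lessThan_Suc_atMost)
    from refined_energy_three[of n "f \<circ> Phiw w"] this[of 0 1] this[of 1 2] this[of 0 2] show ?thesis by argo
  qed
  then show ?thesis unfolding scaled_energy_vertex_extension sum_edges by (intro mult_left_mono sum_mono) auto
qed

text \<open>A real bound \<open>M\<close> for all levels is produced together with its exact value
  in terms of the seminorm; the former is needed to extend to the gasket, the latter for the norm
  estimate. 6000 is 20 times 300, and 12000 doubles it for ordered pairs.\<close>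

lemma extension_bound:
  assumes p: "2 powr (1 + 2 * \<beta>) = 20/3" "0 \<le> 1 + 2 * \<beta>" and f: "f \<in> Hspace \<beta> m"
  obtains M where "\<And>n. scaled_energy n (vertex_extension m f) \<le> M"
    "ennreal (2 * M) = ennreal (12000 * (5/3) ^ m / edge_scale (1 + 2 * \<beta>) m) * Hnorm2 \<beta> m f"
proof -
  let ?p = "1 + 2 * \<beta>" and ?\<kappa> = "edge_scale (1 + 2 * \<beta>) m"
  let ?g = "\<lambda>w i j. gagliardo ?p (edge_fun f w i j)"
  have cf: "continuous_on {0..1} (edge_fun f w i j)" if "(w, i, j) \<in> edges m" for w i j
    using edge_fun_continuous_SGm f that by (auto simp: Hspace_def)
  have H: "Hnorm2 \<beta> m f = ennreal ?\<kappa> * (\<Sum>(w, i, j)\<in>edges m. ?g w i j)" by (rule Hnorm2_eq[OF cf])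
  have "Hnorm2 \<beta> m f < \<infinity>" using f by (simp add: Hspace_def)
  then have "(\<Sum>(w, i, j)\<in>edges m. ?g w i j) < \<infinity>"
    unfolding H using edge_scale_pos[of ?p m] by (auto simp: ennreal_mult_less_top ennreal_mult_eq_top_iff less_top)
  then have fin: "?g w i j < \<infinity>" if "(w, i, j) \<in> edges m" for w i j
    using that by (auto simp: less_top)
  \<comment> \<open>Finiteness of the whole seminorm makes every edge term finite, so the bound can
    be stated in the reals.\<close>
  define G where "G w i j = enn2real (?g w i j)" for w i j
  have G: "ennreal (G w i j) = ?g w i j" if "(w, i, j) \<in> edges m" for w i j
    using fin[OF that] by (simp add: G_def ennreal_enn2real less_top)
  have G0: "0 \<le> G w i j" for w i j by (simp add: G_def)
  define M where "M = (5/3) ^ m * (\<Sum>(w, i, j)\<in>edges m. 6000 * G w i j)"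
  have S: "(\<Sum>k<N. (5/3) ^ k * dyadic_energy k (edge_fun f w i j)) \<le> 300 * G w i j" if e: "(w, i, j) \<in> edges m" for w i j N
  proof -
    have "ennreal (\<Sum>k<N. (5/3) ^ k * dyadic_energy k (edge_fun f w i j)) \<le> ennreal 300 * ?g w i j"
      by (rule sum_dyadic_energy_le_gagliardo[OF cf[OF e] p])
    also have "\<dots> = ennreal (300 * G w i j)" unfolding G[OF e, symmetric] by (rule ennreal_mult[symmetric]) (auto simp: G0)
    finally show ?thesis using G0 by (simp add: ennreal_le_iff)
  qed
  have "scaled_energy (m + n) (vertex_extension m f) \<le> M" for n
  proof -
    have "(\<Sum>(w, i, j)\<in>edges m. 20 * (\<Sum>k<Suc n. (5/3) ^ k * dyadic_energy k (edge_fun f w i j))) \<le> (\<Sum>(w, i, j)\<in>edges m. 6000 * G w i j)"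
    proof (rule sum_mono, clarify)
      fix w i j assume "(w, i, j) \<in> edges m"
      from S[OF this, of "Suc n"]
      show "20 * (\<Sum>k<Suc n. (5/3) ^ k * dyadic_energy k (edge_fun f w i j)) \<le> 6000 * G w i j" by linarith
    qed
    then have "(5/3) ^ m * (\<Sum>(w, i, j)\<in>edges m. 20 * (\<Sum>k<Suc n. (5/3) ^ k * dyadic_energy k (edge_fun f w i j))) \<le> M"
      unfolding M_def by (rule mult_left_mono) simp
    with scaled_energy_vertex_extension_le show ?thesis by (rule order_trans)
  qed
  \<comment> \<open>The formula covers levels from \<open>m\<close> on; lower levels follow by
    monotonicity.\<close>
  then have 1: "scaled_energy n (vertex_extension m f) \<le> M" for n
    using incseqD[OF incseq_scaled_energy, of n "m + n" "vertex_extension m f"] order_trans by (meson le_add2)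
  have "2 * M = 12000 * (5/3) ^ m * (\<Sum>(w, i, j)\<in>edges m. G w i j)"
    unfolding M_def by (simp add: case_prod_beta' flip: sum_distrib_left)
  then have "ennreal (2 * M) = ennreal (12000 * (5/3) ^ m) * ennreal (\<Sum>(w, i, j)\<in>edges m. G w i j)"
    using G0 by (simp only:) (rule ennreal_mult, auto intro!: sum_nonneg)
  also have "ennreal (\<Sum>(w, i, j)\<in>edges m. G w i j) = (\<Sum>(w, i, j)\<in>edges m. ?g w i j)"
    using G G0 by (subst sum_ennreal[symmetric]) (auto intro!: sum.cong)
  also have "ennreal (12000 * (5/3) ^ m) = ennreal (12000 * (5/3) ^ m / ?\<kappa>) * ennreal ?\<kappa>"
    using edge_scale_pos[of ?p m] by (subst ennreal_mult[symmetric]) auto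
  finally have "ennreal (2 * M) = ennreal (12000 * (5/3) ^ m / ?\<kappa>) * Hnorm2 \<beta> m f"
    unfolding H by (simp only: mult.assoc)
  with 1 show ?thesis by (rule that)
qed

text \<open>Both sides agree at the dyadic points of every edge, which are vertices, and both are
  continuous along the edge.\<close>

lemma gasket_extension_vertex_extension_SGm:
  assumes f: "continuous_on (SGm m) f" and M: "\<And>n. scaled_energy n (vertex_extension m f) \<le> M" and x: "x \<in> SGm m"
  shows "gasket_extension (vertex_extension m f) x = f x"
proof -
  obtain w i j s where e: "(w, i, j) \<in> edges m" and s: "s \<in> {0..1}" and xe: "x = Phiw w (side_point i j s)"
    using x SGm_iff by blast
  have w: "w \<in> words m" "set w \<subseteq> {..<3}" and ij: "i < 3" "j < 3" "i \<noteq> j" using e by (auto simp: edges_def words_def)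
  obtain l where l: "l < 3" "l \<noteq> i" "l \<noteq> j" "{i, j, l} = {0, 1, 2}" by (rule third_index[OF ij])
  let ?y = "\<lambda>n. side_point i j (dyadic_floor n s)"
  have V: "?y n \<in> vertices" for n using s ij by (intro side_point_dyadic_floor_vertices) auto
  have eq: "gasket_extension (vertex_extension m f) (Phiw w (?y n)) = f (Phiw w (?y n))" for n
    using gasket_extension(2)[OF M Phiw_vertices[OF w(2) V]] vertex_extension_side[OF w(1) V l(1) bary_side_point[OF l(1) ij(1,2) l(2,3)]] by simp
  have d: "(\<lambda>n. dyadic_floor n s) \<longlonglongrightarrow> s" using s by (intro dyadic_floor_tendsto) auto
  have r: "dyadic_floor n s \<in> {0..1}" for n using dyadic_floor_range[of s n] s by simp
  have "(\<lambda>n. edge_fun (gasket_extension (vertex_extension m f)) w i j (dyadic_floor n s)) \<longlonglongrightarrow> edge_fun (gasket_extension (vertex_extension m f)) w i j s"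
    using continuous_on_tendsto_compose[OF edge_fun_continuous_SG[OF gasket_extension(1)[OF M] e] d s] r by simp
  moreover have "(\<lambda>n. edge_fun f w i j (dyadic_floor n s)) \<longlonglongrightarrow> edge_fun f w i j s"
    using continuous_on_tendsto_compose[OF edge_fun_continuous_SGm[OF f e] d s] r by simp
  ultimately show ?thesis unfolding edge_fun_def eq xe by (rule LIMSEQ_unique)
qed

lemma gasket_extension_vertex_extension_linear:
  assumes f: "\<And>n. scaled_energy n (vertex_extension m f) \<le> M" and g: "\<And>n. scaled_energy n (vertex_extension m g) \<le> N" and x: "x \<in> SG"
  shows "gasket_extension (vertex_extension m (\<lambda>y. a * f y + b * g y)) x = a * gasket_extension (vertex_extension m f) x + b * gasket_extension (vertex_extension m g) x"
proof -
  have "(\<lambda>n. a * vertex_extension m f (approx_seq x n) + b * vertex_extension m g (approx_seq x n)) \<longlonglongrightarrow> a * gasket_extension (vertex_extension m f) x + b * gasket_extension (vertex_extension m g) x"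
    by (intro tendsto_intros gasket_extension(3)[OF f x] gasket_extension(3)[OF g x])
  then show ?thesis unfolding gasket_extension_def vertex_extension_linear[OF approx_seq(1)[OF x]] by (rule limI)
qed

theorem theorem5p2:
  fixes \<beta> :: real and m :: nat
  assumes "\<beta> = 1/2 + ln (5/3) / ln 4"
  shows "\<exists>c::real.
    (\<forall>F\<in>dom_energy. Hnorm2 \<beta> m F \<le> ennreal (c * energy F)) \<and>
    (\<exists>Ext :: (complex \<Rightarrow> real) \<Rightarrow> (complex \<Rightarrow> real).
       (\<forall>f\<in>Hspace \<beta> m. \<forall>g\<in>Hspace \<beta> m. \<forall>a b::real. \<forall>x\<in>SG.
           Ext (\<lambda>y. a * f y + b * g y) x = a * Ext f x + b * Ext g x) \<and>
       (\<forall>f\<in>Hspace \<beta> m.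
           Ext f \<in> dom_energy \<and>
           (\<forall>x\<in>SGm m. Ext f x = f x) \<and>
           ennreal (energy (Ext f)) \<le> ennreal c * Hnorm2 \<beta> m f))"
proof -
  note p = exponent_eq[OF assms]
  \<comment> \<open>Since \<open>edge_scale\<close> is (5/3)^m for this exponent, the extension
    constant \<open>c2\<close> has the value 12000 for every \<open>m\<close>; the trace constant
    \<open>c1\<close> grows with \<open>m\<close>.\<close>
  define c1 where "c1 = edge_scale (1 + 2 * \<beta>) m * (card (edges m) * 24000)"
  define c2 where "c2 = 12000 * (5/3) ^ m / edge_scale (1 + 2 * \<beta>) m"
  define Ext where "Ext f = gasket_extension (vertex_extension m f)" for f
  have 1: "Hnorm2 \<beta> m F \<le> ennreal (max c1 c2 * energy F)" if F: "F \<in> dom_energy" for F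
  proof -
    have "Hnorm2 \<beta> m F \<le> ennreal (c1 * energy F)" unfolding c1_def by (rule trace_bound[OF p(1) F])
    also have "\<dots> \<le> ennreal (max c1 c2 * energy F)"
      using energy_nonneg[OF F] by (intro ennreal_leI mult_right_mono) auto
    finally show ?thesis .
  qed
  have 2: "Ext (\<lambda>y. a * f y + b * g y) x = a * Ext f x + b * Ext g x"
    if f: "f \<in> Hspace \<beta> m" and g: "g \<in> Hspace \<beta> m" and x: "x \<in> SG" for f g a b x
  proof -
    obtain M where "\<And>n. scaled_energy n (vertex_extension m f) \<le> M" by (rule extension_bound[OF p f]) blast
    moreover obtain N where "\<And>n. scaled_energy n (vertex_extension m g) \<le> N" by (rule extension_bound[OF p g]) blast
    ultimately show ?thesis unfolding Ext_def using x by (rule gasket_extension_vertex_extension_linear)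
  qed
  have 3: "Ext f \<in> dom_energy \<and> (\<forall>x\<in>SGm m. Ext f x = f x) \<and> ennreal (energy (Ext f)) \<le> ennreal (max c1 c2) * Hnorm2 \<beta> m f"
    if f: "f \<in> Hspace \<beta> m" for f
  proof -
    obtain M where M: "\<And>n. scaled_energy n (vertex_extension m f) \<le> M" and e: "ennreal (2 * M) = ennreal c2 * Hnorm2 \<beta> m f"
      unfolding c2_def by (rule extension_bound[OF p f]) blast
    have "continuous_on (SGm m) f" using f by (simp add: Hspace_def)
    then have "\<forall>x\<in>SGm m. Ext f x = f x" unfolding Ext_def using gasket_extension_vertex_extension_SGm M by blast
    moreover have "ennreal (energy (Ext f)) \<le> ennreal (max c1 c2) * Hnorm2 \<beta> m f"
    proof -
      have "ennreal (energy (Ext f)) \<le> ennreal (2 * M)"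
        unfolding Ext_def by (rule ennreal_leI[OF gasket_extension_dom_energy(2)[OF M]])
      also have "\<dots> \<le> ennreal (max c1 c2) * Hnorm2 \<beta> m f"
        unfolding e by (intro mult_right_mono ennreal_leI) auto
      finally show ?thesis .
    qed
    ultimately show ?thesis unfolding Ext_def using gasket_extension_dom_energy(1)[OF M] by blast
  qed
  show ?thesis
    by (rule exI[of _ "max c1 c2"], rule conjI, use 1 in blast, rule exI[of _ Ext]) (use 2 3 in blast)
qed

end
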